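(* Let $\mathbf Q=\mathbf Q(F)$ be as in the context. Then $\mathbf Q$ is $\alpha$-proper for every $\alpha<\omega_1$, and $\mathbf Q$ has the strong $PP$-property.
   Context: $F$ is a filter on $\omega$ containing all cofinite sets which is a $P$-filter (for any $A_n\in F$, $n<\omega$, there is $A\in F$ with $A\subseteq^* A_n$ for all $n$) and such that the closed set $\bigcap_{A\in F}A^*\subseteq\omega^*$ satisfies ccc. Let $I=\{\omega\setminus A: A\in F\}$. A tree is a partial order $(T,\le_T)$ with $T\subseteq\omega$ such that for each $i\in T$ the set $\{j\in T: j\le_T i\}$ is linearly ordered, and $i\le_T j$ implies $i\le j$. For trees, $T\le_t S$ means that $(S,\le_S)$ is a suborder of $(T,\le_T)$ and each branch of $T$ contains cofinally a unique branch of $S$. $T^{(n)}$ is the subtree obtained by deleting all numbers $\le n$ from $T$. Fix a tree $T_0\in I$ order-isomorphic to the full binary tree of height $\omega$, and let $\mathcal T$ be the set of trees $T\in I$ with $T\le_t T_0^{(n)}$ for some $n$. $\mathbf P=\mathbf P(F)$ consists of pairs $\langle T_p,f_p\rangle$ with $T_p\in\mathcal T$, $f_p:T_p\to\{0,1\}$, ordered by $p\le q$ iff $T_p\le_t T_q$ and $f_p\supseteq f_q$. $\mathbf Q=\mathbf Q(F)$ is the full product of countably many copies of $\mathbf P$, ordered coordinatewise. A forcing $\mathbf Q$ is $\alpha$-proper ($\alpha<\omega_1$) if for all sufficiently large $\kappa$ and every continuous increasing sequence $\langle N_\xi:\xi\le\alpha\rangle$ of countable elementary submodels of $H(\kappa)$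 with $\mathbf Q\in N_0$ and $\langle N_\xi:\xi\le\eta\rangle\in N_{\eta+1}$ for all $\eta<\alpha$, every $q_0\in\mathbf Q\cap N_0$ has an extension $q\le q_0$ which is $N_\xi$-generic for every $\xi\le\alpha$. The strong $PP$-property (in the sense of Shelah's Proper Forcing) means: for every ground-model $h:\omega\to\omega$ with $\lim h=\infty$, every $p\in\mathbf Q$ and every $\mathbf Q$-name $\dot f$ with $p\Vdash \dot f:\omega\to\omega$, there are $q\le p$ and a tree $T\subseteq\omega^{<\omega}$ in the ground model with $|T\cap\omega^{k}|\le h(k)$ for infinitely many $k$, such that $q\Vdash$ "$\dot f$ is a branch of $T$". *)

theory Defs
  imports "HOL-Analysis.Analysis" "HOL-Library.Sublist"
begin

unbundle cardinal_syntax

section \<open>Filters on \<open>\<omega>\<close> and the space \<open>\<omega>\<^sup>*\<close>\<close>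

definition filter_sets :: "nat filter \<Rightarrow> nat set set" where
  "filter_sets F = {A. eventually (\<lambda>n. n \<in> A) F}"

definition dual_ideal :: "nat filter \<Rightarrow> nat set set" where
  "dual_ideal F = {UNIV - A | A. A \<in> filter_sets F}"

text \<open>\<open>A \<subseteq>\<^sup>* B\<close> means that \<open>A - B\<close> is finite.\<close>

definition P_filter :: "nat filter \<Rightarrow> bool" where
  "P_filter F \<longleftrightarrow>
     (\<forall>A :: nat \<Rightarrow> nat set. (\<forall>n. A n \<in> filter_sets F) \<longrightarrow>
        (\<exists>B \<in> filter_sets F. \<forall>n. finite (B - A n)))"

definition ultrafilter :: "nat filter \<Rightarrow> bool" where
  "ultrafilter U \<longleftrightarrow> U \<noteq> bot \<and> (\<forall>A. A \<in> filter_sets U \<or> - A \<in> filter_sets U)"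

text \<open>The points of \<open>\<omega>\<^sup>* = \<beta>\<omega> - \<omega>\<close> are the ultrafilters containing all cofinite sets
  (in the order of the type \<^typ>\<open>nat filter\<close>, finer filters are smaller).\<close>

definition omega_star :: "nat filter set" where
  "omega_star = {U. ultrafilter U \<and> U \<le> cofinite}"

definition star :: "nat set \<Rightarrow> nat filter set" where
  "star A = {U \<in> omega_star. A \<in> filter_sets U}"

definition omega_star_topology :: "nat filter topology" where
  "omega_star_topology = topology_generated_by (range star)"

definition ccc_space :: "'a topology \<Rightarrow> bool" where
  "ccc_space X \<longleftrightarrow>
     (\<forall>\<U>. (\<forall>U\<in>\<U>. openin X U \<and> U \<noteq> {}) \<and> disjoint \<U> \<longrightarrow> countable \<U>)"

definition filter_closed_set :: "nat filter \<Rightarrow> nat filter set" where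
  "filter_closed_set F = (\<Inter>A\<in>filter_sets F. star A)"


section \<open>Trees and the forcing notions \<open>P(F)\<close> and \<open>Q(F)\<close>\<close>

text \<open>A partial order is given by its reflexive relation; its underlying set is the field of
  that relation. A pair \<open>(x, y)\<close> in the relation means \<open>x \<le> y\<close>.\<close>

definition is_tree :: "nat rel \<Rightarrow> bool" where
  "is_tree T \<longleftrightarrow> Partial_order T \<and>
     (\<forall>i\<in>Field T. {j. (j, i) \<in> T} \<in> Chains T) \<and>
     (\<forall>(i, j)\<in>T. i \<le> j)"

definition branch :: "nat rel \<Rightarrow> nat set \<Rightarrow> bool" where
  "branch T b \<longleftrightarrow> b \<in> Chains T \<and> (\<forall>c\<in>Chains T. b \<subseteq> c \<longrightarrow> c = b)"

definition cofinal_in :: "nat rel \<Rightarrow> nat set \<Rightarrow> nat set \<Rightarrow> bool" where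
  "cofinal_in T c b \<longleftrightarrow> c \<subseteq> b \<and> (\<forall>x\<in>b. \<exists>y\<in>c. (x, y) \<in> T)"

definition tree_le :: "nat rel \<Rightarrow> nat rel \<Rightarrow> bool" (infix "\<le>\<^sub>t" 50) where
  "T \<le>\<^sub>t S \<longleftrightarrow> Field S \<subseteq> Field T \<and> S = Restr T (Field S) \<and>
     (\<forall>b. branch T b \<longrightarrow> (\<exists>!c. branch S c \<and> cofinal_in T c b))"

definition tree_above :: "nat rel \<Rightarrow> nat \<Rightarrow> nat rel" where
  "tree_above T n = Restr T {n<..}"

text \<open>The full binary tree of height \<open>\<omega>\<close> is the set of finite binary sequences ordered by
  end-extension.\<close>

definition full_binary :: "nat rel \<Rightarrow> bool" where
  "full_binary T \<longleftrightarrow>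
     (\<exists>f :: nat \<Rightarrow> bool list. bij_betw f (Field T) UNIV \<and>
        (\<forall>i\<in>Field T. \<forall>j\<in>Field T. (i, j) \<in> T \<longleftrightarrow> prefix (f i) (f j)))"

definition tree_family :: "nat filter \<Rightarrow> nat rel \<Rightarrow> nat rel set" where
  "tree_family F T0 =
     {T. is_tree T \<and> Field T \<in> dual_ideal F \<and> (\<exists>n. T \<le>\<^sub>t tree_above T0 n)}"

type_synonym condition = "nat rel \<times> (nat \<rightharpoonup> nat)"

definition P_conditions :: "nat filter \<Rightarrow> nat rel \<Rightarrow> condition set" where
  "P_conditions F T0 =
     {(T, f). T \<in> tree_family F T0 \<and> dom f = Field T \<and> ran f \<subseteq> {0, 1}}"

definition P_forcing :: "nat filter \<Rightarrow> nat rel \<Rightarrow> condition rel" where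
  "P_forcing F T0 = {(p, q). p \<in> P_conditions F T0 \<and> q \<in> P_conditions F T0 \<and>
     fst p \<le>\<^sub>t fst q \<and> snd q \<subseteq>\<^sub>m snd p}"

definition Q_forcing :: "nat filter \<Rightarrow> nat rel \<Rightarrow> (nat \<Rightarrow> condition) rel" where
  "Q_forcing F T0 = {(p, q). \<forall>n. (p n, q n) \<in> P_forcing F T0}"

lemma tree_le_refl: "T \<le>\<^sub>t T" if "is_tree T"
proof -
  have r: "(x, x) \<in> T" if "x \<in> Field T" for x
    using \<open>is_tree T\<close> that
    unfolding is_tree_def partial_order_on_def preorder_on_def refl_on_def by blast
  have sub: "b \<subseteq> Field T" if "branch T b" for b
    using that unfolding branch_def Chains_def Field_def by blast
  have "\<exists>!c. branch T c \<and> cofinal_in T c b" if b: "branch T b" for b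
  proof (rule ex1I[of _ b])
    show "branch T b \<and> cofinal_in T b b"
      using b sub[OF b] r unfolding cofinal_in_def by blast
  next
    fix c assume "branch T c \<and> cofinal_in T c b"
    then show "c = b" using b unfolding branch_def cofinal_in_def by blast
  qed
  moreover have "T = Restr T (Field T)" by (auto simp: Field_def)
  ultimately show ?thesis unfolding tree_le_def by blast
qed

lemma P_forcing_refl: "(p, p) \<in> P_forcing F T0" if "p \<in> P_conditions F T0"
  using that unfolding P_forcing_def P_conditions_def tree_family_def
  by (auto intro: tree_le_refl)

lemma Field_P_forcing: "Field (P_forcing F T0) = P_conditions F T0"
proof
  show "Field (P_forcing F T0) \<subseteq> P_conditions F T0"
    unfolding Field_def P_forcing_def by auto
  show "P_conditions F T0 \<subseteq> Field (P_forcing F T0)"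
    by (meson FieldI1 P_forcing_refl subsetI)
qed

lemma Field_Q_forcing: "Field (Q_forcing F T0) = {p. \<forall>n. p n \<in> P_conditions F T0}"
proof
  show "Field (Q_forcing F T0) \<subseteq> {p. \<forall>n. p n \<in> P_conditions F T0}"
    unfolding Field_def Q_forcing_def P_forcing_def by auto
  show "{p. \<forall>n. p n \<in> P_conditions F T0} \<subseteq> Field (Q_forcing F T0)"
  proof
    fix p :: "nat \<Rightarrow> condition" assume "p \<in> {p. \<forall>n. p n \<in> P_conditions F T0}"
    then have "(p, p) \<in> Q_forcing F T0"
      by (simp add: Q_forcing_def P_forcing_refl)
    then show "p \<in> Field (Q_forcing F T0)" by (rule FieldI1)
  qed
qed


section \<open>The language of set theory\<close>

text \<open>First-order formulas in \<open>\<in>\<close> and \<open>=\<close>, with natural numbers as names of variables.\<close>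

datatype fm = Mem nat nat | Eq nat nat | Neg fm | Conj fm fm | Forall nat fm

definition Imp :: "fm \<Rightarrow> fm \<Rightarrow> fm" where "Imp \<phi> \<psi> = Neg (Conj \<phi> (Neg \<psi>))"
definition Disj :: "fm \<Rightarrow> fm \<Rightarrow> fm" where "Disj \<phi> \<psi> = Neg (Conj (Neg \<phi>) (Neg \<psi>))"
definition Iff :: "fm \<Rightarrow> fm \<Rightarrow> fm" where "Iff \<phi> \<psi> = Conj (Imp \<phi> \<psi>) (Imp \<psi> \<phi>)"
definition Exists :: "nat \<Rightarrow> fm \<Rightarrow> fm" where "Exists x \<phi> = Neg (Forall x (Neg \<phi>))"
definition BAll :: "nat \<Rightarrow> nat \<Rightarrow> fm \<Rightarrow> fm" where "BAll x y \<phi> = Forall x (Imp (Mem x y) \<phi>)"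
definition BEx :: "nat \<Rightarrow> nat \<Rightarrow> fm \<Rightarrow> fm" where "BEx x y \<phi> = Exists x (Conj (Mem x y) \<phi>)"

text \<open>\<open>z = {x, y}\<close> and \<open>z = \<langle>x, y\<rangle>\<close> (Kuratowski pair). The variables 100, 101, 102 are bound here
  and must not be used for \<open>x, y, z\<close> in \<open>OPair_fm\<close>.\<close>

definition UPair_fm :: "nat \<Rightarrow> nat \<Rightarrow> nat \<Rightarrow> fm" where
  "UPair_fm z x y = Forall 100 (Iff (Mem 100 z) (Disj (Eq 100 x) (Eq 100 y)))"

definition OPair_fm :: "nat \<Rightarrow> nat \<Rightarrow> nat \<Rightarrow> fm" where
  "OPair_fm z x y = Exists 101 (Exists 102
     (Conj (UPair_fm 101 x x) (Conj (UPair_fm 102 x y) (UPair_fm z 101 102))))"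

text \<open>Variable 0 is a function from the set 1 to the set 1.\<close>

definition Function_fm :: fm where
  "Function_fm = Conj
     (BAll 3 0 (BEx 4 1 (BEx 5 1 (OPair_fm 3 4 5))))
     (BAll 4 1 (BEx 5 1 (Conj
        (BEx 3 0 (OPair_fm 3 4 5))
        (BAll 6 1 (Imp (BEx 3 0 (OPair_fm 3 4 6)) (Eq 6 5))))))"

text \<open>For every element 3 of the set 1 there is an element 4 of the set 2 which is the restriction
  of 0 to 3; that is, if 1 is \<open>\<omega>\<close> and 2 is a tree of finite sequences, then 0 is a branch of 2.\<close>

definition Branch_fm :: fm where
  "Branch_fm = BAll 3 1 (BEx 4 2
     (Forall 5 (Iff (Mem 5 4) (Conj (Mem 5 0) (BEx 6 3 (Exists 7 (OPair_fm 5 6 7)))))))"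

primrec sat :: "'m set \<Rightarrow> 'm rel \<Rightarrow> fm \<Rightarrow> (nat \<Rightarrow> 'm) \<Rightarrow> bool" where
  "sat M E (Mem x y) e \<longleftrightarrow> (e x, e y) \<in> E"
| "sat M E (Eq x y) e \<longleftrightarrow> e x = e y"
| "sat M E (Neg \<phi>) e \<longleftrightarrow> \<not> sat M E \<phi> e"
| "sat M E (Conj \<phi> \<psi>) e \<longleftrightarrow> sat M E \<phi> e \<and> sat M E \<psi> e"
| "sat M E (Forall x \<phi>) e \<longleftrightarrow> (\<forall>a\<in>M. sat M E \<phi> (e(x := a)))"

definition elementary_submodel :: "'m rel \<Rightarrow> 'm set \<Rightarrow> bool" where
  "elementary_submodel E N \<longleftrightarrow> N \<noteq> {} \<and>
     (\<forall>\<phi> e. range e \<subseteq> N \<longrightarrow> sat N E \<phi> e = sat UNIV E \<phi> e)"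


section \<open>The structures \<open>H(\<kappa>)\<close>\<close>

definition ext :: "'m rel \<Rightarrow> 'm \<Rightarrow> 'm set" where
  "ext E x = {y. (y, x) \<in> E}"

text \<open>\<open>(H(\<kappa>), \<in>)\<close>, the sets with transitive closure of size less than \<open>\<kappa>\<close>, is up to isomorphism
  the unique well-founded extensional structure in which exactly those sets of elements whose
  closure under elements has size less than \<open>\<kappa>\<close> are sets of the structure.\<close>

definition H_structure :: "'m rel \<Rightarrow> 'm rel \<Rightarrow> bool" where
  "H_structure \<kappa> E \<longleftrightarrow> Card_order \<kappa> \<and> wf E \<and> inj (ext E) \<and>
     (\<forall>X. X \<in> range (ext E) \<longleftrightarrow> |{y. \<exists>x\<in>X. (y, x) \<in> E\<^sup>*}| <o \<kappa>)"

definition upair_in :: "'m rel \<Rightarrow> 'm \<Rightarrow> 'm \<Rightarrow> 'm \<Rightarrow> bool" where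
  "upair_in E z x y \<longleftrightarrow> ext E z = {x, y}"

definition opair_in :: "'m rel \<Rightarrow> 'm \<Rightarrow> 'm \<Rightarrow> 'm \<Rightarrow> bool" where
  "opair_in E z x y \<longleftrightarrow> (\<exists>u v. upair_in E u x x \<and> upair_in E v x y \<and> upair_in E z u v)"

definition ordinal_in :: "'m rel \<Rightarrow> 'm \<Rightarrow> bool" where
  "ordinal_in E a \<longleftrightarrow> (\<forall>x\<in>ext E a. ext E x \<subseteq> ext E a) \<and>
     (\<forall>x\<in>ext E a. \<forall>y\<in>ext E x. ext E y \<subseteq> ext E x)"

text \<open>\<open>a\<close> is the von Neumann ordinal which is the order type of the well-order \<open>\<alpha>\<close>.\<close>

definition order_type_in :: "'m rel \<Rightarrow> nat rel \<Rightarrow> 'm \<Rightarrow> bool" where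
  "order_type_in E \<alpha> a \<longleftrightarrow> ordinal_in E a \<and>
     \<alpha> =o {(x, y). x \<in> ext E a \<and> y \<in> ext E a \<and> ((x, y) \<in> E \<or> x = y)}"

definition succ_in :: "'m rel \<Rightarrow> 'm \<Rightarrow> 'm \<Rightarrow> bool" where
  "succ_in E x y \<longleftrightarrow> ext E y = insert x (ext E x)"

definition limit_in :: "'m rel \<Rightarrow> 'm \<Rightarrow> bool" where
  "limit_in E d \<longleftrightarrow> ordinal_in E d \<and> ext E d \<noteq> {} \<and> (\<forall>x\<in>ext E d. \<exists>y\<in>ext E d. (x, y) \<in> E)"

text \<open>\<open>s\<close> is the sequence \<open>\<langle>N\<^sub>\<xi> : \<xi> \<le> \<eta>\<rangle>\<close>, as a set of ordered pairs; in particular each of the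
  \<open>N\<^sub>\<xi>\<close> is an element of the structure.\<close>

definition sequence_in :: "'m rel \<Rightarrow> ('m \<Rightarrow> 'm set) \<Rightarrow> 'm \<Rightarrow> 'm \<Rightarrow> bool" where
  "sequence_in E N \<eta> s \<longleftrightarrow> (\<exists>v. (\<forall>\<xi>\<in>insert \<eta> (ext E \<eta>). ext E (v \<xi>) = N \<xi>) \<and>
     ext E s = {w. \<exists>\<xi>\<in>insert \<eta> (ext E \<eta>). opair_in E w \<xi> (v \<xi>)})"

text \<open>\<open>z\<close> is a partial order \<open>\<langle>P, \<le>\<rangle>\<close> of the structure which is isomorphic to \<open>r\<close> via \<open>c\<close>.\<close>

definition codes_forcing :: "'m rel \<Rightarrow> ('p \<Rightarrow> 'm) \<Rightarrow> 'p rel \<Rightarrow> 'm \<Rightarrow> bool" where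
  "codes_forcing E c r z \<longleftrightarrow> inj_on c (Field r) \<and>
     (\<exists>A R. opair_in E z A R \<and> ext E A = c ` Field r \<and>
        ext E R = {w. \<exists>(p, q)\<in>r. opair_in E w (c p) (c q)})"


section \<open>\<open>\<alpha>\<close>-properness\<close>

definition dense_in :: "'p rel \<Rightarrow> 'p set \<Rightarrow> bool" where
  "dense_in r D \<longleftrightarrow> D \<subseteq> Field r \<and> (\<forall>p\<in>Field r. \<exists>d\<in>D. (d, p) \<in> r)"

definition compatible :: "'p rel \<Rightarrow> 'p \<Rightarrow> 'p \<Rightarrow> bool" where
  "compatible r p q \<longleftrightarrow> (\<exists>t. (t, p) \<in> r \<and> (t, q) \<in> r)"

text \<open>\<open>q\<close> is \<open>N\<close>-generic: for each dense set \<open>D \<in> N\<close>, the set \<open>D \<inter> N\<close> is predense below \<open>q\<close>.\<close>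

definition generic_for :: "'m rel \<Rightarrow> ('p \<Rightarrow> 'm) \<Rightarrow> 'p rel \<Rightarrow> 'm set \<Rightarrow> 'p \<Rightarrow> bool" where
  "generic_for E c r N q \<longleftrightarrow>
     (\<forall>D d. D \<in> N \<and> dense_in r d \<and> ext E D = c ` d \<longrightarrow>
        (\<forall>q'. (q', q) \<in> r \<longrightarrow> (\<exists>p\<in>d. c p \<in> N \<and> compatible r p q')))"

definition model_sequence :: "'m rel \<Rightarrow> 'm \<Rightarrow> 'm \<Rightarrow> ('m \<Rightarrow> 'm set) \<Rightarrow> bool" where
  "model_sequence E a z N \<longleftrightarrow>
     (\<forall>\<xi>\<in>insert a (ext E a). countable (N \<xi>) \<and> elementary_submodel E (N \<xi>)) \<and>
     (\<forall>\<xi>\<in>insert a (ext E a). \<forall>\<zeta>\<in>ext E \<xi>. N \<zeta> \<subseteq> N \<xi>) \<and>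
     (\<forall>\<xi>\<in>insert a (ext E a). limit_in E \<xi> \<longrightarrow> N \<xi> = (\<Union>\<zeta>\<in>ext E \<xi>. N \<zeta>)) \<and>
     (\<forall>o\<^sub>0. ext E o\<^sub>0 = {} \<longrightarrow> z \<in> N o\<^sub>0) \<and>
     (\<forall>\<eta>\<in>ext E a. \<forall>\<zeta>. succ_in E \<eta> \<zeta> \<longrightarrow> (\<exists>s\<in>N \<zeta>. sequence_in E N \<eta> s))"

text \<open>Here ``sufficiently large'' is read as: uncountable and greater than \<open>2\<^bsup>|P|\<^esup>\<close>. The cardinal
  \<open>\<kappa>\<close> ranges over all such cardinals for which \<open>H(\<kappa>)\<close> has a copy with underlying set the type
  \<^typ>\<open>'m\<close>. As a forcing notion need not consist of elements of \<^typ>\<open>'m\<close>, the property is required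
  for all isomorphic copies of it in \<open>H(\<kappa>)\<close>.\<close>

definition alpha_proper :: "'m itself \<Rightarrow> nat rel \<Rightarrow> 'p rel \<Rightarrow> bool" where
  "alpha_proper _ \<alpha> r \<longleftrightarrow>
     (\<forall>(\<kappa> :: 'm rel) E c z a N.
        H_structure \<kappa> E \<and> natLeq <o \<kappa> \<and> |Pow (Field r)| <o \<kappa> \<and>
        codes_forcing E c r z \<and> order_type_in E \<alpha> a \<and> model_sequence E a z N \<longrightarrow>
        (\<forall>o\<^sub>0. ext E o\<^sub>0 = {} \<longrightarrow>
          (\<forall>q\<^sub>0\<in>Field r. c q\<^sub>0 \<in> N o\<^sub>0 \<longrightarrow>
            (\<exists>q. (q, q\<^sub>0) \<in> r \<and> (\<forall>\<xi>\<in>insert a (ext E a). generic_for E c r (N \<xi>) q)))))"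


section \<open>Names and the forcing relation\<close>

text \<open>\<open>Name a B\<close> is the name \<open>{(a i, p) | i p. p \<in> B i}\<close>. The indices range over \<^typ>\<open>'i + nat\<close>,
  where \<^typ>\<open>'i\<close> bounds the hereditary size of names and is to be read as an arbitrary type; the
  summand \<^typ>\<open>nat\<close> ensures that there are canonical names for countable sets.\<close>

datatype ('i, 'p) name =
  Empty_Name
| Name "'i + nat \<Rightarrow> ('i, 'p) name" "'i + nat \<Rightarrow> 'p set"

fun pairs :: "('i, 'p) name \<Rightarrow> (('i, 'p) name \<times> 'p) set" where
  "pairs Empty_Name = {}"
| "pairs (Name a B) = {(a i, p) | i p. p \<in> B i}"

inductive is_name :: "'p rel \<Rightarrow> ('i, 'p) name \<Rightarrow> bool" for r where
  "(\<And>\<pi> s. (\<pi>, s) \<in> pairs \<tau> \<Longrightarrow> s \<in> Field r \<and> is_name r \<pi>) \<Longrightarrow> is_name r \<tau>"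

definition dense_below :: "'p rel \<Rightarrow> 'p set \<Rightarrow> 'p \<Rightarrow> bool" where
  "dense_below r D p \<longleftrightarrow> (\<forall>q. (q, p) \<in> r \<longrightarrow> (\<exists>d\<in>D. (d, q) \<in> r))"

definition subname :: "(('i, 'p) name \<times> ('i, 'p) name) set" where
  "subname = {(\<pi>, \<tau>). \<exists>s. (\<pi>, s) \<in> pairs \<tau>}"

lemma wf_subname: "wf (subname :: (('i, 'p) name \<times> ('i, 'p) name) set)"
proof (rule wfUNIVI)
  fix Q :: "('i, 'p) name \<Rightarrow> bool" and \<tau>
  assume *: "\<forall>\<tau>. (\<forall>\<pi>. (\<pi>, \<tau>) \<in> subname \<longrightarrow> Q \<pi>) \<longrightarrow> Q \<tau>"
  show "Q \<tau>"
  proof (induction \<tau>)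
    case Empty_Name
    show ?case by (rule *[rule_format]) (simp add: subname_def)
  next
    case (Name a B)
    show ?case by (rule *[rule_format]) (auto simp: subname_def intro: Name)
  qed
qed

function forces_eq :: "'p rel \<Rightarrow> ('i, 'p) name \<Rightarrow> ('i, 'p) name \<Rightarrow> 'p \<Rightarrow> bool" where
  "forces_eq r \<sigma> \<tau> p \<longleftrightarrow>
     (\<forall>x\<in>pairs \<sigma>. dense_below r
        {q. (q, p) \<in> r \<and> ((q, snd x) \<in> r \<longrightarrow>
           (\<exists>y\<in>pairs \<tau>. (q, snd y) \<in> r \<and> forces_eq r (fst x) (fst y) q))} p) \<and>
     (\<forall>y\<in>pairs \<tau>. dense_below r
        {q. (q, p) \<in> r \<and> ((q, snd y) \<in> r \<longrightarrow>
           (\<exists>x\<in>pairs \<sigma>. (q, snd x) \<in> r \<and> forces_eq r (fst x) (fst y) q))} p)"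
  by pat_completeness auto
termination
proof (relation "inv_image subname (\<lambda>(r, \<sigma>, \<tau>, p). \<sigma>)")
  show "wf (inv_image (subname :: (('i, 'p) name \<times> ('i, 'p) name) set)
      (\<lambda>(r :: 'p rel, \<sigma>, \<tau> :: ('i, 'p) name, p :: 'p). \<sigma>))"
    by (rule wf_inv_image[OF wf_subname])
qed (auto simp: subname_def)

declare forces_eq.simps [simp del]

definition forces_mem :: "'p rel \<Rightarrow> ('i, 'p) name \<Rightarrow> ('i, 'p) name \<Rightarrow> 'p \<Rightarrow> bool" where
  "forces_mem r \<sigma> \<tau> p \<longleftrightarrow>
     dense_below r {q. \<exists>x\<in>pairs \<tau>. (q, snd x) \<in> r \<and> forces_eq r \<sigma> (fst x) q} p"

primrec forces :: "'p rel \<Rightarrow> fm \<Rightarrow> (nat \<Rightarrow> ('i, 'p) name) \<Rightarrow> 'p \<Rightarrow> bool" where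
  "forces r (Mem x y) e p \<longleftrightarrow> forces_mem r (e x) (e y) p"
| "forces r (Eq x y) e p \<longleftrightarrow> forces_eq r (e x) (e y) p"
| "forces r (Neg \<phi>) e p \<longleftrightarrow> (\<forall>q. (q, p) \<in> r \<longrightarrow> \<not> forces r \<phi> e q)"
| "forces r (Conj \<phi> \<psi>) e p \<longleftrightarrow> forces r \<phi> e p \<and> forces r \<psi> e p"
| "forces r (Forall x \<phi>) e p \<longleftrightarrow> (\<forall>\<tau>. is_name r \<tau> \<longrightarrow> forces r \<phi> (e(x := \<tau>)) p)"

text \<open>Canonical names for ground model sets. Since a forcing notion need not have a largest
  element, all conditions are attached to each element of such a name.\<close>

definition seq_name :: "(nat \<Rightarrow> ('i, 'p) name) \<Rightarrow> (nat \<Rightarrow> 'p set) \<Rightarrow> ('i, 'p) name" where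
  "seq_name a B = Name (case_sum (\<lambda>_. Empty_Name) a) (case_sum (\<lambda>_. {}) B)"

lemma pairs_seq_name: "pairs (seq_name a B) = {(a n, p) | n p. p \<in> B n}"
proof -
  have *: "(\<exists>i. P (i :: 'i + nat)) \<longleftrightarrow> (\<exists>x. P (Inl x)) \<or> (\<exists>n. P (Inr n))" for P
    by (metis sum.exhaust)
  show ?thesis unfolding seq_name_def by (simp add: *)
qed

fun nat_name :: "'p rel \<Rightarrow> nat \<Rightarrow> ('i, 'p) name" where
  "nat_name r n = seq_name (\<lambda>m. if m < n then nat_name r m else Empty_Name)
     (\<lambda>m. if m < n then Field r else {})"

declare nat_name.simps [simp del]

definition omega_name :: "'p rel \<Rightarrow> ('i, 'p) name" where
  "omega_name r = seq_name (nat_name r) (\<lambda>_. Field r)"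

definition upair_name :: "'p rel \<Rightarrow> ('i, 'p) name \<Rightarrow> ('i, 'p) name \<Rightarrow> ('i, 'p) name" where
  "upair_name r \<sigma> \<tau> = seq_name (\<lambda>n. if n = 0 then \<sigma> else \<tau>) (\<lambda>_. Field r)"

definition opair_name :: "'p rel \<Rightarrow> ('i, 'p) name \<Rightarrow> ('i, 'p) name \<Rightarrow> ('i, 'p) name" where
  "opair_name r \<sigma> \<tau> = upair_name r (upair_name r \<sigma> \<sigma>) (upair_name r \<sigma> \<tau>)"

text \<open>A finite sequence \<open>s\<close> is the set of pairs \<open>\<langle>i, s\<^sub>i\<rangle>\<close> for \<open>i\<close> less than its length.\<close>

definition list_name :: "'p rel \<Rightarrow> nat list \<Rightarrow> ('i, 'p) name" where
  "list_name r s = seq_name (\<lambda>i. opair_name r (nat_name r i) (nat_name r (s ! i)))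
     (\<lambda>i. if i < length s then Field r else {})"

definition list_set_name :: "'p rel \<Rightarrow> nat list set \<Rightarrow> ('i, 'p) name" where
  "list_set_name r T = seq_name (\<lambda>n. list_name r (from_nat n))
     (\<lambda>n. if from_nat n \<in> T then Field r else {})"

definition forces_function :: "'p rel \<Rightarrow> ('i, 'p) name \<Rightarrow> 'p \<Rightarrow> bool" where
  "forces_function r f p \<longleftrightarrow>
     forces r Function_fm ((\<lambda>_. Empty_Name)(0 := f, 1 := omega_name r)) p"

definition forces_branch :: "'p rel \<Rightarrow> ('i, 'p) name \<Rightarrow> nat list set \<Rightarrow> 'p \<Rightarrow> bool" where
  "forces_branch r f T p \<longleftrightarrow>
     forces r Branch_fm
       ((\<lambda>_. Empty_Name)(0 := f, 1 := omega_name r, 2 := list_set_name r T)) p"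


section \<open>The strong \<open>PP\<close>-property\<close>

definition seq_tree :: "nat list set \<Rightarrow> bool" where
  "seq_tree T \<longleftrightarrow> (\<forall>s t. t \<in> T \<and> prefix s t \<longrightarrow> s \<in> T)"

definition strong_PP :: "'i itself \<Rightarrow> 'p rel \<Rightarrow> bool" where
  "strong_PP _ r \<longleftrightarrow>
     (\<forall>(h :: nat \<Rightarrow> nat) p (f :: ('i, 'p) name).
        filterlim h at_top sequentially \<and> p \<in> Field r \<and> is_name r f \<and> forces_function r f p \<longrightarrow>
        (\<exists>q T. (q, p) \<in> r \<and> seq_tree T \<and>
           (\<exists>\<^sub>\<infinity>k. finite {s \<in> T. length s = k} \<and> card {s \<in> T. length s = k} \<le> h k) \<and>
           forces_branch r f T q))"

end

theory Submission
  imports Defs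
begin

text \<open>
  Since \<open>T\<^sub>0\<close> is finitely branching, a condition extends another one as soon as its tree extends the
  other tree as an order, and the position of a late node relative to the numbers up to \<open>n\<close> is
  determined by the finitely many nodes of \<open>T\<^sub>0\<close> in a front above \<open>n\<close>. Hence below a condition one can
  meet a dense set up to finitely many possibilities while keeping a finite part of finitely many
  coordinates unchanged. The limit of such a fusion has its trees in the ideal only if the fusion is
  played as a game against an opponent who demands how much is to be kept unchanged: ccc makes the
  filter nonmeager, and against a nonmeager \<open>P\<close>-filter every strategy for the fusion has a play whose
  limit is a condition.

  The submodels in the definition of \<open>\<alpha>\<close>-properness know the forcing notion only up to isomorphism.
  The fusion orders are therefore expressed by the compatibility with finitely many one-element
  extensions of a condition; these are exactly its covers in the order of the forcing notion.
  Genericity for a sequence of models is then obtained by induction on its length, with a fusion at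
  limits and reflection of the intermediate results into the next model.
\<close>

section \<open>Nonmeager \<open>P\<close>-filters\<close>

text \<open>Almost containment of all moves in one set of the ideal, which the
  \<open>P\<close>-filter property gives, is not enough for a fusion: each stage may add finitely
  many numbers outside that set, and the remainders may add up. Nonmeagerness supplies a set of the
  ideal containing infinitely many blocks of an interval partition; if the opponent names left ends
  of such blocks, every remainder falls into a block. One sequence of demands serves all coordinates
  of the product, since the pseudounion is taken over countably many coordinates and a stage freezes
  only finitely many of them.

  The possibilities left by a fusion step are bounded by the number of traces on
  \<open>{..N}\<close> in finitely many coordinates, where \<open>N\<close> is a front. This gives
  the strong \<open>PP\<close>-property for slowly growing \<open>h\<close>: the length of the
  initial segment to be decided is chosen after the bound is known.

  Properness must be proved in a form that keeps a prescribed finite set frozen, since only so can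
  it serve as one stage of a fusion at a limit of models.\<close>

lemma chain_Inf_filter_neq_bot:
  fixes C :: "'a filter set"
  assumes "C \<noteq> {}" "\<And>A. A \<in> C \<Longrightarrow> A \<noteq> bot" "\<And>A B. A \<in> C \<Longrightarrow> B \<in> C \<Longrightarrow> A \<le> B \<or> B \<le> A"
  shows "Inf C \<noteq> bot"
proof
  assume "Inf C = bot"
  then have "eventually (\<lambda>_. False) (Inf C)" by simp
  moreover have "\<exists>x\<in>C. x \<le> F \<and> x \<le> G" if "F \<in> C" "G \<in> C" for F G
    using assms(3)[OF that] that by auto
  ultimately obtain b where "b \<in> C" "eventually (\<lambda>_. False) b"
    using eventually_Inf_base[of C "\<lambda>_. False"] assms(1) by (auto simp: le_inf_iff)
  then show False using assms(2) by (auto simp: trivial_limit_def)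
qed

lemma ultrafilter_exists:
  assumes "G \<noteq> (bot :: nat filter)"
  obtains U where "ultrafilter U" "U \<le> G"
proof -
  \<comment> \<open>The order is reversed, so that a maximal element is a finest proper filter below
    \<open>G\<close>.\<close>
  define r where "r = {(A, B). A \<noteq> bot \<and> B \<noteq> bot \<and> A \<le> G \<and> B \<le> G \<and> B \<le> A}"
  have F: "Field r = {A. A \<noteq> bot \<and> A \<le> G}" by (auto simp: r_def Field_def)
  have po: "Partial_order r"
    unfolding partial_order_on_def preorder_on_def refl_on_def trans_def antisym_def F
    by (auto simp: r_def)
  have "\<exists>m\<in>Field r. \<forall>a\<in>Field r. (m, a) \<in> r \<longrightarrow> a = m"
  proof (rule Zorns_po_lemma[OF po])
    fix C assume C: "C \<in> Chains r"
    show "\<exists>u\<in>Field r. \<forall>a\<in>C. (a, u) \<in> r"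
    proof (cases "C = {}")
      case True then show ?thesis using assms F by auto
    next
      case False
      have mem: "A \<noteq> bot \<and> A \<le> G" if "A \<in> C" for A
        using C that by (auto simp: Chains_def r_def)
      have "Inf C \<noteq> bot"
        using False mem C by (intro chain_Inf_filter_neq_bot) (auto simp: Chains_def r_def)
      moreover have "Inf C \<le> G" using False mem by (meson Inf_lower2 ex_in_conv)
      ultimately show ?thesis using mem unfolding F by (auto simp: r_def intro!: bexI[of _ "Inf
          C"] Inf_lower)
    qed
  qed
  then obtain U where U: "U \<noteq> bot" "U \<le> G" "\<And>A. A \<noteq> bot \<Longrightarrow> A \<le> G \<Longrightarrow> A \<le> U \<Longrightarrow> A = U"
    unfolding F by (auto simp: r_def)
  have "A \<in> filter_sets U \<or> - A \<in> filter_sets U" for A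
  proof (rule ccontr)
    assume n: "\<not> ?thesis"
    let ?B = "inf U (principal A)"
    have "?B \<noteq> bot" using n by (auto simp: trivial_limit_def eventually_inf_principal filter_sets_def)
    then have "?B = U" using U by (metis inf.cobounded1 order_trans)
    then have "A \<in> filter_sets U"
      by (metis (mono_tags) eventually_principal filter_sets_def inf.cobounded2 filter_leD
          mem_Collect_eq)
    then show False using n by simp
  qed
  then show ?thesis using U that by (auto simp: ultrafilter_def)
qed

text \<open>The sets are the branches of the tree of finite Boolean sequences, coded by numbers; two
  different branches share only the nodes up to the place where they split.\<close>

lemma uncountable_almost_disjoint_family:
  obtains B :: "nat set \<Rightarrow> nat set"
  where "\<And>x. infinite (B x)" "\<And>x y. x \<noteq> y \<Longrightarrow> finite (B x \<inter> B y)"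
proof
  define s where "s x n = map (\<lambda>i. i \<in> x) [0..<n]" for x :: "nat set" and n
  let ?B = "\<lambda>x. range (\<lambda>n. to_nat (s x n))"
  have len: "length (s x n) = n" for x n by (simp add: s_def)
  show "infinite (?B x)" for x
    by (intro range_inj_infinite injI) (metis len from_nat_to_nat)
  show "finite (?B x \<inter> ?B y)" if xy: "x \<noteq> y" for x y
  proof -
    obtain k where k: "(k \<in> x) \<noteq> (k \<in> y)" using xy by auto
    have "?B x \<inter> ?B y \<subseteq> (\<lambda>n. to_nat (s x n)) ` {..k}"
    proof
      fix z assume "z \<in> ?B x \<inter> ?B y"
      then obtain n n' where z: "z = to_nat (s x n)" "z = to_nat (s y n')" by blast
      then have "s x n = s y n'" by simp
      then have eq: "s x n = s y n" using len by metis
      have "n \<le> k"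
      proof (rule ccontr)
        assume "\<not> n \<le> k"
        then have "s x n ! k = (k \<in> x)" "s y n ! k = (k \<in> y)" by (auto simp: s_def)
        then show False using eq k by simp
      qed
      then show "z \<in> (\<lambda>n. to_nat (s x n)) ` {..k}" using z by auto
    qed
    then show ?thesis by (rule finite_subset) simp
  qed
qed

lemma uncountable_nat_sets: "uncountable (UNIV :: nat set set)"
proof
  assume "countable (UNIV :: nat set set)"
  then obtain f :: "nat \<Rightarrow> nat set" where "range f = UNIV"
    using uncountable_def by (metis UNIV_not_empty)
  then show False using Cantors_theorem[of UNIV] by auto
qed

section \<open>The dual ideal of a ccc \<open>P\<close>-filter\<close>

locale ccc_P_filter =
  fixes F :: "nat filter"
  assumes proper: "F \<noteq> bot" and cofinite: "F \<le> cofinite" and P_filter: "P_filter F"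
    and ccc: "ccc_space (subtopology omega_star_topology (filter_closed_set F))"
begin

abbreviation I :: "nat set set" where "I \<equiv> dual_ideal F"

lemma I_iff: "A \<in> I \<longleftrightarrow> - A \<in> filter_sets F"
  unfolding dual_ideal_def by (auto simp: Compl_eq_Diff_UNIV double_diff)

lemma I_finite: "finite A \<Longrightarrow> A \<in> I"
  using cofinite unfolding I_iff filter_sets_def
  by (auto simp: le_filter_def eventually_cofinite)

lemma I_Un: "A \<in> I \<Longrightarrow> B \<in> I \<Longrightarrow> A \<union> B \<in> I"
  unfolding I_iff filter_sets_def by (auto intro: eventually_conj)

lemma I_subset: "B \<in> I \<Longrightarrow> A \<subseteq> B \<Longrightarrow> A \<in> I"
  unfolding I_iff filter_sets_def by (auto elim: eventually_mono)

lemma UNIV_notin_I: "UNIV \<notin> I"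
  using proper unfolding I_iff filter_sets_def by (simp add: trivial_limit_def)

lemma I_UN: "finite K \<Longrightarrow> (\<And>k. k \<in> K \<Longrightarrow> A k \<in> I) \<Longrightarrow> (\<Union>k\<in>K. A k) \<in> I"
  by (induction K rule: finite_induct) (auto intro: I_Un I_finite)

text \<open>The dual form of the \<open>P\<close>-filter property. Any countable index type is
  allowed, so that one set can serve all pairs of a history and a coordinate.\<close>

lemma I_pseudounion:
  fixes A :: "'a :: countable \<Rightarrow> nat set"
  assumes "\<And>a. A a \<in> I"
  obtains C where "C \<in> I" "\<And>a. finite (A a - C)"
proof -
  have "- A (from_nat n) \<in> filter_sets F" for n using assms I_iff by blast
  then have "\<exists>B\<in>filter_sets F. \<forall>n. finite (B - (- A (from_nat n)))"
    using P_filter[unfolded P_filter_def, rule_format, of "\<lambda>n. - A (from_nat n)"] by simp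
  then obtain B where B: "B \<in> filter_sets F" "\<And>n. finite (B - (- A (from_nat n)))"
    by blast
  have "finite (A a - (- B))" for a
    using B(2)[of "to_nat a"] by (simp add: Int_commute Diff_eq)
  then show ?thesis using B(1) that[of "- B"] I_iff by auto
qed

text \<open>If the filter were meager, the unions of an interval partition along an almost disjoint
  family would give uncountably many disjoint open sets.\<close>

lemma I_nonmeager:
  fixes m :: "nat \<Rightarrow> nat"
  assumes m: "strict_mono m"
  shows "\<exists>D\<in>I. \<exists>\<^sub>\<infinity>k. {m k..<m (Suc k)} \<subseteq> D"
proof (rule ccontr)
  assume neg: "\<not> ?thesis"
  then have fin: "finite {k. {m k..<m (Suc k)} \<subseteq> D}" if "D \<in> I" for D
    using that neg unfolding INFM_iff_infinite by blast
  obtain B :: "nat set \<Rightarrow> nat set" where B: "\<And>x. infinite (B x)" "\<And>x y. x \<noteq> y \<Longrightarrow> finite (B x \<inter> B y)"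
    using uncountable_almost_disjoint_family by blast
  define V where "V x = (\<Union>k\<in>B x. {m k..<m (Suc k)})" for x
  define W where "W x = star (V x) \<inter> filter_closed_set F" for x
  have op: "openin (subtopology omega_star_topology (filter_closed_set F)) (W x)" for x
    unfolding openin_subtopology W_def omega_star_topology_def
    by (metis openin_topology_generated_by_iff generate_topology_on.Basis rangeI)
  have ne: "W x \<noteq> {}" for x
  proof -
    \<comment> \<open>\<open>V x\<close> is positive for \<open>F\<close>: otherwise it would itself
      be a set of the ideal containing the infinitely many blocks indexed by
      \<open>B x\<close>.\<close>
    let ?G = "inf F (principal (V x))"
    have "?G \<noteq> bot"
    proof
      assume "?G = bot"
      then have "V x \<in> I"
        by (simp add: trivial_limit_def eventually_inf_principal I_iff filter_sets_def)
      from fin[OF this] have "finite (B x)"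
        by (rule rev_finite_subset) (auto simp: V_def)
      then show False using B by simp
    qed
    then obtain U where U: "ultrafilter U" "U \<le> ?G" using ultrafilter_exists by blast
    then have le: "U \<le> F" "U \<le> principal (V x)" by auto
    then have "U \<in> omega_star" using U cofinite by (auto simp: omega_star_def)
    moreover have "A \<in> filter_sets U" if "A \<in> filter_sets F" for A
      using le that by (auto simp: filter_sets_def le_filter_def)
    moreover have "V x \<in> filter_sets U"
      using le(2) by (auto simp: filter_sets_def le_filter_def eventually_principal)
    ultimately have "U \<in> W x" by (auto simp: W_def star_def filter_closed_set_def)
    then show ?thesis by auto
  qed
  have disj: "W x \<inter> W y = {}" if xy: "x \<noteq> y" for x y
  proof (rule ccontr)
    assume "W x \<inter> W y \<noteq> {}"
    then obtain U where U: "U \<in> omega_star" "V x \<in> filter_sets U" "V y \<in> filter_sets U"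
      by (auto simp: W_def star_def)
    \<comment> \<open>The blocks are pairwise disjoint, so \<open>V x\<close> and \<open>V y\<close>
      meet only in the finitely many blocks with index in both; no ultrafilter in
      \<open>omega_star\<close> contains a finite set.\<close>
    have sub: "V x \<inter> V y \<subseteq> (\<Union>k\<in>B x \<inter> B y. {m k..<m (Suc k)})"
    proof
      fix z assume "z \<in> V x \<inter> V y"
      then obtain k l where k: "k \<in> B x" "m k \<le> z" "z < m (Suc k)" "l \<in> B y" "m l \<le> z" "z < m (Suc l)"
        by (auto simp: V_def)
      then have "m k < m (Suc l)" "m l < m (Suc k)" by auto
      then have "k = l" using m by (simp add: strict_mono_less)
      then show "z \<in> (\<Union>k\<in>B x \<inter> B y. {m k..<m (Suc k)})" using k by auto
    qed
    have "finite (\<Union>k\<in>B x \<inter> B y. {m k..<m (Suc k)})" using B(2)[OF xy] by auto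
    then have "finite (V x \<inter> V y)" using sub finite_subset by blast
    then have "eventually (\<lambda>z. z \<notin> V x \<inter> V y) cofinite" by (simp add: eventually_cofinite Int_def)
    then have "eventually (\<lambda>z. z \<notin> V x \<inter> V y) U" using U(1) by (auto simp: omega_star_def le_filter_def)
    moreover have "eventually (\<lambda>z. z \<in> V x) U" "eventually (\<lambda>z. z \<in> V y) U"
      using U by (auto simp: filter_sets_def)
    ultimately have "eventually (\<lambda>_. False) U" by eventually_elim auto
    then show False using U(1) by (auto simp: omega_star_def ultrafilter_def trivial_limit_def)
  qed
  have inj: "inj W" using ne disj by (metis inf.idem injI)
  have "disjoint (range W)"
    unfolding disjoint_def
  proof (intro ballI impI)
    fix A B assume "A \<in> range W" "B \<in> range W" "A \<noteq> B"
    then obtain x y where "A = W x" "B = W y" "x \<noteq> y" by blast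
    then show "A \<inter> B = {}" using disj by simp
  qed
  moreover have "\<forall>A\<in>range W. openin (subtopology omega_star_topology (filter_closed_set F)) A \<and> A \<noteq> {}"
    using op ne by simp
  ultimately have "countable (range W)"
    using ccc[unfolded ccc_space_def, rule_format, of "range W"] by simp
  then show False using countable_image_inj_on[OF _ inj] uncountable_nat_sets by simp
qed

text \<open>The sets \<open>A \<sigma> i\<close> are the moves of a strategy against the numbers \<open>\<sigma>\<close>; the sequence \<open>x\<close>
  defeats all its coordinates \<open>i\<close> simultaneously.\<close>

lemma strategy_defeated:
  fixes A :: "nat list \<Rightarrow> nat \<Rightarrow> nat set"
  assumes A: "\<And>\<sigma> i. A \<sigma> i \<in> I"
    and step: "\<And>\<sigma> n i. i \<le> length \<sigma> \<Longrightarrow> A (\<sigma> @ [n]) i - A \<sigma> i \<subseteq> {n<..}"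
  obtains x :: "nat \<Rightarrow> nat" where "\<And>j. j \<le> x j" "\<And>i. (\<Union>j. A (map x [0..<j]) i) \<in> I"
proof -
  obtain C where C: "C \<in> I" "\<And>\<sigma> i. finite (A \<sigma> i - C)"
    using I_pseudounion[of "\<lambda>(\<sigma>, i). A \<sigma> i"] A by (auto split: prod.splits)
  \<comment> \<open>Each \<open>A \<sigma> i - C\<close> is finite, and only finitely many histories
    have entries at most \<open>b\<close> and length at most \<open>k\<close>, so one bound covers
    the remainders of all of them.\<close>
  have "\<exists>b'>b. \<forall>\<sigma> i. set \<sigma> \<subseteq> {..b} \<and> length \<sigma> \<le> k \<and> i \<le> k \<longrightarrow> A \<sigma> i - C \<subseteq> {..<b'}" for b k
  proof -
    let ?S = "\<Union>\<sigma>\<in>{\<sigma>. set \<sigma> \<subseteq> {..b} \<and> length \<sigma> \<le> k}. \<Union>i\<in>{..k}. A \<sigma> i - C"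
    have "finite ?S" using C by (intro finite_UN_I finite_lists_length_le) auto
    then obtain c where "?S \<subseteq> {..<c}" using finite_nat_iff_bounded by blast
    then have "\<forall>\<sigma> i. set \<sigma> \<subseteq> {..b} \<and> length \<sigma> \<le> k \<and> i \<le> k \<longrightarrow> A \<sigma> i - C \<subseteq> {..<max c (Suc b)}"
      by fastforce
    then show ?thesis by (intro exI[of _ "max c (Suc b)"]) auto
  qed
  then obtain nx where nx: "\<And>b k. nx b k > b"
    "\<And>b k \<sigma> i. set \<sigma> \<subseteq> {..b} \<Longrightarrow> length \<sigma> \<le> k \<Longrightarrow> i \<le> k \<Longrightarrow> A \<sigma> i - C \<subseteq> {..<nx b k}"
    by metis
  define m where "m = rec_nat 0 (\<lambda>k b. nx b k)"
  have mS: "m (Suc k) = nx (m k) k" for k by (simp add: m_def)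
  have m: "strict_mono m" by (simp add: strict_mono_Suc_iff mS nx)
  obtain D where D: "D \<in> I" "\<exists>\<^sub>\<infinity>k. {m k..<m (Suc k)} \<subseteq> D" using I_nonmeager[OF m] by blast
  \<comment> \<open>Index 0 is removed so that \<open>Suc j \<le> k j\<close> holds: the history
    through stage \<open>j\<close> has length \<open>Suc j\<close>, which must be within the bound
    used for \<open>m (Suc (k j))\<close>.\<close>
  define K where "K = {k. {m k..<m (Suc k)} \<subseteq> D} - {0}"
  have K: "infinite K" using D(2) by (simp add: K_def INFM_iff_infinite)
  define k where "k = enumerate K"
  have kK: "k j \<in> K" for j using K by (simp add: k_def enumerate_in_set)
  have kmono: "strict_mono k" using K by (simp add: k_def strict_mono_enumerate)
  have kge: "Suc j \<le> k j" for j
  proof (induction j)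
    case 0 show ?case using kK[of 0] by (auto simp: K_def)
  next
    case (Suc j) then show ?case using kmono by (metis Suc_le_eq le_less_trans lessI strict_mono_less)
  qed
  define x where "x j = m (k j)" for j
  \<comment> \<open>What stage \<open>j\<close> adds lies above \<open>x j = m (k j)\<close> by
    \<open>step\<close> and, outside \<open>C\<close>, below the next partition point; it therefore
    falls into a block contained in \<open>D\<close>. The finitely many stages before
    \<open>i\<close> are not controlled and are added separately.\<close>
  have new: "A (map x [0..<Suc j]) i - A (map x [0..<j]) i \<subseteq> C \<union> D" if ij: "i \<le> j" for i j
  proof
    fix z assume z: "z \<in> A (map x [0..<Suc j]) i - A (map x [0..<j]) i"
    have "z > x j" using step[of i "map x [0..<j]" "x j"] ij z by auto
    moreover have "z < m (Suc (k j))" if "z \<notin> C"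
    proof -
      have "set (map x [0..<Suc j]) \<subseteq> {..m (k j)}"
        using m kmono by (auto simp: x_def strict_mono_less_eq less_Suc_eq_le)
      then have "A (map x [0..<Suc j]) i - C \<subseteq> {..<m (Suc (k j))}"
        unfolding mS using kge[of j] ij by (intro nx) auto
      then show ?thesis using z that by auto
    qed
    moreover have "{m (k j)..<m (Suc (k j))} \<subseteq> D" using kK[of j] by (auto simp: K_def)
    ultimately show "z \<in> C \<union> D" by (cases "z \<in> C") (auto simp: x_def)
  qed
  have "(\<Union>j. A (map x [0..<j]) i) \<subseteq> (\<Union>j\<in>{..i}. A (map x [0..<j]) i) \<union> (C \<union> D)" for i
  proof -
    have "A (map x [0..<j]) i \<subseteq> (\<Union>j\<in>{..i}. A (map x [0..<j]) i) \<union> (C \<union> D)" for j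
    proof (induction j)
      case (Suc j)
      show ?case
      proof (cases "i \<le> j")
        case True then show ?thesis using new[of i j] Suc by blast
      next
        case False then show ?thesis by (intro le_supI1 UN_upper) simp
      qed
    qed auto
    then show ?thesis by blast
  qed
  then have "(\<Union>j. A (map x [0..<j]) i) \<in> I" for i
    by (rule I_subset[rotated]) (intro I_Un I_UN A C D; simp)
  moreover have "j \<le> x j" for j
    using kge[of j] strict_mono_imp_increasing[OF m, of "k j"] by (simp add: x_def)
  ultimately show ?thesis using that by blast
qed

end

section \<open>Trees cofinal in the binary tree\<close>

lemma Field_Restr_tree: "is_tree T \<Longrightarrow> Field (Restr T B) = Field T \<inter> B"
  unfolding is_tree_def partial_order_on_def preorder_on_def refl_on_def by (auto simp: Field_def)

lemma tree_refl: "is_tree T \<Longrightarrow> x \<in> Field T \<Longrightarrow> (x, x) \<in> T"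
  unfolding is_tree_def partial_order_on_def preorder_on_def refl_on_def by blast

lemma tree_trans: "is_tree T \<Longrightarrow> (x, y) \<in> T \<Longrightarrow> (y, z) \<in> T \<Longrightarrow> (x, z) \<in> T"
  unfolding is_tree_def partial_order_on_def preorder_on_def trans_def by blast

lemma tree_le: "is_tree T \<Longrightarrow> (x, y) \<in> T \<Longrightarrow> x \<le> y"
  unfolding is_tree_def by blast

lemma tree_linear: "is_tree T \<Longrightarrow> (x, z) \<in> T \<Longrightarrow> (y, z) \<in> T \<Longrightarrow> (x, y) \<in> T \<or> (y, x) \<in> T"
  unfolding is_tree_def Chains_def by (blast dest: FieldI2)

lemma tree_linear_less:
  assumes "is_tree T" "(x, z) \<in> T" "(y, z) \<in> T" "x < y"
  shows "(x, y) \<in> T"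
  using tree_linear[OF assms(1-3)] tree_le[OF assms(1), of y x] assms(4) by auto

lemma is_treeI:
  assumes "\<And>x. x \<in> Field T \<Longrightarrow> (x, x) \<in> T"
    and "\<And>x y z. (x, y) \<in> T \<Longrightarrow> (y, z) \<in> T \<Longrightarrow> (x, z) \<in> T"
    and "\<And>x y. (x, y) \<in> T \<Longrightarrow> x \<le> y"
    and "\<And>x y z. (x, z) \<in> T \<Longrightarrow> (y, z) \<in> T \<Longrightarrow> x < y \<Longrightarrow> (x, y) \<in> T"
  shows "is_tree T"
proof -
  have "(x, y) \<in> T \<or> (y, x) \<in> T" if "(x, z) \<in> T" "(y, z) \<in> T" for x y z
    using assms(1)[of x] assms(4)[OF that] assms(4)[OF that(2,1)] that
    by (metis FieldI1 linorder_less_linear)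
  moreover have "x = y" if "(x, y) \<in> T" "(y, x) \<in> T" for x y
    using assms(3)[OF that(1)] assms(3)[OF that(2)] by simp
  moreover have "T \<subseteq> Field T \<times> Field T" by (auto simp: Field_def)
  moreover have "trans T" using assms(2) by (rule transI)
  ultimately show ?thesis
    using assms(1,3)
    unfolding is_tree_def partial_order_on_def preorder_on_def refl_on_def antisym_def Chains_def
    by auto
qed

lemma is_tree_Restr: "is_tree T \<Longrightarrow> is_tree (Restr T B)"
  by (rule is_treeI)
    (auto simp: Field_Restr_tree dest: tree_refl tree_trans tree_le tree_linear_less)

lemma Field_tree_above: "is_tree T \<Longrightarrow> Field (tree_above T n) = Field T \<inter> {n<..}"
  by (simp add: tree_above_def Field_Restr_tree)

lemma branch_exists:
  assumes T: "is_tree T" and x: "x \<in> Field T"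
  obtains b where "branch T b" "x \<in> b"
proof -
  let ?A = "{c \<in> Chains T. x \<in> c}"
  have "\<exists>M\<in>?A. \<forall>X\<in>?A. M \<subseteq> X \<longrightarrow> X = M"
  proof (rule subset_Zorn_nonempty)
    show "?A \<noteq> {}" using tree_refl[OF T x] by (auto simp: Chains_def intro!: exI[of _ "{x}"])
    fix C assume C: "C \<noteq> {}" "subset.chain ?A C"
    have "(a, b) \<in> T \<or> (b, a) \<in> T" if "a \<in> c" "b \<in> d" "c \<in> C" "d \<in> C" for a b c d
    proof -
      have "c \<subseteq> d \<or> d \<subseteq> c" "c \<in> Chains T" "d \<in> Chains T"
        using C(2) that by (auto simp: subset.chain_def)
      then show ?thesis using that unfolding Chains_def by blast
    qed
    then show "\<Union>C \<in> ?A" using C by (auto simp: Chains_def subset.chain_def)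
  qed
  then obtain M where M: "M \<in> Chains T" "x \<in> M" "\<And>X. X \<in> Chains T \<Longrightarrow> x \<in> X \<Longrightarrow> M \<subseteq> X \<Longrightarrow> X = M"
    by blast
  then have "branch T M" unfolding branch_def by blast
  then show ?thesis using M that by blast
qed

lemma branch_absorb:
  assumes T: "is_tree T" and b: "branch T b" and y: "y \<in> Field T"
    and cmp: "\<And>x. x \<in> b \<Longrightarrow> (x, y) \<in> T \<or> (y, x) \<in> T"
  shows "y \<in> b"
proof -
  have "insert y b \<in> Chains T"
    using b cmp tree_refl[OF T y] unfolding branch_def Chains_def by blast
  then show ?thesis using b unfolding branch_def by blast
qed

lemma branch_Field: "branch T b \<Longrightarrow> b \<subseteq> Field T"
  unfolding branch_def Chains_def Field_def by blast

lemma branch_linear: "branch T b \<Longrightarrow> x \<in> b \<Longrightarrow> y \<in> b \<Longrightarrow> (x, y) \<in> T \<or> (y, x) \<in> T"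
  unfolding branch_def Chains_def by blast

lemma branch_downward:
  assumes T: "is_tree T" and b: "branch T b" and x: "x \<in> b" "(y, x) \<in> T"
  shows "y \<in> b"
proof (rule branch_absorb[OF T b])
  show "y \<in> Field T" using x by (auto intro: FieldI1)
  fix z assume "z \<in> b"
  then show "(z, y) \<in> T \<or> (y, z) \<in> T"
    using branch_linear[OF b _ x(1), of z] x(2) tree_linear[OF T] tree_trans[OF T] by blast
qed

text \<open>The only branch of \<open>S\<close> that can be cofinal in \<open>b\<close> is the trace
  \<open>b \<inter> Field S\<close>. If the trace is cofinal, it is a maximal chain, because a node
  comparable with all of it is comparable with all of \<open>b\<close>. So existence and uniqueness
  reduce to cofinality of the trace.\<close>

lemma tree_le_iff:
  assumes T: "is_tree T"
  shows "T \<le>\<^sub>t S \<longleftrightarrow> S = Restr T (Field S) \<and>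
    (\<forall>b. branch T b \<longrightarrow> (\<forall>x\<in>b. \<exists>s\<in>b \<inter> Field S. (x, s) \<in> T))" (is "_ \<longleftrightarrow> ?R")
proof
  assume ts: "T \<le>\<^sub>t S"
  have "\<exists>s\<in>b \<inter> Field S. (x, s) \<in> T" if b: "branch T b" and x: "x \<in> b" for b x
  proof -
    obtain c where c: "branch S c" "cofinal_in T c b"
      using ts[unfolded tree_le_def, THEN conjunct2, THEN conjunct2] b by blast
    then show ?thesis using x branch_Field[OF c(1)] unfolding cofinal_in_def by blast
  qed
  then show ?R using ts[unfolded tree_le_def, THEN conjunct2, THEN conjunct1] by (intro conjI allI
      impI ballI)
next
  assume R: ?R
  note S = R[THEN conjunct1]
  have S': "(x, y) \<in> S \<longleftrightarrow> (x, y) \<in> T \<and> x \<in> Field S \<and> y \<in> Field S" for x y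
    using arg_cong[OF S, of "\<lambda>R. (x, y) \<in> R"] by simp
  have sub: "Field S \<subseteq> Field T" using S' by (auto simp: Field_def)
  have "\<exists>!c. branch S c \<and> cofinal_in T c b" if b: "branch T b" for b
  proof (rule ex1I[of _ "b \<inter> Field S"])
    have cof: "\<exists>s\<in>b \<inter> Field S. (x, s) \<in> T" if "x \<in> b" for x
      using R[THEN conjunct2] b that by blast
    have ch: "b \<inter> Field S \<in> Chains S"
      using branch_linear[OF b] S' unfolding Chains_def by blast
    have "c = b \<inter> Field S" if c: "c \<in> Chains S" "b \<inter> Field S \<subseteq> c" for c
    proof -
      have "y \<in> b" if y: "y \<in> c" for y
      proof (rule branch_absorb[OF T b])
        have yS: "y \<in> Field S" using c(1) y unfolding Chains_def Field_def by blast
        then show "y \<in> Field T" using sub by blast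
        fix x assume "x \<in> b"
        then obtain s where s: "s \<in> b \<inter> Field S" "(x, s) \<in> T" using cof by blast
        then have "(s, y) \<in> S \<or> (y, s) \<in> S" using c y unfolding Chains_def by blast
        then have "(s, y) \<in> T \<or> (y, s) \<in> T" using S' by blast
        then show "(x, y) \<in> T \<or> (y, x) \<in> T"
          using s(2) tree_trans[OF T] tree_linear[OF T] by blast
      qed
      moreover have "c \<subseteq> Field S" using c(1) unfolding Chains_def Field_def by blast
      ultimately show ?thesis using c(2) by blast
    qed
    then have "branch S (b \<inter> Field S)" using ch unfolding branch_def by blast
    then show "branch S (b \<inter> Field S) \<and> cofinal_in T (b \<inter> Field S) b"
      using cof unfolding cofinal_in_def by blast
    fix c assume c: "branch S c \<and> cofinal_in T c b"
    then have "c \<subseteq> b \<inter> Field S" using branch_Field[of S c] by (auto simp: cofinal_in_def)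
    then show "c = b \<inter> Field S" using c ch by (metis branch_def)
  qed
  then show "T \<le>\<^sub>t S" unfolding tree_le_def by (intro conjI allI impI S sub)
qed

section \<open>Fronts and cofinal extensions of the binary tree\<close>

locale tree_forcing = ccc_P_filter +
  fixes T0 :: "nat rel"
  assumes T0_tree: "is_tree T0" and T0_full: "full_binary T0"
begin

lemma T0_extend:
  assumes s: "s \<in> Field T0"
  shows "\<exists>s'\<in>Field T0. n < s' \<and> (s, s') \<in> T0"
proof -
  obtain f where f: "bij_betw f (Field T0) (UNIV :: bool list set)"
    "\<And>i j. i \<in> Field T0 \<Longrightarrow> j \<in> Field T0 \<Longrightarrow> (i, j) \<in> T0 \<longleftrightarrow> prefix (f i) (f j)"
    using T0_full unfolding full_binary_def by metis
  define g where "g = inv_into (Field T0) f"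
  have g: "g l \<in> Field T0" "f (g l) = l" for l
    using f(1) by (simp_all add: g_def bij_betw_def inv_into_into f_inv_into_f)
  define h where "h k = g (f s @ replicate k True)" for k
  have fh: "f (h k) = f s @ replicate k True" for k by (simp add: h_def g)
  have "inj h" by (rule injI) (metis fh append_eq_append_conv length_replicate same_append_eq)
  then have "infinite (range h)" by (rule range_inj_infinite)
  then have "\<not> range h \<subseteq> {..n}" using finite_subset by blast
  then obtain k where k: "h k > n" by (auto simp: image_subset_iff not_le)
  have "h k \<in> Field T0" by (simp add: h_def g)
  then show ?thesis using k f(2)[OF s] fh by auto
qed

text \<open>\<open>front n N\<close> says that the part of \<open>T\<^sub>0\<close> in the interval from \<open>n\<close> to \<open>N\<close> meets every branch.
  It exists by finite branching, and it determines the position of every later node relative to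
  the numbers up to \<open>n\<close>.\<close>

definition front :: "nat \<Rightarrow> nat \<Rightarrow> bool" where
  "front n N \<longleftrightarrow> n \<le> N \<and> (\<forall>s\<in>Field T0. N < s \<longrightarrow> (\<exists>u\<in>Field T0. n < u \<and> u \<le> N \<and> (u, s) \<in> T0))"

lemma front_exists: "\<exists>N. front n N"
proof -
  obtain f where f: "bij_betw f (Field T0) (UNIV :: bool list set)"
    "\<And>i j. i \<in> Field T0 \<Longrightarrow> j \<in> Field T0 \<Longrightarrow> (i, j) \<in> T0 \<longleftrightarrow> prefix (f i) (f j)"
    using T0_full unfolding full_binary_def by metis
  \<comment> \<open>Sequences of length \<open>L\<close> are longer than all sequences numbered up
    to \<open>n\<close>, so the finitely many nodes of this level have numbers above
    \<open>n\<close>; they form the front.\<close>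
  define L where "L = Suc (\<Sum>i\<le>n. length (f i))"
  have L: "length (f i) < L" if "i \<le> n" for i
    using member_le_sum[of i "{..n}" "\<lambda>i. length (f i)"] that by (simp add: L_def)
  have "finite {l :: bool list. length l \<le> L}"
    using finite_lists_length_le[of "UNIV :: bool set" L] by simp
  then have "finite {u \<in> Field T0. f u \<in> {l. length l \<le> L}}"
    by (rule finite_inverse_image_gen) (use f(1) in \<open>auto simp: bij_betw_def intro: inj_on_subset\<close>)
  then obtain N where N: "\<And>u. u \<in> Field T0 \<Longrightarrow> length (f u) \<le> L \<Longrightarrow> u \<le> N"
    unfolding finite_nat_set_iff_bounded_le by auto
  have "\<exists>u\<in>Field T0. n < u \<and> u \<le> max n N \<and> (u, s) \<in> T0" if s: "s \<in> Field T0" "max n N < s" for s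
  proof -
    have "L < length (f s)" using N[OF s(1)] s(2) by (meson linorder_not_less max_less_iff_conj)
    moreover obtain u where u: "u \<in> Field T0" "f u = take L (f s)"
      using f(1) by (metis UNIV_I bij_betw_imp_surj_on imageE)
    ultimately have "length (f u) = L" by simp
    then have "n < u" "u \<le> N" using L[of u] N[OF u(1)] by (meson linorder_not_le
        order_less_irrefl, simp)
    moreover have "(u, s) \<in> T0" using f(2)[OF u(1) s(1)] u(2) by (simp add: take_is_prefix)
    ultimately show ?thesis using u(1) by auto
  qed
  then show ?thesis unfolding front_def by (intro exI[of _ "max n N"]) auto
qed

text \<open>The branch condition of \<open>\<le>\<^sub>t\<close> is replaced by a condition on
  single nodes, which is easy to check for trees that are cut, extended by a node or formed as
  unions. \<open>tree_family_iff\<close> shows that the same trees result.\<close>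

definition cofinal_ext :: "nat \<Rightarrow> nat rel \<Rightarrow> bool" where
  "cofinal_ext m T \<longleftrightarrow> is_tree T \<and> Field T \<in> I \<and>
     tree_above T0 m = Restr T (Field T0 \<inter> {m<..}) \<and>
     (\<forall>x\<in>Field T. \<exists>s\<in>Field T0. m < s \<and> (x, s) \<in> T)"

lemma cofinal_ext_tree: "cofinal_ext m T \<Longrightarrow> is_tree T"
  by (simp add: cofinal_ext_def)

lemma cofinal_ext_T0:
  assumes "cofinal_ext m T" "x \<in> Field T0" "y \<in> Field T0" "m < x" "m < y"
  shows "(x, y) \<in> T \<longleftrightarrow> (x, y) \<in> T0"
proof -
  have "tree_above T0 m = Restr T (Field T0 \<inter> {m<..})" using assms(1) by (simp add: cofinal_ext_def)
  then have "(x, y) \<in> tree_above T0 m \<longleftrightarrow> (x, y) \<in> Restr T (Field T0 \<inter> {m<..})" by simp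
  then show ?thesis using assms by (simp add: tree_above_def)
qed

lemma cofinal_ext_Field: "cofinal_ext m T \<Longrightarrow> x \<in> Field T0 \<Longrightarrow> m < x \<Longrightarrow> x \<in> Field T"
  using cofinal_ext_T0[of m T x x] tree_refl[OF T0_tree] by (auto intro: FieldI1)

lemma cofinal_extI:
  assumes "is_tree T" "Field T \<in> I"
    and "\<And>x y. x \<in> Field T0 \<Longrightarrow> y \<in> Field T0 \<Longrightarrow> m < x \<Longrightarrow> m < y \<Longrightarrow> (x, y) \<in> T \<longleftrightarrow> (x, y) \<in> T0"
    and "\<And>x. x \<in> Field T \<Longrightarrow> \<exists>s\<in>Field T0. m < s \<and> (x, s) \<in> T"
  shows "cofinal_ext m T"
proof -
  have "tree_above T0 m = Restr T (Field T0 \<inter> {m<..})"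
    using assms(3) by (auto simp: tree_above_def intro: FieldI1 FieldI2)
  then show ?thesis using assms by (simp add: cofinal_ext_def)
qed

lemma cofinal_ext_above:
  assumes T: "cofinal_ext m T" and x: "x \<in> Field T"
  shows "\<exists>s\<in>Field T0. m < s \<and> n < s \<and> (x, s) \<in> T"
proof -
  obtain s where s: "s \<in> Field T0" "m < s" "(x, s) \<in> T"
    using assms unfolding cofinal_ext_def by blast
  obtain s' where s': "s' \<in> Field T0" "max m n < s'" "(s, s') \<in> T0"
    using T0_extend[OF s(1)] by blast
  then have "(s, s') \<in> T" using cofinal_ext_T0[OF T s(1) s'(1) s(2)] by simp
  then show ?thesis using s s' tree_trans[OF cofinal_ext_tree[OF T]] by auto
qed

text \<open>The front meets the path to a node of \<open>T0\<close> above \<open>e\<close>. Both the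
  front node and \<open>e\<close> lie below that node, and among its predecessors the smaller number
  comes first.\<close>

lemma cofinal_ext_front:
  assumes T: "cofinal_ext m T" and f: "front n N" and mn: "m \<le> n" and e: "e \<in> Field T" "N < e"
  shows "\<exists>u\<in>Field T0. n < u \<and> u \<le> N \<and> (u, e) \<in> T"
proof -
  note tr = cofinal_ext_tree[OF T]
  obtain s where s: "s \<in> Field T0" "m < s" "(e, s) \<in> T" using cofinal_ext_above[OF T e(1)] by blast
  then have "N < s" using tree_le[OF tr s(3)] e by simp
  then obtain u where u: "u \<in> Field T0" "n < u" "u \<le> N" "(u, s) \<in> T0"
    using f s(1) unfolding front_def by blast
  then have "(u, s) \<in> T" using cofinal_ext_T0[OF T u(1) s(1)] s mn by simp
  then have "(u, e) \<in> T" using tree_linear_less[OF tr _ s(3)] u e by simp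
  then show ?thesis using u by blast
qed

text \<open>Finite branching enters here. A branch has no last node, since \<open>T0\<close>
  continues above every node; hence it has elements beyond any front, and a front above the number
  \<open>x\<close> puts a node of \<open>T0\<close> on the branch after \<open>x\<close>.\<close>

lemma cofinal_ext_branch:
  assumes T: "cofinal_ext m T" and b: "branch T b" and x: "x \<in> b"
  shows "\<exists>s\<in>b \<inter> Field T0. n < s \<and> (x, s) \<in> T"
proof -
  note tr = cofinal_ext_tree[OF T]
  have inf: "infinite b"
  proof
    assume fin: "finite b"
    define z where "z = Max b"
    have z: "z \<in> b" "\<And>y. y \<in> b \<Longrightarrow> y \<le> z"
      using fin x Max_in[OF fin] unfolding z_def by blast (simp add: fin)
    have "(y, z) \<in> T" if "y \<in> b" for y
      using branch_linear[OF b that z(1)] tree_le[OF tr] z(2)[OF that] by (metis le_antisym)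
    moreover obtain s where s: "s \<in> Field T0" "z < s" "(z, s) \<in> T"
      using cofinal_ext_above[OF T, of z] branch_Field[OF b] z(1) by blast
    ultimately have "s \<in> b"
      by (intro branch_absorb[OF tr b]) (auto intro: FieldI2 tree_trans[OF tr])
    then show False using z(2)[of s] s(2) by simp
  qed
  obtain N where N: "front (max n (max m x)) N" using front_exists by blast
  have "\<not> b \<subseteq> {..N}" using inf finite_subset by blast
  then obtain e where e: "e \<in> b" "N < e" by (meson atMost_iff not_le subsetI)
  obtain u where u: "u \<in> Field T0" "max n (max m x) < u" "(u, e) \<in> T"
    using cofinal_ext_front[OF T N _ subsetD[OF branch_Field[OF b] e(1)] e(2)] by (auto simp:
        le_max_iff_disj)
  have ub: "u \<in> b" using branch_downward[OF tr b e(1) u(3)] .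
  moreover have "(x, u) \<in> T" using branch_linear[OF b x ub] tree_le[OF tr, of u x] u(2) by auto
  ultimately show ?thesis using u by auto
qed

lemma tree_family_iff: "T \<in> tree_family F T0 \<longleftrightarrow> (\<exists>m. cofinal_ext m T)"
proof
  assume T: "T \<in> tree_family F T0"
  then obtain m where m: "T \<le>\<^sub>t tree_above T0 m" and tr: "is_tree T" "Field T \<in> I"
    unfolding tree_family_def by blast
  note le = m[unfolded tree_le_iff[OF tr(1)] Field_tree_above[OF T0_tree]]
  have "\<exists>s\<in>Field T0. m < s \<and> (x, s) \<in> T" if "x \<in> Field T" for x
    using branch_exists[OF tr(1) that] le by (metis IntD1 IntD2 greaterThan_iff)
  then show "\<exists>m. cofinal_ext m T" using tr le unfolding cofinal_ext_def by blast
next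
  assume "\<exists>m. cofinal_ext m T"
  then obtain m where m: "cofinal_ext m T" ..
  have "T \<le>\<^sub>t tree_above T0 m"
    unfolding tree_le_iff[OF cofinal_ext_tree[OF m]] Field_tree_above[OF T0_tree]
    using cofinal_ext_branch[OF m, of _ _ m] m
    by (auto simp: cofinal_ext_def) (metis (no_types, lifting) IntD1 IntD2 IntI greaterThan_iff)
  then show "T \<in> tree_family F T0" using m unfolding tree_family_def cofinal_ext_def by blast
qed

text \<open>Nodes of \<open>T0\<close> beyond the bound of \<open>S\<close> belong to
  \<open>S\<close> and are cofinal in every branch of \<open>T\<close>, so the branch condition
  holds automatically.\<close>

lemma tree_family_le_iff:
  assumes T: "T \<in> tree_family F T0" and S: "S \<in> tree_family F T0"
  shows "T \<le>\<^sub>t S \<longleftrightarrow> S = Restr T (Field S)"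
proof -
  obtain m m' where m: "cofinal_ext m T" "cofinal_ext m' S" using assms tree_family_iff by blast
  have "\<exists>s\<in>b \<inter> Field S. (x, s) \<in> T" if "branch T b" "x \<in> b" for b x
    using cofinal_ext_branch[OF m(1) that, of m'] cofinal_ext_Field[OF m(2)] by blast
  then show ?thesis unfolding tree_le_iff[OF cofinal_ext_tree[OF m(1)]] by blast
qed

end

section \<open>Conditions\<close>

abbreviation supp :: "condition \<Rightarrow> nat set" where "supp p \<equiv> Field (fst p)"

definition cut :: "nat set \<Rightarrow> condition \<Rightarrow> condition" where
  "cut B p = (Restr (fst p) B, snd p |` B)"

context tree_forcing
begin

abbreviation "PC \<equiv> P_conditions F T0"
abbreviation "PF \<equiv> P_forcing F T0"

lemma PC_iff:
  "p \<in> PC \<longleftrightarrow> (\<exists>m. cofinal_ext m (fst p)) \<and> dom (snd p) = supp p \<and> ran (snd p) \<subseteq> {0, 1}"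
  by (cases p) (simp add: P_conditions_def tree_family_iff)

lemma PC_tree: "p \<in> PC \<Longrightarrow> is_tree (fst p)"
  unfolding PC_iff by (auto dest: cofinal_ext_tree)

lemma PF_iff:
  "(p, q) \<in> PF \<longleftrightarrow> p \<in> PC \<and> q \<in> PC \<and> supp q \<subseteq> supp p \<and>
     (\<forall>x\<in>supp q. \<forall>y\<in>supp q. (x, y) \<in> fst q \<longleftrightarrow> (x, y) \<in> fst p) \<and>
     (\<forall>x\<in>supp q. snd q x = snd p x)" (is "_ \<longleftrightarrow> ?R")
proof -
  have "(p, q) \<in> PF \<longleftrightarrow> p \<in> PC \<and> q \<in> PC \<and> fst q = Restr (fst p) (supp q) \<and> snd q \<subseteq>\<^sub>m snd p"
  proof -
    have "fst p \<in> tree_family F T0" if "p \<in> PC" for p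
      using that by (auto simp: P_conditions_def)
    then show ?thesis unfolding P_forcing_def using tree_family_le_iff by blast
  qed
  also have "\<dots> \<longleftrightarrow> ?R"
  proof -
    have "fst q = Restr (fst p) (supp q) \<longleftrightarrow>
        supp q \<subseteq> supp p \<and> (\<forall>x\<in>supp q. \<forall>y\<in>supp q. (x, y) \<in> fst q \<longleftrightarrow> (x, y) \<in> fst p)"
      if q: "q \<in> PC"
    proof
      assume eq: "fst q = Restr (fst p) (supp q)"
      have *: "(x, y) \<in> fst q \<longleftrightarrow> (x, y) \<in> fst p \<and> x \<in> supp q \<and> y \<in> supp q" for x y
        using arg_cong[OF eq, of "\<lambda>R. (x, y) \<in> R"] by simp
      then have "supp q \<subseteq> supp p" using tree_refl[OF PC_tree[OF q]] by (blast intro: FieldI1)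
      then show "supp q \<subseteq> supp p \<and> (\<forall>x\<in>supp q. \<forall>y\<in>supp q. (x, y) \<in> fst q \<longleftrightarrow> (x, y) \<in> fst p)"
        using * by blast
    next
      assume "supp q \<subseteq> supp p \<and> (\<forall>x\<in>supp q. \<forall>y\<in>supp q. (x, y) \<in> fst q \<longleftrightarrow> (x, y) \<in> fst p)"
      then show "fst q = Restr (fst p) (supp q)" by (auto intro: FieldI1 FieldI2)
    qed
    moreover have "snd q \<subseteq>\<^sub>m snd p \<longleftrightarrow> (\<forall>x\<in>supp q. snd q x = snd p x)" if "q \<in> PC"
      using that by (simp add: PC_iff map_le_def)
    ultimately show ?thesis by blast
  qed
  finally show ?thesis .
qed

lemma PF_refl: "p \<in> PC \<Longrightarrow> (p, p) \<in> PF"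
  by (simp add: PF_iff)

lemma PF_trans: "(p, q) \<in> PF \<Longrightarrow> (q, r) \<in> PF \<Longrightarrow> (p, r) \<in> PF"
  unfolding PF_iff by (metis (no_types, opaque_lifting) subsetD subset_trans)

lemma PF_PC: "(p, q) \<in> PF \<Longrightarrow> p \<in> PC" "(p, q) \<in> PF \<Longrightarrow> q \<in> PC"
  by (simp_all add: PF_iff)

lemma PF_supp: "(p, q) \<in> PF \<Longrightarrow> supp q \<subseteq> supp p"
  by (simp add: PF_iff)

lemma PF_order: "(p, q) \<in> PF \<Longrightarrow> x \<in> supp q \<Longrightarrow> y \<in> supp q \<Longrightarrow> (x, y) \<in> fst q \<longleftrightarrow> (x, y) \<in> fst p"
  by (simp add: PF_iff)

lemma PF_order': "(p, q) \<in> PF \<Longrightarrow> (x, y) \<in> fst q \<Longrightarrow> (x, y) \<in> fst p"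
  using PF_order[of p q x y] by (auto intro: FieldI1 FieldI2)

lemma PF_value: "(p, q) \<in> PF \<Longrightarrow> x \<in> supp q \<Longrightarrow> snd q x = snd p x"
  by (simp add: PF_iff)

lemma PF_eqI:
  assumes pq: "(p, q) \<in> PF" and s: "supp p \<subseteq> supp q"
  shows "p = q"
proof (rule prod_eqI)
  have eq: "supp p = supp q" using pq s by (auto simp: PF_iff)
  show "fst p = fst q" using pq unfolding PF_iff eq
    by (auto) (metis FieldI1 FieldI2 eq)+
  have "dom (snd p) = dom (snd q)" using pq eq by (simp add: PF_iff PC_iff)
  then show "snd p = snd q" using pq eq
    by (intro ext) (metis PF_iff PC_iff domIff)
qed

lemma PF_antisym: "(p, q) \<in> PF \<Longrightarrow> (q, p) \<in> PF \<Longrightarrow> p = q"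
  by (rule PF_eqI) (simp_all add: PF_iff)

lemma supp_cut: "p \<in> PC \<Longrightarrow> supp (cut B p) = supp p \<inter> B"
  by (simp add: cut_def Field_Restr_tree PC_tree)

text \<open>The bound \<open>m\<close> of a condition stays valid for all its extensions, so a
  single choice of fronts serves the whole forcing below the condition.\<close>

lemma PF_cofinal_ext:
  assumes m: "cofinal_ext m (fst p)" and qp: "(q, p) \<in> PF"
  shows "cofinal_ext m (fst q)"
proof -
  obtain m' where m': "cofinal_ext m' (fst q)" using PF_PC[OF qp] by (auto simp: PC_iff)
  show ?thesis
  proof (rule cofinal_extI)
    show "(x, y) \<in> fst q \<longleftrightarrow> (x, y) \<in> T0"
      if "x \<in> Field T0" "y \<in> Field T0" "m < x" "m < y" for x y
      using cofinal_ext_T0[OF m that] PF_order[OF qp] cofinal_ext_Field[OF m] that by blast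
    show "\<exists>s\<in>Field T0. m < s \<and> (x, s) \<in> fst q" if "x \<in> supp q" for x
      using cofinal_ext_above[OF m' that] by blast
  qed (use m' in \<open>auto simp: cofinal_ext_def\<close>)
qed

lemma PC_cofinal_ext:
  assumes "p \<in> PC"
  shows "\<exists>m. \<forall>q. (q, p) \<in> PF \<longrightarrow> cofinal_ext m (fst q)"
proof -
  obtain m where "cofinal_ext m (fst p)" using assms by (auto simp: PC_iff)
  then show ?thesis using PF_cofinal_ext by (intro exI[of _ m]) simp
qed

text \<open>All nodes of \<open>T0\<close> beyond \<open>m\<close> lie in \<open>supp q\<close>,
  hence in \<open>B\<close>, so the cut remains cofinal. This is the source of interpolants between
  two conditions, in particular of extensions by a single number.\<close>

lemma cut_between:
  assumes pq: "(p, q) \<in> PF" and B: "supp q \<subseteq> B"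
  shows "(p, cut B p) \<in> PF" "(cut B p, q) \<in> PF"
proof -
  note PC = PF_PC[OF pq]
  obtain m where m: "cofinal_ext m (fst q)" "cofinal_ext m (fst p)"
    using PC_cofinal_ext[OF PC(2)] PF_refl[OF PC(2)] pq by blast
  have T0q: "x \<in> supp q" if "x \<in> Field T0" "m < x" for x using cofinal_ext_Field[OF m(1) that] .
  have "cofinal_ext m (Restr (fst p) B)"
  proof (rule cofinal_extI)
    show "is_tree (Restr (fst p) B)" by (intro is_tree_Restr PC_tree PC)
    show "Field (Restr (fst p) B) \<in> I"
      using m(2) I_subset[of "supp p"] by (auto simp: cofinal_ext_def Field_Restr_tree)
    show "(x, y) \<in> Restr (fst p) B \<longleftrightarrow> (x, y) \<in> T0"
      if "x \<in> Field T0" "y \<in> Field T0" "m < x" "m < y" for x y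
      using that B T0q cofinal_ext_T0[OF m(2) that] by blast
    show "\<exists>s\<in>Field T0. m < s \<and> (x, s) \<in> Restr (fst p) B" if "x \<in> Field (Restr (fst p) B)" for x
      using cofinal_ext_above[OF m(2)] that B T0q by (simp add: Field_Restr_tree PC_tree PC) blast
  qed
  then have e: "\<exists>m. cofinal_ext m (fst (cut B p))" by (auto simp: cut_def)
  have s: "supp (cut B p) = supp p \<inter> B" by (rule supp_cut[OF PC(1)])
  have o: "(x, y) \<in> fst (cut B p) \<longleftrightarrow> (x, y) \<in> fst p" if "x \<in> B" "y \<in> B" for x y
    using that by (simp add: cut_def)
  have v: "snd (cut B p) x = snd p x" if "x \<in> B" for x using that by (simp add: cut_def)
  have d: "dom (snd p) = supp p" "ran (snd p) \<subseteq> {0, 1}" using PC(1) by (simp_all add: PC_iff)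
  have "dom (snd (cut B p)) = supp p \<inter> B" using d(1) by (simp add: cut_def)
  moreover have "ran (snd (cut B p)) \<subseteq> {0, 1}"
    using d(2) ran_restrictD[of _ "snd p" B] by (fastforce simp: cut_def ran_def restrict_map_def)
  ultimately have c: "cut B p \<in> PC" using e s by (simp add: PC_iff)
  show "(p, cut B p) \<in> PF"
    unfolding PF_iff using PC(1) c s o v by simp
  show "(cut B p, q) \<in> PF"
    unfolding PF_iff using PC(2) c
  proof (intro conjI ballI)
    show "supp q \<subseteq> supp (cut B p)" using s B PF_supp[OF pq] by simp
    show "(x, y) \<in> fst q \<longleftrightarrow> (x, y) \<in> fst (cut B p)" if "x \<in> supp q" "y \<in> supp q" for x y
      using o[of x y] that B PF_order[OF pq that] by blast
    show "snd q x = snd (cut B p) x" if "x \<in> supp q" for x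
      using v[of x] that B PF_value[OF pq that] by auto
  qed
qed

section \<open>Adding numbers to a condition and amalgamating\<close>

lemma PC_extendI:
  assumes pq: "p \<in> PC" and t: "is_tree T" and sT: "Field T = insert j (supp p)" and j: "j \<notin> supp p"
    and ord: "\<And>x y. x \<in> supp p \<Longrightarrow> y \<in> supp p \<Longrightarrow> (x, y) \<in> T \<longleftrightarrow> (x, y) \<in> fst p"
    and above: "\<exists>s\<in>supp p. (j, s) \<in> T" and v: "v \<in> {0, 1}"
  shows "((T, (snd p)(j \<mapsto> v)), p) \<in> PF"
proof -
  obtain m where m: "cofinal_ext m (fst p)" using pq by (auto simp: PC_iff)
  have T0p: "x \<in> supp p" if "x \<in> Field T0" "m < x" for x using cofinal_ext_Field[OF m that] .
  have "cofinal_ext m T"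
  proof (rule cofinal_extI[OF t])
    show "Field T \<in> I"
      unfolding sT using m I_Un[OF I_finite[of "{j}"]] by (simp add: cofinal_ext_def)
    show "(x, y) \<in> T \<longleftrightarrow> (x, y) \<in> T0"
      if "x \<in> Field T0" "y \<in> Field T0" "m < x" "m < y" for x y
      using that T0p ord cofinal_ext_T0[OF m that] by simp
    have old: "\<exists>s\<in>Field T0. m < s \<and> (x, s) \<in> T" if x: "x \<in> supp p" for x
      using cofinal_ext_above[OF m x] ord[OF x] T0p by blast
    show "\<exists>s\<in>Field T0. m < s \<and> (x, s) \<in> T" if x: "x \<in> Field T" for x
      using x old above tree_trans[OF t] unfolding sT by blast
  qed
  moreover have "ran ((snd p)(j \<mapsto> v)) \<subseteq> {0, 1}"
    using pq v by (auto simp: PC_iff ran_def)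
  moreover have "dom ((snd p)(j \<mapsto> v)) = Field T"
    using pq sT by (auto simp: PC_iff)
  ultimately show ?thesis using pq sT ord j by (auto simp: PF_iff PC_iff)
qed

lemma insert_exists:
  assumes p: "p \<in> PC" and j: "j \<notin> supp p"
  shows "\<exists>y. (y, p) \<in> PF \<and> supp y = insert j (supp p)"
proof -
  let ?T = "fst p"
  note t = PC_tree[OF p]
  obtain m where m: "cofinal_ext m ?T" using p by (auto simp: PC_iff)
  obtain i :: nat where "i \<in> Field T0"
    using T0_full unfolding full_binary_def by (metis UNIV_I bij_betw_def imageE)
  then obtain s0 where s0: "s0 \<in> Field T0" "max m j < s0" using T0_extend by blast
  then have s0p: "s0 \<in> supp p" using cofinal_ext_Field[OF m] by simp
  \<comment> \<open>The new node is placed immediately below \<open>s\<close>, the first node on the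
    way to \<open>s0\<close> with a number above \<open>j\<close>; the strict predecessors of
    \<open>s\<close> then have numbers below \<open>j\<close>, as the numbering of trees
    requires.\<close>
  define s where "s = (LEAST s. j < s \<and> (s, s0) \<in> ?T)"
  have s: "j < s" "(s, s0) \<in> ?T"
    using LeastI[of "\<lambda>s. j < s \<and> (s, s0) \<in> ?T" s0] tree_refl[OF t s0p] s0(2) by (auto simp: s_def)
  have sl: "z < j" if "(z, s) \<in> ?T" "z \<noteq> s" for z
  proof -
    have "(z, s0) \<in> ?T" using tree_trans[OF t that(1) s(2)] .
    moreover have "z < s" using tree_le[OF t that(1)] that(2) by simp
    ultimately have "\<not> j < z" using not_less_Least[of z "\<lambda>s. j < s \<and> (s, s0) \<in> ?T"] by (auto simp:
        s_def)
    moreover have "z \<noteq> j" using that(1) j by (auto intro: FieldI1)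
    ultimately show ?thesis by simp
  qed
  have sp: "s \<in> supp p" using s(2) by (auto intro: FieldI1)
  define T' where "T' = ?T \<union> {(z, j) | z. (z, s) \<in> ?T \<and> z \<noteq> s} \<union> {(j, j)} \<union> {(j, y) | y. (s, y) \<in> ?T}"
  have T': "(x, y) \<in> T' \<longleftrightarrow> (x, y) \<in> ?T \<or> (y = j \<and> (x, s) \<in> ?T \<and> x \<noteq> s) \<or> (x = j \<and> y = j) \<or>
      (x = j \<and> (s, y) \<in> ?T)" for x y
    by (auto simp: T'_def)
  have nj: "(x, j) \<notin> ?T" "(j, x) \<notin> ?T" for x using j by (auto intro: FieldI1 FieldI2)
  have FT': "Field T' = insert j (supp p)"
    unfolding T'_def using sp by (auto simp: Field_def)
  have "is_tree T'"
  proof (rule is_treeI)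
    show "(x, x) \<in> T'" if "x \<in> Field T'" for x
      using that tree_refl[OF t] unfolding FT' T' by blast
    show "x \<le> y" if "(x, y) \<in> T'" for x y
      using that sl[of x] tree_le[OF t, of x y] tree_le[OF t, of s y] s(1) unfolding T' by auto
    show "(x, z) \<in> T'" if "(x, y) \<in> T'" "(y, z) \<in> T'" for x y z
    proof -
      have anti: "w = s" if "(s, w) \<in> ?T" "(w, s) \<in> ?T" for w
        using tree_le[OF t that(1)] tree_le[OF t that(2)] by simp
      show ?thesis
      proof (cases "y = j")
        case True
        show ?thesis
        proof (cases "x = j \<or> z = j")
          case False
          then have "(x, s) \<in> ?T" "(s, z) \<in> ?T" using that True nj unfolding T' by blast+
          then show ?thesis using tree_trans[OF t] unfolding T' by blast
        qed (use that True in auto)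
      next
        case y: False
        show ?thesis
        proof (cases "x = j")
          case True
          then have sy: "(s, y) \<in> ?T" using that(1) y nj unfolding T' by blast
          then have "z \<noteq> j" using that(2) anti y nj unfolding T' by blast
          then have "(y, z) \<in> ?T" using that(2) y unfolding T' by blast
          then show ?thesis using tree_trans[OF t sy] True unfolding T' by blast
        next
          case False
          then have xy: "(x, y) \<in> ?T" using that(1) y unfolding T' by blast
          show ?thesis
          proof (cases "z = j")
            case True
            then have "(y, s) \<in> ?T" "y \<noteq> s" using that(2) y nj unfolding T' by blast+
            then show ?thesis using tree_trans[OF t xy] anti xy True unfolding T' by blast
          next
            case False
            then have "(y, z) \<in> ?T" using that(2) y unfolding T' by blast
            then show ?thesis using tree_trans[OF t xy] unfolding T' by blast
          qed
        qed
      qed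
    qed
    show "(x, y) \<in> T'" if *: "(x, z) \<in> T'" "(y, z) \<in> T'" "x < y" for x y z
    proof -
      consider "x = j" | "y = j" | "x \<noteq> j" "y \<noteq> j" by blast
      then show ?thesis
      proof cases
        case 1
        then have "y \<noteq> j" using * by simp
        then consider "z = j" "(y, s) \<in> ?T" "y \<noteq> s" | "(y, z) \<in> ?T" "(s, z) \<in> ?T"
          using * nj unfolding T' 1 by blast
        then show ?thesis
        proof cases
          case 1 then show ?thesis using sl[of y] \<open>x = j\<close> *(3) by simp
        next
          case 2
          then have "(s, y) \<in> ?T \<or> (y, s) \<in> ?T" using tree_linear[OF t] by blast
          moreover have "y = s" if "(y, s) \<in> ?T" using sl[OF that] *(3) 1 by fastforce
          ultimately show ?thesis using tree_refl[OF t sp] unfolding T' 1 by blast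
        qed
      next
        case 2
        then consider "z = j" | "(s, z) \<in> ?T" "(x, z) \<in> ?T" using * nj unfolding T' by blast
        then show ?thesis
        proof cases
          case 1 then show ?thesis using * 2 by simp
        next
          case b: 2
          have "x < s" using *(3) 2 s(1) by simp
          then show ?thesis using tree_linear_less[OF t b(2,1)] 2 unfolding T' by blast
        qed
      next
        case 3
        show ?thesis
        proof (cases "z = j")
          case True
          then have "(x, s) \<in> ?T" "(y, s) \<in> ?T" using * 3 nj unfolding T' by blast+
          then show ?thesis using tree_linear_less[OF t _ _ *(3)] unfolding T' by blast
        next
          case False
          then have "(x, z) \<in> ?T" "(y, z) \<in> ?T" using * 3 unfolding T' by blast+
          then show ?thesis using tree_linear_less[OF t _ _ *(3)] unfolding T' by blast
        qed
      qed
    qed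
  qed
  then have "((T', (snd p)(j \<mapsto> 0)), p) \<in> PF"
  proof (rule PC_extendI[OF p _ FT' j])
    show "(x, y) \<in> T' \<longleftrightarrow> (x, y) \<in> ?T" if "x \<in> supp p" "y \<in> supp p" for x y
      using that j unfolding T' by blast
    show "\<exists>s\<in>supp p. (j, s) \<in> T'" using sp tree_refl[OF t sp] unfolding T' by blast
  qed simp
  then show ?thesis using FT' by (intro exI[of _ "(T', (snd p)(j \<mapsto> 0))"]) simp
qed

lemma fill_exists:
  assumes "finite A" "p \<in> PC"
  shows "\<exists>y. (y, p) \<in> PF \<and> supp y = supp p \<union> A"
  using assms(1)
proof induction
  case empty then show ?case using PF_refl[OF assms(2)] by (intro exI[of _ p]) simp
next
  case (insert a A)
  then obtain y where y: "(y, p) \<in> PF" "supp y = supp p \<union> A" by blast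
  show ?case
  proof (cases "a \<in> supp y")
    case True then show ?thesis using y by (intro exI[of _ y]) auto
  next
    case False
    then obtain z where "(z, y) \<in> PF" "supp z = Set.insert a (supp y)"
      using insert_exists[OF PF_PC(1)[OF y(1)]] by blast
    then show ?thesis using y PF_trans by (intro exI[of _ z]) auto
  qed
qed

text \<open>If all new nodes of \<open>q\<close> lie above a front beyond \<open>j\<close>, then \<open>j\<close> has the same
  position relative to \<open>q\<close> as it has relative to \<open>p\<close>.\<close>

lemma amalgamation:
  assumes p0: "p0 \<in> PC"
  shows "\<exists>K\<ge>j. \<forall>p y q. (p, p0) \<in> PF \<and> (y, p) \<in> PF \<and> supp y = insert j (supp p) \<and>
    (q, p) \<in> PF \<and> j \<notin> supp q \<and> (\<forall>e\<in>supp q - supp p. K < e) \<longrightarrow>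
    (\<exists>t. (t, y) \<in> PF \<and> (t, q) \<in> PF)"
proof -
  obtain m where m0: "\<And>q. (q, p0) \<in> PF \<Longrightarrow> cofinal_ext m (fst q)"
    using PC_cofinal_ext[OF p0] by blast
  \<comment> \<open>The front is taken beyond \<open>m\<close>, so that its nodes belong to
    \<open>supp p\<close>, and beyond \<open>j\<close>, so that they are larger than
    \<open>j\<close>.\<close>
  obtain K where K: "front (max m j) K" using front_exists by blast
  then have jK: "j \<le> K" by (simp add: front_def)
  have "\<exists>t. (t, y) \<in> PF \<and> (t, q) \<in> PF"
    if pp0: "(p, p0) \<in> PF" and y: "(y, p) \<in> PF" "supp y = insert j (supp p)" and q: "(q, p) \<in> PF"
      and j: "j \<notin> supp q" and new: "\<And>e. e \<in> supp q \<Longrightarrow> e \<notin> supp p \<Longrightarrow> K < e" for p y q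
  proof -
    have p: "p \<in> PC" using PF_PC(1)[OF pp0] .
    have m: "cofinal_ext m (fst q)" if "(q, p) \<in> PF" for q using m0[OF PF_trans[OF that pp0]] .
    let ?T = "fst p" and ?T1 = "fst y" and ?T2 = "fst q"
    have jp: "j \<notin> supp p" using j PF_supp[OF q] by blast
    note t = PC_tree[OF p] and t1 = PC_tree[OF PF_PC(1)[OF y(1)]] and t2 = PC_tree[OF PF_PC(1)[OF q]]
    have fr: "\<exists>u\<in>supp p. j < u \<and> (u, e) \<in> ?T2" if e: "e \<in> supp q" "e \<notin> supp p" for e
    proof -
      obtain u where u: "u \<in> Field T0" "max m j < u" "(u, e) \<in> ?T2"
        using cofinal_ext_front[OF m[OF q] K _ e(1) new[OF e]] by auto
      have "u \<in> supp p" using cofinal_ext_Field[OF m[OF PF_refl[OF p]] u(1)] u(2) by simp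
      then show ?thesis using u by auto
    qed
    have E1: "(x, z) \<in> ?T1 \<longleftrightarrow> (x, z) \<in> ?T" if "x \<in> supp p" "z \<in> supp p" for x z
      using PF_order[OF y(1) that] by simp
    have E2: "(x, z) \<in> ?T2 \<longleftrightarrow> (x, z) \<in> ?T" if "x \<in> supp p" "z \<in> supp p" for x z
      using PF_order[OF q that] by simp
    \<comment> \<open>A new node \<open>e\<close> of \<open>q\<close> is put above \<open>j\<close>
      exactly if some node of \<open>p\<close> lies above \<open>j\<close> in \<open>y\<close> and
      below \<open>e\<close> in \<open>q\<close>; \<open>j\<close> gets no other predecessors than
      in \<open>y\<close>.\<close>
    define T' where "T' = ?T1 \<union> ?T2 \<union> {(j, e) | e u. u \<in> supp p \<and> (j, u) \<in> ?T1 \<and> (u, e) \<in> ?T2}"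
    have Fs: "x \<in> supp y" "z \<in> supp y" if "(x, z) \<in> ?T1" for x z using that by (auto intro:
        FieldI1 FieldI2)
    have F2: "x \<in> supp q" "z \<in> supp q" if "(x, z) \<in> ?T2" for x z using that by (auto intro:
        FieldI1 FieldI2)
    have sub: "supp p \<subseteq> supp q" using PF_supp[OF q] .
    have jj: "(j, j) \<in> ?T1" using tree_refl[OF t1, of j] y(2) by simp
    have N1: "(x, z) \<in> T' \<longleftrightarrow> (x, z) \<in> ?T2" if "x \<noteq> j" "z \<noteq> j" for x z
      using that Fs[of x z] E1[of x z] E2[of x z] y(2) unfolding T'_def by auto
    have N2: "(x, j) \<in> T' \<longleftrightarrow> (x, j) \<in> ?T1" for x
      using F2[of _ j] j by (auto simp: T'_def)
    have N3: "(j, e) \<in> T' \<longleftrightarrow> (\<exists>u\<in>supp p. (j, u) \<in> ?T1 \<and> (u, e) \<in> ?T2)" if "e \<noteq> j" for e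
      using that F2[of j e] j Fs[of j e] y(2) tree_refl[OF t2, of e] sub by (auto simp: T'_def)
    have N4: "(j, e) \<in> T' \<longleftrightarrow> (j, e) \<in> ?T1" if "e \<in> supp p" for e
    proof -
      have "e \<noteq> j" using that jp by blast
      moreover have "(j, e) \<in> ?T1" if "u \<in> supp p" "(j, u) \<in> ?T1" "(u, e) \<in> ?T2" for u
        using tree_trans[OF t1 that(2)] E1[of u e] E2[of u e] that \<open>e \<in> supp p\<close> by blast
      moreover have "(e, e) \<in> ?T2" using tree_refl[OF t2, of e] sub that by blast
      ultimately show ?thesis using N3[of e] that by blast
    qed
    have N5: "x \<in> supp p" if "(x, j) \<in> ?T1" "x \<noteq> j" for x
      using Fs[OF that(1)] that(2) y(2) by simp
    have FT': "Field T' = insert j (supp q)"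
    proof
      show "Field T' \<subseteq> insert j (supp q)"
      proof
        fix x assume "x \<in> Field T'"
        then obtain z where "(x, z) \<in> T' \<or> (z, x) \<in> T'" by (auto simp: Field_def)
        then show "x \<in> insert j (supp q)"
          using N1[of x z] N1[of z x] N2[of x] N3[of x] N5[of x] F2[of _ x] F2[of x] sub by blast
      qed
      have "(j, j) \<in> T'" using N2 jj by blast
      moreover have "(x, x) \<in> T'" if "x \<in> supp q" for x
        using N1[of x x] tree_refl[OF t2 that] j that by blast
      ultimately show "insert j (supp q) \<subseteq> Field T'" by (auto intro: FieldI1)
    qed
    have t': "is_tree T'"
    proof (rule is_treeI)
      show "(x, x) \<in> T'" if "x \<in> Field T'" for x
        using that N1[of x x] N2[of x] jj tree_refl[OF t2] unfolding FT' by blast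
      show le: "x \<le> z" if "(x, z) \<in> T'" for x z
        using that unfolding T'_def by (auto dest!: tree_le[OF t1] tree_le[OF t2])
      show "(x, z) \<in> T'" if *: "(x, w) \<in> T'" "(w, z) \<in> T'" for x w z
      proof -
        consider "w = j" "x = j" | "w = j" "z = j" | "w = j" "x \<noteq> j" "z \<noteq> j" | "w \<noteq> j" "x = j" "z = j"
          | "w \<noteq> j" "x = j" "z \<noteq> j" | "w \<noteq> j" "x \<noteq> j" "z = j" | "w \<noteq> j" "x \<noteq> j" "z \<noteq> j"
          by metis
        then show ?thesis
        proof cases
          case 3
          then obtain u where u: "u \<in> supp p" "(j, u) \<in> ?T1" "(u, z) \<in> ?T2" using * N3 by blast
          have "(x, j) \<in> ?T1" using * N2 3 by blast
          then have "x \<in> supp p" "(x, u) \<in> ?T1" using 3 N5 u tree_trans[OF t1] by blast+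
          then have "(x, u) \<in> ?T2" using E1 E2 u by blast
          then show ?thesis using N1[of x z] 3 u tree_trans[OF t2] by blast
        next
          case 4 then show ?thesis using N2 jj by blast
        next
          case 5
          then obtain u where u: "u \<in> supp p" "(j, u) \<in> ?T1" "(u, w) \<in> ?T2" using * N3 by blast
          moreover have "(w, z) \<in> ?T2" using * N1 5 by blast
          ultimately show ?thesis using N3[of z] 5 tree_trans[OF t2] by blast
        next
          case 6
          then have w: "(w, j) \<in> ?T1" "(x, w) \<in> ?T2" using * N1 N2 by blast+
          then have wp: "w \<in> supp p" using N5 6 by blast
          \<comment> \<open>No new node of \<open>q\<close> can lie below \<open>j\<close>, since
            its number exceeds \<open>K \<ge> j\<close>.\<close>
          have "x \<in> supp p"
          proof (rule ccontr)
            assume "x \<notin> supp p"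
            then have "K < x" using new F2[OF w(2)] by blast
            then show False using tree_le[OF t2 w(2)] tree_le[OF t1 w(1)] jK by simp
          qed
          then have "(x, w) \<in> ?T1" using E1 E2 wp w by blast
          then show ?thesis using tree_trans[OF t1 _ w(1)] N2 6 by blast
        next
          case 7 then show ?thesis using * N1 tree_trans[OF t2] by blast
        qed (use * in auto)
      qed
      show "(x, z) \<in> T'" if *: "(x, w) \<in> T'" "(z, w) \<in> T'" "x < z" for x z w
      proof -
        consider "w = j" | "w \<noteq> j" "x = j" | "w \<noteq> j" "z = j" | "w \<noteq> j" "x \<noteq> j" "z \<noteq> j" by blast
        then show ?thesis
        proof cases
          case 1
          then have "(x, z) \<in> ?T1" using * N2 tree_linear_less[OF t1] by blast
          then show ?thesis by (simp add: T'_def)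
        next
          case 2
          then obtain u where u: "u \<in> supp p" "(j, u) \<in> ?T1" "(u, w) \<in> ?T2" using * N3 by blast
          have zj: "z \<noteq> j" using * 2 by simp
          then have zw: "(z, w) \<in> ?T2" using * N1 2 by blast
          consider "(u, z) \<in> ?T2" | "(z, u) \<in> ?T2" using tree_linear[OF t2 u(3) zw] by blast
          then show ?thesis
          proof cases
            case 1 then show ?thesis using N3[OF zj] u 2 by blast
          next
            case b: 2
            \<comment> \<open>An old node beyond \<open>j\<close> lies at or below \<open>z\<close>:
              either \<open>z\<close> itself or the front node under it. Comparing it with
              \<open>j\<close> below \<open>u\<close> in \<open>y\<close> places it above
              \<open>j\<close>.\<close>
            have "\<exists>v\<in>supp p. j < v \<and> (v, z) \<in> ?T2"
            proof (cases "z \<in> supp p")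
              case True
              then show ?thesis using tree_refl[OF t2, of z] sub *(3) 2 by blast
            next
              case False
              then show ?thesis using fr F2[OF zw] by blast
            qed
            then obtain v where v: "v \<in> supp p" "j < v" "(v, z) \<in> ?T2" by blast
            then have "(v, u) \<in> ?T1" using tree_trans[OF t2 v(3) b] E1 E2 u v by blast
            then have "(j, v) \<in> ?T1" using tree_linear_less[OF t1 u(2) _ v(2)] by blast
            then show ?thesis using N3[OF zj] v 2 by blast
          qed
        next
          case 3
          then obtain u where u: "u \<in> supp p" "(j, u) \<in> ?T1" "(u, w) \<in> ?T2" using * N3 by blast
          have xj: "x \<noteq> j" using * 3 by simp
          then have xw: "(x, w) \<in> ?T2" using * N1 3 by blast
          have "x < u" using *(3) 3 tree_le[OF t1 u(2)] by simp
          then have xu: "(x, u) \<in> ?T2" using tree_linear_less[OF t2 xw u(3)] by blast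
          have "x \<in> supp p" using new[of x] F2[OF xw] *(3) 3 jK by fastforce
          then have "(x, u) \<in> ?T1" using E1 E2 u xu by blast
          then have "(x, j) \<in> ?T1" using tree_linear_less[OF t1 _ u(2)] *(3) 3 by blast
          then show ?thesis using N2 3 by blast
        next
          case 4
          then have "(x, z) \<in> ?T2" using * N1 tree_linear_less[OF t2] by blast
          then show ?thesis by (simp add: T'_def)
        qed
      qed
    qed
    obtain v where v: "snd y j = Some v" "v \<in> {0, 1}"
    proof -
      have d: "dom (snd y) = supp y" "ran (snd y) \<subseteq> {0, 1}" using PF_PC(1)[OF y(1)] by (simp_all
          add: PC_iff)
      then have "j \<in> dom (snd y)" using y(2) by simp
      then obtain v where v: "snd y j = Some v" by blast
      then have "v \<in> {0, 1}" using d(2) by (blast intro: ranI)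
      then show ?thesis using v that by blast
    qed
    obtain s where s: "s \<in> supp p" "(j, s) \<in> ?T1"
    proof -
      obtain s where "s \<in> Field T0" "m < s" "(j, s) \<in> ?T1"
        using cofinal_ext_above[OF m[OF y(1)], of j] y(2) by auto
      then show ?thesis using that cofinal_ext_Field[OF m[OF PF_refl[OF p]]] by blast
    qed
    let ?t = "(T', (snd q)(j \<mapsto> v))"
    have "(?t, q) \<in> PF"
    proof (rule PC_extendI[OF PF_PC(1)[OF q] t' FT' j _ _ v(2)])
      show "(x, z) \<in> T' \<longleftrightarrow> (x, z) \<in> ?T2" if "x \<in> supp q" "z \<in> supp q" for x z
        using N1[of x z] that j by blast
      show "\<exists>s\<in>supp q. (j, s) \<in> T'" using s sub by (auto simp: T'_def)
    qed
    moreover have "(?t, y) \<in> PF"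
      unfolding PF_iff
    proof (intro conjI ballI)
      show "?t \<in> PC" using PF_PC(1)[OF \<open>(?t, q) \<in> PF\<close>] .
      show "y \<in> PC" using PF_PC(1)[OF y(1)] .
      show "supp y \<subseteq> supp ?t" using y(2) FT' sub by auto
      show "(x, z) \<in> fst y \<longleftrightarrow> (x, z) \<in> fst ?t" if "x \<in> supp y" "z \<in> supp y" for x z
      proof (cases "z = j")
        case True then show ?thesis using N2 by simp
      next
        case False
        then have zp: "z \<in> supp p" using that y(2) by simp
        show ?thesis
        proof (cases "x = j")
          case True then show ?thesis using N4[OF zp] by simp
        next
          case False
          then have "x \<in> supp p" using that y(2) by simp
          then show ?thesis using E1 E2 zp N1[of x z] False \<open>z \<noteq> j\<close> by simp
        qed
      qed
      show "snd y x = snd ?t x" if "x \<in> supp y" for x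
        using that v y(2) PF_value[OF y(1), of x] PF_value[OF q, of x] by auto
    qed
    ultimately show ?thesis by blast
  qed
  then show ?thesis using jK by blast
qed

text \<open>Whether \<open>r\<close> is below \<open>p\<close> is a matter of the numbers up to \<open>N\<close>, once \<open>r\<close> is known to be below
  the part of \<open>p\<close> beyond \<open>N\<close>.\<close>

lemma front_determines:
  assumes f: "front n N" and m: "cofinal_ext m (fst q)" and mn: "m \<le> n"
    and pq: "(p, q) \<in> PF" and rw: "(r, cut (supp q \<union> {N<..}) p) \<in> PF"
    and agree: "cut {..N} r = cut {..N} p"
    and small: "\<And>x. x \<in> supp p \<Longrightarrow> x \<notin> supp q \<Longrightarrow> x \<le> N \<Longrightarrow> x \<le> n"
  shows "(r, p) \<in> PF"
proof -
  let ?w = "cut (supp q \<union> {N<..}) p"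
  have nN: "n \<le> N" using f by (simp add: front_def)
  have pw: "(p, ?w) \<in> PF" and wq: "(?w, q) \<in> PF" using cut_between[OF pq] by blast+
  note PCs = PF_PC[OF pq] PF_PC[OF rw]
  note t = PC_tree[OF PCs(1)] and tr = PC_tree[OF PCs(3)] and tw = PC_tree[OF PCs(4)]
  have sw: "supp ?w = supp p \<inter> (supp q \<union> {N<..})" by (rule supp_cut[OF PCs(1)])
  have low: "x \<in> supp r \<longleftrightarrow> x \<in> supp p" if "x \<le> N" for x
    using supp_cut[OF PCs(1), of "{..N}"] supp_cut[OF PCs(3), of "{..N}"] agree that by auto
  have lowo: "(x, y) \<in> fst r \<longleftrightarrow> (x, y) \<in> fst p" if "x \<le> N" "y \<le> N" for x y
    using arg_cong[OF agree, of "\<lambda>c. (x, y) \<in> fst c"] that by (simp add: cut_def)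
  have lowv: "snd r x = snd p x" if "x \<le> N" for x
    using arg_cong[OF agree, of "\<lambda>c. snd c x"] that by (simp add: cut_def)
  have mw: "cofinal_ext m (fst ?w)" by (rule PF_cofinal_ext[OF m wq])
  have sub: "supp p \<subseteq> supp r"
  proof
    fix x assume x: "x \<in> supp p"
    show "x \<in> supp r"
    proof (cases "x \<le> N")
      case True then show ?thesis using low x by simp
    next
      case False
      then have "x \<in> supp ?w" using x sw by simp
      then show ?thesis using PF_supp[OF rw] by blast
    qed
  qed
  \<comment> \<open>The front node \<open>u\<close> separates \<open>x \<le> n\<close> from
    \<open>e > N\<close>, so \<open>x\<close> is below \<open>e\<close> exactly if it is below
    \<open>u\<close>; the latter is decided by the agreement up to \<open>N\<close>.\<close>
  have mixed: "(x, e) \<in> fst p \<longleftrightarrow> (x, e) \<in> fst r"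
    if x: "x \<in> supp p" "x \<le> N" "x \<notin> supp q" and e: "e \<in> supp p" "N < e" for x e
  proof -
    have ew: "e \<in> supp ?w" using e sw by simp
    obtain u where u: "n < u" "u \<le> N" "(u, e) \<in> fst ?w"
      using cofinal_ext_front[OF mw f mn ew e(2)] by blast
    have xu: "x < u" using small[OF x(1,3,2)] u(1) by simp
    have up: "(u, e) \<in> fst p" "(u, e) \<in> fst r" using PF_order'[OF pw u(3)] PF_order'[OF rw u(3)] by auto
    have "(x, e) \<in> fst p \<longleftrightarrow> (x, u) \<in> fst p"
      using tree_linear_less[OF t _ up(1) xu] tree_trans[OF t _ up(1)] by blast
    moreover have "(x, e) \<in> fst r \<longleftrightarrow> (x, u) \<in> fst r"
      using tree_linear_less[OF tr _ up(2) xu] tree_trans[OF tr _ up(2)] by blast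
    ultimately show ?thesis using lowo[OF x(2) u(2)] by simp
  qed
  have ord: "(x, y) \<in> fst p \<longleftrightarrow> (x, y) \<in> fst r" if xy: "x \<in> supp p" "y \<in> supp p" for x y
  proof -
    have both: ?thesis if "x \<in> supp ?w" "y \<in> supp ?w"
      using PF_order[OF pw that] PF_order[OF rw that] by simp
    have big: "z \<in> supp ?w" if "z \<in> supp p" "N < z" for z unfolding sw using that by simp
    have inq: "z \<in> supp ?w" if "z \<in> supp p" "z \<in> supp q" for z unfolding sw using that by simp
    show ?thesis
    proof (cases "x \<le> N")
      case xN: True
      show ?thesis
      proof (cases "y \<le> N")
        case True then show ?thesis using lowo xN by simp
      next
        case False
        then have "y \<in> supp ?w" using big xy by simp
        then show ?thesis using both inq[OF xy(1)] mixed[OF xy(1) xN _ xy(2)] False by (meson not_le)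
      qed
    next
      case xN: False
      show ?thesis
      proof (cases "N < y")
        case True then show ?thesis using both big xy xN by simp
      next
        case False
        then have "(x, y) \<notin> fst p" "(x, y) \<notin> fst r" using tree_le[OF t, of x y] tree_le[OF tr, of
            x y] xN by auto
        then show ?thesis by simp
      qed
    qed
  qed
  have val: "snd p x = snd r x" if "x \<in> supp p" for x
  proof (cases "x \<le> N")
    case True then show ?thesis using lowv by simp
  next
    case False
    then have "x \<in> supp ?w" using that sw by simp
    then show ?thesis using PF_value[OF pw] PF_value[OF rw] by simp
  qed
  show ?thesis using PCs sub ord val by (simp add: PF_iff)
qed

end

section \<open>Names for pairs and natural numbers\<close>

locale forcing =
  fixes r :: "'p rel"
  assumes refl: "p \<in> Field r \<Longrightarrow> (p, p) \<in> r"
    and trans: "(p, q) \<in> r \<Longrightarrow> (q, s) \<in> r \<Longrightarrow> (p, s) \<in> r"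
begin

abbreviation "feq \<equiv> forces_eq r"
abbreviation "fmem \<equiv> forces_mem r"

lemma le_refl: "(p, q) \<in> r \<Longrightarrow> (p, p) \<in> r"
  by (rule refl) (rule FieldI1)

lemma dense_belowI: "(\<And>q. (q, p) \<in> r \<Longrightarrow> \<exists>d\<in>D. (d, q) \<in> r) \<Longrightarrow> dense_below r D p"
  by (auto simp: dense_below_def)

lemma dense_belowD: "dense_below r D p \<Longrightarrow> (q, p) \<in> r \<Longrightarrow> \<exists>d\<in>D. (d, q) \<in> r"
  by (auto simp: dense_below_def)

lemma dense_below_mono: "dense_below r D p \<Longrightarrow> (q, p) \<in> r \<Longrightarrow> dense_below r D q"
  using trans by (auto simp: dense_below_def)

lemma dense_below_subset:
  "dense_below r D p \<Longrightarrow> (\<And>q. (q, p) \<in> r \<Longrightarrow> q \<in> D \<Longrightarrow> q \<in> D') \<Longrightarrow> dense_below r D' p"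
  using trans unfolding dense_below_def by meson

lemma dense_below_dense: "dense_below r {q. dense_below r D q} p \<Longrightarrow> dense_below r D p"
proof (rule dense_belowI)
  fix q assume D: "dense_below r {q. dense_below r D q} p" and q: "(q, p) \<in> r"
  then obtain d where d: "dense_below r D d" "(d, q) \<in> r" using dense_belowD by blast
  then obtain d' where "d' \<in> D" "(d', d) \<in> r" using dense_belowD[OF d(1) le_refl[OF d(2)]] by blast
  then show "\<exists>d\<in>D. (d, q) \<in> r" using trans[OF _ d(2)] by blast
qed

lemma dense_below_bind:
  assumes "dense_below r D p" "\<And>q. (q, p) \<in> r \<Longrightarrow> q \<in> D \<Longrightarrow> dense_below r D' q"
  shows "dense_below r D' p"
  by (rule dense_below_dense) (rule dense_below_subset[OF assms(1)], use assms(2) in auto)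

lemma dense_belowI2: "(\<And>q. (q, p) \<in> r \<Longrightarrow> q \<in> D) \<Longrightarrow> dense_below r D p"
  using le_refl by (auto simp: dense_below_def)

text \<open>The definition of \<open>forces_eq\<close> puts the requirement of being below
  \<open>s\<close> as an implication inside a dense set. Density of that set below \<open>p\<close>
  amounts to density below each common extension of \<open>p\<close> and \<open>s\<close>, because a
  condition without extensions below \<open>s\<close> satisfies the implication vacuously.\<close>

lemma feq_iff1:
  "feq \<sigma> \<tau> p \<longleftrightarrow>
    (\<forall>(\<pi>, s)\<in>pairs \<sigma>. \<forall>q. (q, p) \<in> r \<and> (q, s) \<in> r \<longrightarrow> fmem \<pi> \<tau> q) \<and>
    (\<forall>(\<pi>, s)\<in>pairs \<tau>. \<forall>q. (q, p) \<in> r \<and> (q, s) \<in> r \<longrightarrow>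
      dense_below r {q. \<exists>x\<in>pairs \<sigma>. (q, snd x) \<in> r \<and> feq (fst x) \<pi> q} q)"
proof -
  have *: "dense_below r {q. (q, p) \<in> r \<and> ((q, s) \<in> r \<longrightarrow> P q)} p \<longleftrightarrow>
      (\<forall>q. (q, p) \<in> r \<and> (q, s) \<in> r \<longrightarrow> dense_below r {q. P q} q)" for P s
  proof
    assume L: "dense_below r {q. (q, p) \<in> r \<and> ((q, s) \<in> r \<longrightarrow> P q)} p"
    show "\<forall>q. (q, p) \<in> r \<and> (q, s) \<in> r \<longrightarrow> dense_below r {q. P q} q"
    proof (intro allI impI dense_belowI)
      fix q t assume q: "(q, p) \<in> r \<and> (q, s) \<in> r" and t: "(t, q) \<in> r"
      then have "(t, p) \<in> r" "(t, s) \<in> r" using trans[OF t] by blast+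
      then obtain d where "(d, t) \<in> r" "(d, s) \<in> r \<longrightarrow> P d" using dense_belowD[OF L] by blast
      then show "\<exists>d\<in>{q. P q}. (d, t) \<in> r" using trans[OF _ \<open>(t, s) \<in> r\<close>] by blast
    qed
  next
    assume R: "\<forall>q. (q, p) \<in> r \<and> (q, s) \<in> r \<longrightarrow> dense_below r {q. P q} q"
    show "dense_below r {q. (q, p) \<in> r \<and> ((q, s) \<in> r \<longrightarrow> P q)} p"
    proof (rule dense_belowI)
      fix q assume q: "(q, p) \<in> r"
      show "\<exists>d\<in>{q. (q, p) \<in> r \<and> ((q, s) \<in> r \<longrightarrow> P q)}. (d, q) \<in> r"
      proof (cases "\<exists>d. (d, q) \<in> r \<and> (d, s) \<in> r")
        case True
        then obtain d where d: "(d, q) \<in> r" "(d, s) \<in> r" by blast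
        then have "dense_below r {q. P q} d" using R trans[OF d(1) q] by blast
        then obtain d' where d': "P d'" "(d', d) \<in> r" using dense_belowD[OF _ le_refl[OF d(1)]] by blast
        have "(d', q) \<in> r" using trans[OF d'(2) d(1)] .
        then show ?thesis using d'(1) trans[OF _ q] by blast
      next
        case False
        then show ?thesis using q le_refl[OF q] by blast
      qed
    qed
  qed
  show ?thesis
    unfolding forces_eq.simps[of r \<sigma> \<tau> p] * forces_mem_def by (simp add: split_beta)
qed

lemma feq_memD1: "feq \<sigma> \<tau> p \<Longrightarrow> (\<pi>, s) \<in> pairs \<sigma> \<Longrightarrow> (q, p) \<in> r \<Longrightarrow> (q, s) \<in> r \<Longrightarrow> fmem \<pi> \<tau> q"
  unfolding feq_iff1[of \<sigma> \<tau> p] by blast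

lemma feq_memD2: "feq \<sigma> \<tau> p \<Longrightarrow> (\<pi>, s) \<in> pairs \<tau> \<Longrightarrow> (q, p) \<in> r \<Longrightarrow> (q, s) \<in> r \<Longrightarrow>
    dense_below r {q. \<exists>x\<in>pairs \<sigma>. (q, snd x) \<in> r \<and> feq (fst x) \<pi> q} q"
  unfolding feq_iff1[of \<sigma> \<tau> p] by blast

lemma feq_mono: "feq \<sigma> \<tau> p \<Longrightarrow> (q, p) \<in> r \<Longrightarrow> feq \<sigma> \<tau> q"
  unfolding feq_iff1[of \<sigma> \<tau>] using trans by blast

lemma fmem_mono: "fmem \<sigma> \<tau> p \<Longrightarrow> (q, p) \<in> r \<Longrightarrow> fmem \<sigma> \<tau> q"
  unfolding forces_mem_def by (rule dense_below_mono)

lemma fmem_dense: "dense_below r {q. fmem \<sigma> \<tau> q} p \<Longrightarrow> fmem \<sigma> \<tau> p"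
  unfolding forces_mem_def by (rule dense_below_dense)

lemma feq_dense:
  assumes "dense_below r {q. feq \<sigma> \<tau> q} p"
  shows "feq \<sigma> \<tau> p"
  unfolding feq_iff1[of \<sigma> \<tau> p]
proof (intro conjI ballI, safe)
  fix \<pi> s q assume *: "(\<pi>, s) \<in> pairs \<sigma>" "(q, p) \<in> r" "(q, s) \<in> r"
  show "fmem \<pi> \<tau> q"
  proof (rule fmem_dense, rule dense_below_subset[OF dense_below_mono[OF assms *(2)]])
    fix d assume d: "(d, q) \<in> r" "d \<in> {q. feq \<sigma> \<tau> q}"
    then show "d \<in> {q. fmem \<pi> \<tau> q}"
      using feq_memD1[OF _ *(1) le_refl[OF d(1)] trans[OF d(1) *(3)]] by simp
  qed
next
  fix \<pi> s q assume *: "(\<pi>, s) \<in> pairs \<tau>" "(q, p) \<in> r" "(q, s) \<in> r"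
  show "dense_below r {q. \<exists>x\<in>pairs \<sigma>. (q, snd x) \<in> r \<and> feq (fst x) \<pi> q} q"
  proof (rule dense_below_bind[OF dense_below_mono[OF assms *(2)]])
    fix d assume d: "(d, q) \<in> r" "d \<in> {q. feq \<sigma> \<tau> q}"
    then show "dense_below r {q. \<exists>x\<in>pairs \<sigma>. (q, snd x) \<in> r \<and> feq (fst x) \<pi> q} d"
      using feq_memD2[OF _ *(1) le_refl[OF d(1)] trans[OF d(1) *(3)]] by simp
  qed
qed

lemma fmemI: "(\<pi>, s) \<in> pairs \<tau> \<Longrightarrow> (q, s) \<in> r \<Longrightarrow> feq \<sigma> \<pi> q \<Longrightarrow> fmem \<sigma> \<tau> q"
  unfolding forces_mem_def
proof (rule dense_belowI2, rule CollectI)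
  fix d assume *: "(\<pi>, s) \<in> pairs \<tau>" "(q, s) \<in> r" "feq \<sigma> \<pi> q" and d: "(d, q) \<in> r"
  show "\<exists>x\<in>pairs \<tau>. (d, snd x) \<in> r \<and> feq \<sigma> (fst x) d"
    by (rule bexI[OF _ *(1)]) (simp add: trans[OF d *(2)] feq_mono[OF *(3) d])
qed

lemma fmemE:
  assumes "fmem \<sigma> \<tau> q" "(q', q) \<in> r"
  obtains \<pi> s d where "(\<pi>, s) \<in> pairs \<tau>" "(d, s) \<in> r" "(d, q') \<in> r" "feq \<sigma> \<pi> d"
  using dense_belowD[OF assms(1)[unfolded forces_mem_def] assms(2)] by force

lemma feq_refl: "feq \<sigma> \<sigma> p"
proof (induction \<sigma> arbitrary: p rule: wf_induct_rule[OF wf_subname])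
  case (1 \<sigma>)
  have IH: "feq \<pi> \<pi> q" if "(\<pi>, s) \<in> pairs \<sigma>" for \<pi> s q using 1 that by (auto simp: subname_def)
  show ?case
    unfolding feq_iff1[of \<sigma> \<sigma> p]
  proof (intro conjI ballI, safe)
    fix \<pi> s q assume *: "(\<pi>, s) \<in> pairs \<sigma>" "(q, s) \<in> r"
    show "fmem \<pi> \<sigma> q" by (rule fmemI[OF * IH[OF *(1)]])
  next
    fix \<pi> s q assume *: "(\<pi>, s) \<in> pairs \<sigma>" "(q, s) \<in> r"
    show "dense_below r {q. \<exists>x\<in>pairs \<sigma>. (q, snd x) \<in> r \<and> feq (fst x) \<pi> q} q"
    proof (rule dense_belowI2, rule CollectI, rule bexI[OF _ *(1)])
      fix d assume "(d, q) \<in> r"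
      then show "(d, snd (\<pi>, s)) \<in> r \<and> feq (fst (\<pi>, s)) \<pi> d"
        using trans[OF _ *(2)] IH[OF *(1)] by simp
    qed
  qed
qed

text \<open>Both halves of \<open>forces_eq\<close> recurse with the elements of
  \<open>\<sigma>\<close> in the first place, so symmetry is not visible in the definition and needs
  an induction. It yields the symmetric form \<open>feq_iff\<close>.\<close>

lemma feq_sym: "feq \<sigma> \<tau> p \<Longrightarrow> feq \<tau> \<sigma> p"
proof (induction \<sigma> arbitrary: \<tau> p rule: wf_induct_rule[OF wf_subname])
  case (1 \<sigma>)
  have IH: "feq \<pi> \<rho> q \<Longrightarrow> feq \<rho> \<pi> q" if "(\<pi>, s) \<in> pairs \<sigma>" for \<pi> s \<rho> q
    using "1.IH" that by (auto simp: subname_def)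
  show ?case
    unfolding feq_iff1[of \<tau> \<sigma> p]
  proof (intro conjI ballI, safe)
    fix \<pi> s q assume *: "(\<pi>, s) \<in> pairs \<tau>" "(q, p) \<in> r" "(q, s) \<in> r"
    show "fmem \<pi> \<sigma> q"
      unfolding forces_mem_def
      by (rule dense_below_subset[OF feq_memD2[OF "1.prems" *]]) (use IH in force)
  next
    fix \<pi> s q assume *: "(\<pi>, s) \<in> pairs \<sigma>" "(q, p) \<in> r" "(q, s) \<in> r"
    show "dense_below r {q. \<exists>x\<in>pairs \<tau>. (q, snd x) \<in> r \<and> feq (fst x) \<pi> q} q"
      by (rule dense_below_subset[OF feq_memD1[OF "1.prems" *, unfolded forces_mem_def]])
        (use IH[OF *(1)] in force)
  qed
qed

lemma feq_iff:
  "feq \<sigma> \<tau> p \<longleftrightarrow>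
    (\<forall>\<pi> s q. (\<pi>, s) \<in> pairs \<sigma> \<and> (q, p) \<in> r \<and> (q, s) \<in> r \<longrightarrow> fmem \<pi> \<tau> q) \<and>
    (\<forall>\<pi> s q. (\<pi>, s) \<in> pairs \<tau> \<and> (q, p) \<in> r \<and> (q, s) \<in> r \<longrightarrow> fmem \<pi> \<sigma> q)"
proof -
  have "{q. \<exists>x\<in>pairs \<sigma>. (q, snd x) \<in> r \<and> feq (fst x) \<pi> q} =
      {q. \<exists>x\<in>pairs \<sigma>. (q, snd x) \<in> r \<and> feq \<pi> (fst x) q}" for \<pi>
    using feq_sym by blast
  then show ?thesis unfolding feq_iff1[of \<sigma> \<tau> p] forces_mem_def[of r _ \<sigma>] by auto
qed

lemma feq_trans: "feq \<sigma> \<tau> p \<Longrightarrow> feq \<tau> \<rho> p \<Longrightarrow> feq \<sigma> \<rho> p"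
proof (induction \<sigma> arbitrary: \<tau> \<rho> p rule: wf_induct_rule[OF wf_subname])
  case (1 \<sigma>)
  have IH: "feq \<pi> \<pi>' q \<Longrightarrow> feq \<pi>' \<pi>'' q \<Longrightarrow> feq \<pi> \<pi>'' q" if "(\<pi>, s) \<in> pairs \<sigma>" for \<pi> s \<pi>' \<pi>'' q
    using "1.IH" that unfolding subname_def by blast
  show ?case
    unfolding feq_iff[of \<sigma> \<rho>]
  proof (intro conjI allI impI)
    fix \<pi> s q assume *: "(\<pi>, s) \<in> pairs \<sigma> \<and> (q, p) \<in> r \<and> (q, s) \<in> r"
    then have m: "fmem \<pi> \<tau> q" using feq_memD1[OF "1.prems"(1)] by blast
    show "fmem \<pi> \<rho> q"
    proof (unfold forces_mem_def, rule dense_belowI)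
      fix q' assume q': "(q', q) \<in> r"
      obtain \<pi>' s' d where d: "(\<pi>', s') \<in> pairs \<tau>" "(d, s') \<in> r" "(d, q') \<in> r" "feq \<pi> \<pi>' d"
        using fmemE[OF m q'] .
      have "(d, p) \<in> r" using d(3) q' * trans by blast
      then have "fmem \<pi>' \<rho> d" using feq_memD1[OF "1.prems"(2) d(1)] d(2) by blast
      then obtain \<pi>'' s'' d' where d': "(\<pi>'', s'') \<in> pairs \<rho>" "(d', s'') \<in> r" "(d', d) \<in> r" "feq
          \<pi>' \<pi>'' d'"
        using fmemE le_refl[OF d(3)] by meson
      then have "feq \<pi> \<pi>'' d'" using IH * feq_mono[OF d(4) d'(3)] by blast
      then show "\<exists>d\<in>{q. \<exists>x\<in>pairs \<rho>. (q, snd x) \<in> r \<and> feq \<pi> (fst x) q}. (d, q') \<in> r"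
        using d' trans[OF d'(3) d(3)] by force
    qed
  next
    fix \<pi> s q assume *: "(\<pi>, s) \<in> pairs \<rho> \<and> (q, p) \<in> r \<and> (q, s) \<in> r"
    then have m: "fmem \<pi> \<tau> q" using "1.prems"(2) unfolding feq_iff[of \<tau> \<rho>] by blast
    show "fmem \<pi> \<sigma> q"
    proof (unfold forces_mem_def, rule dense_belowI)
      fix q' assume q': "(q', q) \<in> r"
      obtain \<pi>' s' d where d: "(\<pi>', s') \<in> pairs \<tau>" "(d, s') \<in> r" "(d, q') \<in> r" "feq \<pi> \<pi>' d"
        using fmemE[OF m q'] .
      have "(d, p) \<in> r" using d(3) q' * trans by blast
      then have "fmem \<pi>' \<sigma> d" using "1.prems"(1) d(1,2) unfolding feq_iff[of \<sigma> \<tau>] by blast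
      then obtain \<pi>'' s'' d' where d': "(\<pi>'', s'') \<in> pairs \<sigma>" "(d', s'') \<in> r" "(d', d) \<in> r" "feq
          \<pi>' \<pi>'' d'"
        using fmemE le_refl[OF d(3)] by meson
      then have "feq \<pi>'' \<pi> d'" using IH[OF d'(1)] feq_sym feq_mono[OF d(4) d'(3)] by blast
      then show "\<exists>d\<in>{q. \<exists>x\<in>pairs \<sigma>. (q, snd x) \<in> r \<and> feq \<pi> (fst x) q}. (d, q') \<in> r"
        using d' trans[OF d'(3) d(3)] feq_sym by force
    qed
  qed
qed

lemma fmem_cong_left:
  assumes "fmem \<sigma> \<rho> p" "feq \<sigma> \<tau> p"
  shows "fmem \<tau> \<rho> p"
  unfolding forces_mem_def
proof (rule dense_below_subset[OF assms(1)[unfolded forces_mem_def]])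
  fix q assume q: "(q, p) \<in> r" "q \<in> {q. \<exists>x\<in>pairs \<rho>. (q, snd x) \<in> r \<and> feq \<sigma> (fst x) q}"
  then show "q \<in> {q. \<exists>x\<in>pairs \<rho>. (q, snd x) \<in> r \<and> feq \<tau> (fst x) q}"
    using feq_trans[OF feq_sym[OF feq_mono[OF assms(2) q(1)]]] by blast
qed

lemma fmem_cong_right:
  assumes "fmem \<pi> \<sigma> p" "feq \<sigma> \<tau> p"
  shows "fmem \<pi> \<tau> p"
proof (rule fmem_dense, rule dense_belowI)
  fix q assume q: "(q, p) \<in> r"
  obtain \<pi>' s d where d: "(\<pi>', s) \<in> pairs \<sigma>" "(d, s) \<in> r" "(d, q) \<in> r" "feq \<pi> \<pi>' d"
    using fmemE[OF assms(1) q] .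
  have "fmem \<pi>' \<tau> d" using feq_memD1[OF assms(2) d(1)] d q trans by blast
  then have "fmem \<pi> \<tau> d" using fmem_cong_left feq_sym d(4) by blast
  then show "\<exists>d\<in>{q. fmem \<pi> \<tau> q}. (d, q) \<in> r" using d(3) by blast
qed

lemma is_name_pairs: "is_name r \<tau> \<Longrightarrow> (\<pi>, s) \<in> pairs \<tau> \<Longrightarrow> s \<in> Field r \<and> is_name r \<pi>"
  by (erule is_name.cases) blast

text \<open>Extensionality relative to names satisfying \<open>is_name\<close>, since only these are
  in the range of the quantifier \<open>Forall\<close> of the forcing relation.\<close>

lemma feq_ext:
  assumes "is_name r \<sigma>" "is_name r \<tau>"
    and "\<And>\<pi> q. is_name r \<pi> \<Longrightarrow> (q, p) \<in> r \<Longrightarrow> fmem \<pi> \<sigma> q \<longleftrightarrow> fmem \<pi> \<tau> q"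
  shows "feq \<sigma> \<tau> p"
  unfolding feq_iff
  using assms is_name_pairs fmemI feq_refl by meson

section \<open>Monotonicity, density and the derived connectives\<close>

lemma forces_mono: "forces r \<phi> e p \<Longrightarrow> (q, p) \<in> r \<Longrightarrow> forces r \<phi> e q"
proof (induction \<phi> arbitrary: e p q)
  case (Neg \<phi>)
  then show ?case using trans[OF _ Neg.prems(2)] by simp
next
  case (Conj \<phi> \<psi>)
  then show ?case unfolding forces.simps by blast
next
  case (Forall x \<phi>)
  then show ?case unfolding forces.simps by blast
qed (simp_all add: fmem_mono feq_mono)

lemma forces_dense: "dense_below r {q. forces r \<phi> e q} p \<Longrightarrow> forces r \<phi> e p"
proof (induction \<phi> arbitrary: e p)
  case (Mem x y) then show ?case using fmem_dense by simp
next
  case (Eq x y) then show ?case using feq_dense by simp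
next
  case (Neg \<phi>)
  show ?case
    unfolding forces.simps
  proof (intro allI impI notI)
    fix q assume q: "(q, p) \<in> r" "forces r \<phi> e q"
    then obtain d where d: "forces r (Neg \<phi>) e d" "(d, q) \<in> r" using dense_belowD[OF Neg.prems] by blast
    then show False using forces_mono[OF q(2) d(2)] le_refl[OF d(2)] by auto
  qed
next
  case (Conj \<phi> \<psi>)
  have "dense_below r {q. forces r \<phi> e q} p" "dense_below r {q. forces r \<psi> e q} p"
    by (rule dense_below_subset[OF Conj.prems]; simp)+
  then show ?case using Conj.IH by simp
next
  case (Forall x \<phi>)
  have "dense_below r {q. forces r \<phi> (e(x := \<tau>)) q} p" if "is_name r \<tau>" for \<tau>
    by (rule dense_below_subset[OF Forall.prems]) (use that in simp)
  then show ?case using Forall.IH unfolding forces.simps by blast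
qed

lemma forces_Imp: "forces r (Imp \<phi> \<psi>) e p \<longleftrightarrow> (\<forall>q. (q, p) \<in> r \<longrightarrow> forces r \<phi> e q \<longrightarrow> forces r \<psi> e q)"
proof
  assume L: "forces r (Imp \<phi> \<psi>) e p"
  show "\<forall>q. (q, p) \<in> r \<longrightarrow> forces r \<phi> e q \<longrightarrow> forces r \<psi> e q"
  proof (intro allI impI)
    fix q assume q: "(q, p) \<in> r" "forces r \<phi> e q"
    show "forces r \<psi> e q"
    proof (rule forces_dense, rule dense_belowI)
      fix s assume s: "(s, q) \<in> r"
      have "(s, p) \<in> r" "forces r \<phi> e s" using trans[OF s q(1)] forces_mono[OF q(2) s] by auto
      then show "\<exists>d\<in>{q. forces r \<psi> e q}. (d, s) \<in> r" using L by (auto simp: Imp_def)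
    qed
  qed
next
  assume "\<forall>q. (q, p) \<in> r \<longrightarrow> forces r \<phi> e q \<longrightarrow> forces r \<psi> e q"
  then show "forces r (Imp \<phi> \<psi>) e p" using le_refl unfolding Imp_def forces.simps by blast
qed

lemma forces_Disj: "forces r (Disj \<phi> \<psi>) e p \<longleftrightarrow> dense_below r {q. forces r \<phi> e q \<or> forces r \<psi> e q} p"
  by (auto simp: Disj_def dense_below_def)

lemma forces_Exists:
  "forces r (Exists x \<phi>) e p \<longleftrightarrow> dense_below r {q. \<exists>\<tau>. is_name r \<tau> \<and> forces r \<phi> (e(x := \<tau>)) q} p"
  unfolding Exists_def forces.simps dense_below_def by blast

lemma forces_Iff: "forces r (Iff \<phi> \<psi>) e p \<longleftrightarrow>
    (\<forall>q. (q, p) \<in> r \<longrightarrow> (forces r \<phi> e q \<longleftrightarrow> forces r \<psi> e q))"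
  by (auto simp: Iff_def forces_Imp)

lemma forces_BAll: "x \<noteq> y \<Longrightarrow> forces r (BAll x y \<phi>) e p \<longleftrightarrow>
    (\<forall>\<tau> q. is_name r \<tau> \<longrightarrow> (q, p) \<in> r \<longrightarrow> fmem \<tau> (e y) q \<longrightarrow> forces r \<phi> (e(x := \<tau>)) q)"
  by (auto simp: BAll_def forces_Imp)

lemma forces_BEx: "x \<noteq> y \<Longrightarrow> forces r (BEx x y \<phi>) e p \<longleftrightarrow>
    dense_below r {q. \<exists>\<tau>. is_name r \<tau> \<and> fmem \<tau> (e y) q \<and> forces r \<phi> (e(x := \<tau>)) q} p"
  by (auto simp: BEx_def forces_Exists)

section \<open>Canonical names\<close>

lemma fmem_seq_name:
  "fmem \<tau> (seq_name a (\<lambda>n. if P n then Field r else {})) q \<longleftrightarrow>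
    dense_below r {d. \<exists>n. P n \<and> feq \<tau> (a n) d} q"
proof -
  have "(\<exists>x\<in>pairs (seq_name a (\<lambda>n. if P n then Field r else {})). (d, snd x) \<in> r \<and> feq \<tau> (fst x) d) \<longleftrightarrow>
      (\<exists>n. P n \<and> feq \<tau> (a n) d)" if "(d, q) \<in> r" for d
    using that refl[of d] by (auto simp: pairs_seq_name split: if_splits intro: FieldI1)
  then show ?thesis
    unfolding forces_mem_def by (auto elim!: dense_below_subset)
qed

lemma is_name_seq_name:
  "(\<And>n. P n \<Longrightarrow> is_name r (a n)) \<Longrightarrow> is_name r (seq_name a (\<lambda>n. if P n then Field r else {}))"
  by (rule is_name.intros) (auto simp: pairs_seq_name split: if_splits)

lemma is_name_upair: "is_name r \<sigma> \<Longrightarrow> is_name r \<tau> \<Longrightarrow> is_name r (upair_name r \<sigma> \<tau>)"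
  using is_name_seq_name[of "\<lambda>_. True" "\<lambda>n. if n = 0 then \<sigma> else \<tau>"] by (simp add: upair_name_def)

lemma is_name_opair: "is_name r \<sigma> \<Longrightarrow> is_name r \<tau> \<Longrightarrow> is_name r (opair_name r \<sigma> \<tau>)"
  by (simp add: opair_name_def is_name_upair)

lemma fmem_upair: "fmem \<pi> (upair_name r \<sigma> \<tau>) q \<longleftrightarrow> dense_below r {d. feq \<pi> \<sigma> d \<or> feq \<pi> \<tau> d} q"
proof -
  have "(\<exists>n::nat. feq \<pi> (if n = 0 then \<sigma> else \<tau>) d) \<longleftrightarrow> feq \<pi> \<sigma> d \<or> feq \<pi> \<tau> d" for d
    by (metis zero_neq_one)
  then show ?thesis
    using fmem_seq_name[of \<pi> "\<lambda>n. if n = 0 then \<sigma> else \<tau>" "\<lambda>_. True" q] by (simp add: upair_name_def)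
qed

lemma fmem_upair_left: "fmem \<sigma> (upair_name r \<sigma> \<tau>) q"
  unfolding fmem_upair by (rule dense_belowI2) (simp add: feq_refl)

lemma fmem_upair_right: "fmem \<tau> (upair_name r \<sigma> \<tau>) q"
  unfolding fmem_upair by (rule dense_belowI2) (simp add: feq_refl)

lemma upair_cong:
  assumes "is_name r \<sigma>" "is_name r \<tau>" "is_name r \<sigma>'" "is_name r \<tau>'"
    and eq: "feq \<sigma> \<sigma>' p" "feq \<tau> \<tau>' p"
  shows "feq (upair_name r \<sigma> \<tau>) (upair_name r \<sigma>' \<tau>') p"
proof (rule feq_ext)
  show "is_name r (upair_name r \<sigma> \<tau>)" "is_name r (upair_name r \<sigma>' \<tau>')" by (simp_all add: assms
      is_name_upair)
  fix \<pi> q assume q: "(q, p) \<in> r"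
  have "feq \<pi> \<sigma> d \<longleftrightarrow> feq \<pi> \<sigma>' d" "feq \<pi> \<tau> d \<longleftrightarrow> feq \<pi> \<tau>' d" if "(d, q) \<in> r" for d
    using feq_mono[OF eq(1)] feq_mono[OF eq(2)] trans[OF that q] feq_trans feq_sym by blast+
  then show "fmem \<pi> (upair_name r \<sigma> \<tau>) q \<longleftrightarrow> fmem \<pi> (upair_name r \<sigma>' \<tau>') q"
    unfolding fmem_upair by (auto elim!: dense_below_subset)
qed

lemma opair_cong:
  assumes "is_name r \<sigma>" "is_name r \<tau>" "is_name r \<sigma>'" "is_name r \<tau>'" "feq \<sigma> \<sigma>' p" "feq \<tau> \<tau>' p"
  shows "feq (opair_name r \<sigma> \<tau>) (opair_name r \<sigma>' \<tau>') p"
  unfolding opair_name_def using assms by (intro upair_cong is_name_upair)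

text \<open>The four memberships of the components give disjunctions that are decided only densely;
  four successive extensions decide all of them, and transitivity of equality leaves one of the two
  matchings.\<close>

lemma upair_inject:
  assumes "feq (upair_name r a b) (upair_name r a' b') p"
  shows "dense_below r {q. feq a a' q \<and> feq b b' q \<or> feq a b' q \<and> feq b a' q} p"
proof (rule dense_belowI)
  fix q assume q: "(q, p) \<in> r"
  note eq = feq_mono[OF assms q]
  note m = fmem_cong_right[OF fmem_upair_left eq, unfolded fmem_upair]
    fmem_cong_right[OF fmem_upair_right eq, unfolded fmem_upair]
    fmem_cong_right[OF fmem_upair_left feq_sym[OF eq], unfolded fmem_upair]
    fmem_cong_right[OF fmem_upair_right feq_sym[OF eq], unfolded fmem_upair]
  obtain d1 where d1: "(d1, q) \<in> r" "feq a a' d1 \<or> feq a b' d1" using dense_belowD[OF m(1)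
      le_refl[OF q]] by blast
  obtain d2 where d2: "(d2, d1) \<in> r" "feq b a' d2 \<or> feq b b' d2" using dense_belowD[OF m(2) d1(1)]
      by blast
  have d2q: "(d2, q) \<in> r" using trans d1 d2 by blast
  obtain d3 where d3: "(d3, d2) \<in> r" "feq a' a d3 \<or> feq a' b d3" using dense_belowD[OF m(3) d2q]
      by blast
  have d3q: "(d3, q) \<in> r" using trans d2q d3 by blast
  obtain d4 where d4: "(d4, d3) \<in> r" "feq b' a d4 \<or> feq b' b d4" using dense_belowD[OF m(4) d3q]
      by blast
  have le: "(d4, d1) \<in> r" "(d4, d2) \<in> r" "(d4, q) \<in> r" using trans d1(1) d2(1) d3(1) d4(1) by blast+
  have c: "feq a a' d4 \<or> feq a b' d4" "feq b a' d4 \<or> feq b b' d4" "feq a' a d4 \<or> feq a' b d4"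
    "feq b' a d4 \<or> feq b' b d4" using d1(2) d2(2) d3(2) d4(2) feq_mono le d4(1) by blast+
  have "feq a a' d4 \<and> feq b b' d4 \<or> feq a b' d4 \<and> feq b a' d4"
    using c(1)
  proof
    assume aa': "feq a a' d4"
    have "feq b b' d4" if ba': "feq b a' d4"
      using c(4) feq_sym feq_trans[OF feq_trans[OF ba' feq_sym[OF aa']]] by blast
    then show ?thesis using aa' c(2) by blast
  next
    assume ab': "feq a b' d4"
    have "feq a a' d4" if bb': "feq b b' d4"
      using c(3) feq_sym feq_trans[OF feq_trans[OF ab' feq_sym[OF bb']]] by blast
    then show ?thesis using ab' c(2) by blast
  qed
  then have "d4 \<in> {q. feq a a' q \<and> feq b b' q \<or> feq a b' q \<and> feq b a' q}" by (rule CollectI)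
  then show "\<exists>d\<in>{q. feq a a' q \<and> feq b b' q \<or> feq a b' q \<and> feq b a' q}. (d, q) \<in> r"
    using le(3) by (intro bexI[of _ d4])
qed

text \<open>In the crossed matching of the two Kuratowski sets all four components are equal, so
  both matchings give the same conclusion.\<close>

lemma opair_inject:
  assumes "feq (opair_name r a b) (opair_name r a' b') p"
  shows "feq a a' p \<and> feq b b' p"
proof -
  have eq: "feq (upair_name r (upair_name r a a) (upair_name r a b))
      (upair_name r (upair_name r a' a') (upair_name r a' b')) p"
    using assms unfolding opair_name_def .
  have "dense_below r {q. feq a a' q \<and> feq b b' q} p"
  proof (rule dense_below_bind[OF upair_inject[OF eq]])
    fix q
    let ?G = "{q. feq a a' q \<and> feq b b' q}"
    assume "q \<in> {q. feq (upair_name r a a) (upair_name r a' a') q \<and> feq (upair_name r a b)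
        (upair_name r a' b') q \<or>
      feq (upair_name r a a) (upair_name r a' b') q \<and> feq (upair_name r a b) (upair_name r a' a') q}"
    then have "feq (upair_name r a a) (upair_name r a' a') q \<and> feq (upair_name r a b) (upair_name
        r a' b') q \<or>
      feq (upair_name r a a) (upair_name r a' b') q \<and> feq (upair_name r a b) (upair_name r a' a')
          q" by (rule CollectD)
    then show "dense_below r ?G q"
    proof (elim disjE conjE)
      assume 1: "feq (upair_name r a a) (upair_name r a' a') q" "feq (upair_name r a b)
          (upair_name r a' b') q"
      show "dense_below r ?G q"
      proof (rule dense_below_bind[OF upair_inject[OF 1(1)]])
        fix s assume s: "(s, q) \<in> r" "s \<in> {q. feq a a' q \<and> feq a a' q \<or> feq a a' q \<and> feq a a' q}"
        show "dense_below r ?G s"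
        proof (rule dense_below_subset[OF dense_below_mono[OF upair_inject[OF 1(2)] s(1)]])
          fix d assume d: "(d, s) \<in> r" "d \<in> {q. feq a a' q \<and> feq b b' q \<or> feq a b' q \<and> feq b a' q}"
          have aa': "feq a a' d" using s(2) feq_mono[OF _ d(1)] by simp
          moreover have "feq b b' d" if "feq a b' d" "feq b a' d"
            using feq_trans[OF feq_trans[OF that(2) feq_sym[OF aa']] that(1)] .
          ultimately show "d \<in> ?G" using d(2) by auto
        qed
      qed
    next
      assume 2: "feq (upair_name r a a) (upair_name r a' b') q" "feq (upair_name r a b)
          (upair_name r a' a') q"
      show "dense_below r ?G q"
      proof (rule dense_below_bind[OF upair_inject[OF 2(1)]])
        fix s assume s: "(s, q) \<in> r" "s \<in> {q. feq a a' q \<and> feq a b' q \<or> feq a b' q \<and> feq a a' q}"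
        show "dense_below r ?G s"
        proof (rule dense_below_subset[OF dense_below_mono[OF upair_inject[OF 2(2)] s(1)]])
          fix d assume d: "(d, s) \<in> r" "d \<in> {q. feq a a' q \<and> feq b a' q \<or> feq a a' q \<and> feq b a' q}"
          have "feq a a' d" "feq a b' d" using s(2) feq_mono[OF _ d(1)] by auto
          moreover have "feq b a' d" using d(2) by simp
          ultimately show "d \<in> ?G" using feq_trans feq_sym by blast
        qed
      qed
    qed
  qed
  then have "dense_below r {q. feq a a' q} p" "dense_below r {q. feq b b' q} p"
    by (auto elim: dense_below_subset)
  then show ?thesis using feq_dense by blast
qed

lemma forces_UPair_fm:
  assumes "100 \<notin> {x, y, z}" "is_name r (e x)" "is_name r (e y)" "is_name r (e z)"
  shows "forces r (UPair_fm z x y) e p \<longleftrightarrow> feq (e z) (upair_name r (e x) (e y)) p"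
proof -
  have "forces r (UPair_fm z x y) e p \<longleftrightarrow> (\<forall>\<tau>. is_name r \<tau> \<longrightarrow> (\<forall>q. (q, p) \<in> r \<longrightarrow>
      (fmem \<tau> (e z) q \<longleftrightarrow> fmem \<tau> (upair_name r (e x) (e y)) q)))"
    using assms(1) by (auto simp: UPair_fm_def forces_Iff forces_Disj fmem_upair)
  also have "\<dots> \<longleftrightarrow> feq (e z) (upair_name r (e x) (e y)) p"
  proof
    assume "\<forall>\<tau>. is_name r \<tau> \<longrightarrow> (\<forall>q. (q, p) \<in> r \<longrightarrow>
      (fmem \<tau> (e z) q \<longleftrightarrow> fmem \<tau> (upair_name r (e x) (e y)) q))"
    then show "feq (e z) (upair_name r (e x) (e y)) p"
      using assms by (intro feq_ext is_name_upair) auto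
  next
    assume "feq (e z) (upair_name r (e x) (e y)) p"
    then show "\<forall>\<tau>. is_name r \<tau> \<longrightarrow> (\<forall>q. (q, p) \<in> r \<longrightarrow>
      (fmem \<tau> (e z) q \<longleftrightarrow> fmem \<tau> (upair_name r (e x) (e y)) q))"
      using fmem_cong_right feq_sym feq_mono by blast
  qed
  finally show ?thesis .
qed

lemma forces_OPair_fm:
  assumes "{x, y, z} \<inter> {100..102} = {}" "is_name r (e x)" "is_name r (e y)" "is_name r (e z)"
  shows "forces r (OPair_fm z x y) e p \<longleftrightarrow> feq (e z) (opair_name r (e x) (e y)) p"
proof -
  have ne: "x \<noteq> 100" "x \<noteq> 101" "x \<noteq> 102" "y \<noteq> 100" "y \<noteq> 101" "y \<noteq> 102" "z \<noteq> 100" "z \<noteq> 101" "z \<noteq> 102"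
    using assms(1) by auto
  let ?A = "upair_name r (e x) (e x)" and ?B = "upair_name r (e x) (e y)"
  have "forces r (OPair_fm z x y) e p \<longleftrightarrow> dense_below r {q. \<exists>\<sigma>. is_name r \<sigma> \<and> dense_below r {q. \<exists>\<tau>.
      is_name r \<tau> \<and>
      feq \<sigma> ?A q \<and> feq \<tau> ?B q \<and> feq (e z) (upair_name r \<sigma> \<tau>) q} q} p"
    unfolding OPair_fm_def forces_Exists using ne assms(2-)
    by (simp add: forces_UPair_fm cong: conj_cong)
  also have "\<dots> \<longleftrightarrow> feq (e z) (opair_name r (e x) (e y)) p"
  proof
    assume L: "dense_below r {q. \<exists>\<sigma>. is_name r \<sigma> \<and> dense_below r {q. \<exists>\<tau>. is_name r \<tau> \<and>
      feq \<sigma> ?A q \<and> feq \<tau> ?B q \<and> feq (e z) (upair_name r \<sigma> \<tau>) q} q} p"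
    have *: "feq (e z) (opair_name r (e x) (e y)) q"
      if "is_name r \<sigma>" "is_name r \<tau>" "feq \<sigma> ?A q" "feq \<tau> ?B q" "feq (e z) (upair_name r \<sigma> \<tau>) q"
          for \<sigma> \<tau> q
      unfolding opair_name_def using that assms(2-)
      by (meson feq_trans is_name_upair upair_cong)
    show "feq (e z) (opair_name r (e x) (e y)) p"
      by (rule feq_dense, rule dense_below_bind[OF L]) (auto intro: * elim!: dense_below_subset)
  next
    assume "feq (e z) (opair_name r (e x) (e y)) p"
    then have eq: "feq (e z) (upair_name r ?A ?B) p" by (simp add: opair_name_def)
    show "dense_below r {q. \<exists>\<sigma>. is_name r \<sigma> \<and> dense_below r {q. \<exists>\<tau>. is_name r \<tau> \<and>
      feq \<sigma> ?A q \<and> feq \<tau> ?B q \<and> feq (e z) (upair_name r \<sigma> \<tau>) q} q} p"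
    proof (rule dense_belowI2, rule CollectI, rule exI[of _ ?A], rule conjI)
      show "is_name r ?A" using assms(2,3) by (simp add: is_name_upair)
      fix q assume q: "(q, p) \<in> r"
      show "dense_below r {q. \<exists>\<tau>. is_name r \<tau> \<and> feq ?A ?A q \<and> feq \<tau> ?B q \<and>
        feq (e z) (upair_name r ?A \<tau>) q} q"
      proof (rule dense_belowI2, rule CollectI, rule exI[of _ ?B], intro conjI feq_refl)
        show "is_name r ?B" using assms(2,3) by (simp add: is_name_upair)
        show "feq (e z) (upair_name r ?A ?B) q'" if "(q', q) \<in> r" for q'
          by (rule feq_mono[OF eq trans[OF that q]])
      qed
    qed
  qed
  finally show ?thesis .
qed

lemma fmem_nat: "fmem \<tau> (nat_name r n) q \<longleftrightarrow> dense_below r {d. \<exists>m<n. feq \<tau> (nat_name r m) d} q"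
  unfolding nat_name.simps[of r n] fmem_seq_name by (rule arg_cong[of _ _ "\<lambda>D. dense_below r D q"]) auto

lemma fmem_omega: "fmem \<tau> (omega_name r) q \<longleftrightarrow> dense_below r {d. \<exists>m. feq \<tau> (nat_name r m) d} q"
  using fmem_seq_name[of \<tau> "nat_name r" "\<lambda>_. True" q] by (simp add: omega_name_def)

lemma is_name_nat: "is_name r (nat_name r n)"
proof (induction n rule: less_induct)
  case (less n)
  then show ?case unfolding nat_name.simps[of r n] by (intro is_name_seq_name) simp
qed

lemma is_name_omega: "is_name r (omega_name r)"
  using is_name_seq_name[of "\<lambda>_. True" "nat_name r"] by (simp add: omega_name_def is_name_nat)

lemma fmem_nat_less: "m < n \<Longrightarrow> fmem (nat_name r m) (nat_name r n) q"
  unfolding fmem_nat using feq_refl by (intro dense_belowI2) blast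

lemma fmem_nat_omega: "fmem (nat_name r m) (omega_name r) q"
  unfolding fmem_omega using feq_refl by (intro dense_belowI2) blast

text \<open>If equality were forced, \<open>k\<close> would be forced to be a member of itself; an
  extension then identifies \<open>k\<close> with some \<open>j < k\<close>, against the induction
  hypothesis.\<close>

lemma nat_name_less_neq:
  "p \<in> Field r \<Longrightarrow> k < n \<Longrightarrow> \<not> feq (nat_name r n :: ('i, 'p) name) (nat_name r k) p"
proof (induction k arbitrary: n p rule: less_induct)
  case (less k)
  show ?case
  proof
    assume eq: "feq (nat_name r n :: ('i, 'p) name) (nat_name r k) p"
    have "fmem (nat_name r k :: ('i, 'p) name) (nat_name r k) p"
      by (rule fmem_cong_right[OF fmem_nat_less[OF less.prems(2)] eq])
    then obtain d j where "(d, p) \<in> r" "j < k" "feq (nat_name r k :: ('i, 'p) name) (nat_name r j) d"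
      unfolding fmem_nat using dense_belowD refl[OF less.prems(1)] by blast
    then show False using less.IH[of j d k] by (auto intro: FieldI1)
  qed
qed

lemma nat_name_inject:
  "feq (nat_name r m :: ('i, 'p) name) (nat_name r n) p \<Longrightarrow> p \<in> Field r \<Longrightarrow> m = n"
  using nat_name_less_neq feq_sym by (metis linorder_neqE_nat)

end

section \<open>Fusion\<close>

definition covers :: "'p rel \<Rightarrow> 'p \<Rightarrow> 'p set" where
  "covers r p = {y. (y, p) \<in> r \<and> y \<noteq> p \<and> (\<forall>w. (y, w) \<in> r \<and> (w, p) \<in> r \<longrightarrow> w = y \<or> w = p)}"

text \<open>In the product, let \<open>Y\<close> consist of all extensions of \<open>p\<close> by
  the number \<open>j\<close> in coordinate \<open>i\<close>. That \<open>q\<close> is below none of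
  them means that \<open>j\<close> has not been added; that it is compatible with each means that
  every position of \<open>j\<close> is still available. This takes the place of a fusion order
  defined by fixing a finite part of the supports.\<close>

definition frozen :: "'p rel \<Rightarrow> 'p set \<Rightarrow> 'p \<Rightarrow> 'p \<Rightarrow> bool" where
  "frozen r Y q p \<longleftrightarrow> (q, p) \<in> r \<and> (\<forall>y\<in>Y. compatible r q y \<and> (q, y) \<notin> r)"

lemma frozen_mono: "frozen r Y q p \<Longrightarrow> Y' \<subseteq> Y \<Longrightarrow> frozen r Y' q p"
  by (auto simp: frozen_def)

text \<open>The fusion orders are given by freezing finite sets of covers. Covers and compatibility are
  first-order in the forcing notion, so they are available in every elementary submodel containing
  some isomorphic copy of it.\<close>

locale fusion = forcing r for r :: "'p rel" +
  fixes C :: "'j set \<Rightarrow> 'p \<Rightarrow> 'p set"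
  assumes C_finite: "finite J \<Longrightarrow> p \<in> Field r \<Longrightarrow> finite (C J p)"
    and C_covers: "p \<in> Field r \<Longrightarrow> C J p \<subseteq> covers r p"
    and covers_countable: "p \<in> Field r \<Longrightarrow> countable (covers r p)"
    and covers_infinite: "p \<in> Field r \<Longrightarrow> infinite (covers r p)"
    and frozen_trans: "frozen r (C J q) s q \<Longrightarrow> frozen r (C J p) q p \<Longrightarrow> frozen r (C J p) s p"
    and one_step: "p \<in> Field r \<Longrightarrow> finite J \<Longrightarrow> \<exists>M :: nat. \<forall>D. dense_in r D \<longrightarrow>
      (\<exists>q D'. frozen r (C J p) q p \<and> D' \<subseteq> D \<and> finite D' \<and> card D' \<le> M \<and>
        (\<forall>q'. (q', q) \<in> r \<longrightarrow> (\<exists>d\<in>D'. compatible r d q')))"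
    and limit: "X \<subseteq> Field r \<Longrightarrow>
      (\<And>(k :: nat) p J. p \<in> X \<Longrightarrow> finite J \<Longrightarrow> \<exists>q\<in>X \<inter> E k. frozen r (C J p) q p) \<Longrightarrow>
      p \<in> X \<Longrightarrow> finite J \<Longrightarrow> \<exists>q. frozen r (C J p) q p \<and> (\<forall>k. \<exists>s\<in>X \<inter> E k. (q, s) \<in> r)"

section \<open>Covers and fusion in the product\<close>

context tree_forcing
begin

abbreviation "QF \<equiv> Q_forcing F T0"

lemma QF_iff: "(p, q) \<in> QF \<longleftrightarrow> (\<forall>i. (p i, q i) \<in> PF)"
  by (simp add: Q_forcing_def)

lemma Field_QF: "p \<in> Field QF \<longleftrightarrow> (\<forall>i. p i \<in> PC)"
  by (simp add: Field_Q_forcing)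

lemma QF_refl: "p \<in> Field QF \<Longrightarrow> (p, p) \<in> QF"
  by (simp add: QF_iff Field_QF PF_refl)

lemma QF_trans: "(p, q) \<in> QF \<Longrightarrow> (q, s) \<in> QF \<Longrightarrow> (p, s) \<in> QF"
  unfolding QF_iff using PF_trans by blast

lemma QF_antisym: "(p, q) \<in> QF \<Longrightarrow> (q, p) \<in> QF \<Longrightarrow> p = q"
  unfolding QF_iff using PF_antisym by blast

lemma QF_upd: "(p, q) \<in> QF \<Longrightarrow> (a, q i) \<in> PF \<Longrightarrow> (p(i := a), q) \<in> QF"
  by (simp add: QF_iff)

lemma QF_upd2: "(p, q) \<in> QF \<Longrightarrow> (p i, a) \<in> PF \<Longrightarrow> (p, q(i := a)) \<in> QF"
  by (simp add: QF_iff)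

definition one_pt :: "(nat \<times> nat) set \<Rightarrow> (nat \<Rightarrow> condition) \<Rightarrow> (nat \<Rightarrow> condition) set" where
  "one_pt J p = {y. (y, p) \<in> QF \<and> (\<exists>(i, j)\<in>J. j \<notin> supp (p i) \<and>
     supp (y i) = insert j (supp (p i)) \<and> (\<forall>i'. i' \<noteq> i \<longrightarrow> y i' = p i'))}"

lemma one_ptE:
  assumes "y \<in> one_pt J p"
  obtains i j where "(i, j) \<in> J" "y \<in> one_pt {(i, j)} p"
  using assms by (auto simp: one_pt_def)

lemma one_pt1: "y \<in> one_pt {(i, j)} p \<longleftrightarrow> (y, p) \<in> QF \<and> j \<notin> supp (p i) \<and>
    supp (y i) = insert j (supp (p i)) \<and> (\<forall>i'. i' \<noteq> i \<longrightarrow> y i' = p i')"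
  by (simp add: one_pt_def)

lemma one_pt_mono: "J \<subseteq> J' \<Longrightarrow> one_pt J p \<subseteq> one_pt J' p"
  by (auto simp: one_pt_def)

lemma one_pt_interpolate:
  assumes qp: "(q, p) \<in> QF" and j: "j \<in> supp (q i)" "j \<notin> supp (p i)"
  shows "\<exists>w\<in>one_pt {(i, j)} p. (q, w) \<in> QF"
proof
  let ?c = "cut (insert j (supp (p i))) (q i)"
  have qpi: "(q i, p i) \<in> PF" using qp by (simp add: QF_iff)
  note c = cut_between[OF qpi, of "insert j (supp (p i))", OF subset_insertI]
  have s: "supp ?c = insert j (supp (p i))"
    using supp_cut[OF PF_PC(1)[OF qpi]] j(1) PF_supp[OF qpi] by auto
  have p: "p \<in> Field QF" using qp by (auto intro: FieldI2)
  show "(q, p(i := ?c)) \<in> QF" by (rule QF_upd2[OF qp c(1)])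
  show "p(i := ?c) \<in> one_pt {(i, j)} p"
    using s j(2) QF_upd[OF QF_refl[OF p] c(2)] by (simp add: one_pt1)
qed

lemma one_pt_covers: "one_pt J p \<subseteq> covers QF p"
proof
  fix y assume "y \<in> one_pt J p"
  then obtain i j where "y \<in> one_pt {(i, j)} p" by (rule one_ptE)
  then have y: "(y, p) \<in> QF" "j \<notin> supp (p i)" "supp (y i) = insert j (supp (p i))"
    "\<And>i'. i' \<noteq> i \<Longrightarrow> y i' = p i'" by (auto simp: one_pt1)
  have "w = y \<or> w = p" if w: "(y, w) \<in> QF" "(w, p) \<in> QF" for w
  proof -
    have wi: "(y i', w i') \<in> PF" "(w i', p i') \<in> PF" for i' using w by (simp_all add: QF_iff)
    have rest: "w i' = p i'" if "i' \<noteq> i" for i' using wi[of i'] y(4)[OF that] PF_antisym by simp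
    have "w i = y i \<or> w i = p i"
    proof (cases "j \<in> supp (w i)")
      case True
      then have "supp (y i) \<subseteq> supp (w i)" using y(3) PF_supp[OF wi(2)[of i]] by simp
      then show ?thesis using PF_eqI[OF wi(1)[of i]] by simp
    next
      case False
      then have "supp (w i) \<subseteq> supp (p i)"
        using PF_supp[OF wi(1)[of i]] unfolding y(3) by (simp add: subset_insert)
      then show ?thesis using PF_eqI[OF wi(2)[of i]] by simp
    qed
    then show ?thesis using rest y(4) by (metis ext)
  qed
  moreover have "y \<noteq> p" using y(2,3) by auto
  ultimately show "y \<in> covers QF p" using y(1) by (simp add: covers_def)
qed

text \<open>A cover adding more than one number would have a one-number extension of
  \<open>p\<close> strictly in between. So covers, a notion of the abstract order, are exactly the
  one-number extensions.\<close>

lemma covers_one_pt: "covers QF p \<subseteq> (\<Union>i j. one_pt {(i, j)} p)"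
proof
  fix y assume "y \<in> covers QF p"
  then have y: "(y, p) \<in> QF" "y \<noteq> p" "\<And>w. (y, w) \<in> QF \<Longrightarrow> (w, p) \<in> QF \<Longrightarrow> w = y \<or> w = p"
    by (auto simp: covers_def)
  then obtain i where "y i \<noteq> p i" by blast
  moreover have yi: "(y i, p i) \<in> PF" using y(1) by (simp add: QF_iff)
  ultimately obtain j where j: "j \<in> supp (y i)" "j \<notin> supp (p i)" using PF_eqI by blast
  obtain w where w: "w \<in> one_pt {(i, j)} p" "(y, w) \<in> QF" using one_pt_interpolate[OF y(1) j] by blast
  then have "w = y \<or> w = p" using y(3) by (simp add: one_pt1)
  moreover have "w \<noteq> p" using w(1) by (auto simp: one_pt1)
  ultimately show "y \<in> (\<Union>i j. one_pt {(i, j)} p)" using w(1) by blast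
qed

lemma finite_cuts: "finite {c :: condition. fst c \<subseteq> {..N} \<times> {..N} \<and> dom (snd c) \<subseteq> {..N} \<and> ran (snd
    c) \<subseteq> {0, 1}}"
proof -
  have "{f :: nat \<rightharpoonup> nat. dom f \<subseteq> {..N} \<and> ran f \<subseteq> {0, 1}} =
      (\<Union>A\<in>Pow {..N}. {f. dom f = A \<and> ran f \<subseteq> {0, 1}})" by auto
  moreover have "finite (\<Union>A\<in>Pow {..N}. {f :: nat \<rightharpoonup> nat. dom f = A \<and> ran f \<subseteq> {0, 1}})"
    by (intro finite_UN_I finite_set_of_finite_maps) (auto intro: finite_subset)
  ultimately have "finite {f :: nat \<rightharpoonup> nat. dom f \<subseteq> {..N} \<and> ran f \<subseteq> {0, 1}}" by simp
  then have "finite (Pow ({..N} \<times> {..N}) \<times> {f :: nat \<rightharpoonup> nat. dom f \<subseteq> {..N} \<and> ran f \<subseteq> {0, 1}})" by simp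
  then show ?thesis by (rule rev_finite_subset) (simp add: subset_iff mem_Times_iff)
qed

lemma cut_mem:
  assumes "p \<in> PC"
  shows "cut {..N} p \<in> {c. fst c \<subseteq> {..N} \<times> {..N} \<and> dom (snd c) \<subseteq> {..N} \<and> ran (snd c) \<subseteq> {0, 1}}"
proof -
  have "ran (snd p |` {..N}) \<subseteq> ran (snd p)" by (auto simp: ran_def restrict_map_def)
  then show ?thesis using assms by (auto simp: cut_def PC_iff)
qed

text \<open>A new number has a position relative to infinitely many nodes, but by
  \<open>front_determines\<close> the part up to a front beyond \<open>j\<close> fixes all of it,
  and there are only finitely many such parts.\<close>

lemma one_pt1_finite:
  assumes p: "p \<in> Field QF"
  shows "finite (one_pt {(i, j)} p)"
proof -
  have pi: "p i \<in> PC" using p by (simp add: Field_QF)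
  obtain m where m: "cofinal_ext m (fst (p i))" using pi by (auto simp: PC_iff)
  obtain N where N: "front (max m j) N" using front_exists by blast
  then have jN: "j \<le> N" by (simp add: front_def)
  let ?R = "{c :: condition. fst c \<subseteq> {..N} \<times> {..N} \<and> dom (snd c) \<subseteq> {..N} \<and> ran (snd c) \<subseteq> {0, 1}}"
  have "inj_on (\<lambda>y. cut {..N} (y i)) (one_pt {(i, j)} p)"
  proof (rule inj_onI)
    fix y z assume y: "y \<in> one_pt {(i, j)} p" and z: "z \<in> one_pt {(i, j)} p"
      and eq: "cut {..N} (y i) = cut {..N} (z i)"
    have yi: "(y i, p i) \<in> PF" and zi: "(z i, p i) \<in> PF" using y z by (simp_all add: one_pt1 QF_iff)
    have s: "supp (y i) = insert j (supp (p i))" "supp (z i) = insert j (supp (p i))"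
      using y z by (simp_all add: one_pt1)
    let ?w = "cut (supp (p i) \<union> {N<..}) (y i)"
    have "supp ?w = supp (p i)" using supp_cut[OF PF_PC(1)[OF yi]] s jN by auto
    moreover have "(?w, p i) \<in> PF" by (rule cut_between(2)[OF yi]) simp
    ultimately have "?w = p i" using PF_eqI by simp
    then have "(z i, y i) \<in> PF"
      using zi eq s by (intro front_determines[OF N m _ yi]) auto
    then have "z i = y i" using PF_eqI s by simp
    then show "y = z" using y z unfolding one_pt1 by (metis ext)
  qed
  moreover have "(\<lambda>y. cut {..N} (y i)) ` one_pt {(i, j)} p \<subseteq> ?R"
  proof
    fix c assume "c \<in> (\<lambda>y. cut {..N} (y i)) ` one_pt {(i, j)} p"
    then obtain y where "y \<in> one_pt {(i, j)} p" "c = cut {..N} (y i)" by blast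
    then have "(y i, p i) \<in> PF" "c = cut {..N} (y i)" by (simp_all add: one_pt1 QF_iff)
    then have "y i \<in> PC" "c = cut {..N} (y i)" using PF_PC(1) by blast+
    then show "c \<in> ?R" using cut_mem by simp
  qed
  ultimately show ?thesis using finite_cuts by (rule inj_on_finite)
qed

lemma one_pt_Union: "one_pt J p = (\<Union>(i, j)\<in>J. one_pt {(i, j)} p)"
  by (auto simp: one_pt_def)

lemma one_pt_finite: "finite J \<Longrightarrow> p \<in> Field QF \<Longrightarrow> finite (one_pt J p)"
  by (subst one_pt_Union) (auto intro: one_pt1_finite)

lemma covers_QF_countable: "p \<in> Field QF \<Longrightarrow> countable (covers QF p)"
  by (rule countable_subset[OF covers_one_pt]) (auto intro: countable_finite one_pt1_finite)

lemma covers_QF_infinite: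
  assumes p: "p \<in> Field QF"
  shows "infinite (covers QF p)"
proof -
  have "\<exists>a j. j \<notin> supp (p i) \<and> (a, p i) \<in> PF \<and> supp a = insert j (supp (p i))" for i
  proof -
    have pi: "p i \<in> PC" using p by (simp add: Field_QF)
    then have "supp (p i) \<in> I" by (auto simp: PC_iff cofinal_ext_def)
    then have "supp (p i) \<noteq> UNIV" using UNIV_notin_I by metis
    then obtain j where "j \<notin> supp (p i)" by blast
    then show ?thesis using insert_exists[OF pi] by blast
  qed
  then obtain a j where a: "\<And>i. j i \<notin> supp (p i)" "\<And>i. (a i, p i) \<in> PF"
    "\<And>i. supp (a i) = insert (j i) (supp (p i))" by metis
  have "p(i := a i) \<in> one_pt {(i, j i)} p" for i
    using a QF_upd[OF QF_refl[OF p] a(2)] by (simp add: one_pt1)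
  then have "range (\<lambda>i. p(i := a i)) \<subseteq> covers QF p" using one_pt_covers by blast
  moreover have "inj (\<lambda>i. p(i := a i))"
  proof (rule injI, rule ccontr)
    fix i i' assume eq: "p(i := a i) = p(i' := a i')" "i \<noteq> i'"
    then have "a i = p i" by (metis fun_upd_same fun_upd_other)
    then show False using a(1,3)[of i] by auto
  qed
  ultimately show ?thesis using range_inj_infinite infinite_super by blast
qed

lemma frozen_supp:
  assumes f: "frozen QF (one_pt J p) q p" and J: "(i, j) \<in> J" and j: "j \<in> supp (q i)"
  shows "j \<in> supp (p i)"
proof (rule ccontr)
  assume nj: "j \<notin> supp (p i)"
  have qp: "(q, p) \<in> QF" using f by (simp add: frozen_def)
  obtain w where w: "w \<in> one_pt {(i, j)} p" "(q, w) \<in> QF" using one_pt_interpolate[OF qp j nj] by blast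
  then have "w \<in> one_pt J p" using one_pt_mono[of "{(i, j)}" J] J by blast
  then show False using f w(2) by (auto simp: frozen_def)
qed

text \<open>Cutting a common extension of \<open>q\<close> and \<open>y\<close> to the support of
  \<open>q\<close> and the number \<open>j\<close> gives a cover of \<open>q\<close> that still
  refines \<open>y\<close>. This carries a frozen demand from \<open>p\<close> to a later stage and
  makes freezing transitive.\<close>

lemma one_pt_transfer:
  assumes y: "y \<in> one_pt {(i, j)} p" and qp: "(q, p) \<in> QF" and j: "j \<notin> supp (q i)"
    and c: "compatible QF q y"
  shows "\<exists>z\<in>one_pt {(i, j)} q. (z, y) \<in> QF"
proof -
  obtain t where t: "(t, q) \<in> QF" "(t, y) \<in> QF" using c by (auto simp: compatible_def)
  have si: "supp (y i) = insert j (supp (p i))" using y by (simp add: one_pt1)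
  have ti: "(t i, q i) \<in> PF" "(t i, y i) \<in> PF" "(q i, p i) \<in> PF" using t qp by (simp_all add: QF_iff)
  then have "j \<in> supp (t i)" using PF_supp[OF ti(2)] si by blast
  let ?c = "cut (insert j (supp (q i))) (t i)"
  have s: "supp ?c = insert j (supp (q i))"
    using supp_cut[OF PF_PC(1)[OF ti(1)]] \<open>j \<in> supp (t i)\<close> PF_supp[OF ti(1)] by auto
  have c1: "(?c, q i) \<in> PF" using cut_between(2)[OF ti(1)] by blast
  have "supp (y i) \<subseteq> insert j (supp (q i))" using si PF_supp[OF ti(3)] by blast
  then have c2: "(?c, y i) \<in> PF" by (rule cut_between(2)[OF ti(2)])
  have q: "q \<in> Field QF" using qp by (auto intro: FieldI1)
  have "q(i := ?c) \<in> one_pt {(i, j)} q"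
    using QF_upd[OF QF_refl[OF q] c1] s j by (simp add: one_pt1)
  moreover have "(q(i := ?c), y) \<in> QF"
    using c2 qp y by (auto simp: QF_iff one_pt1)
  ultimately show ?thesis by blast
qed

lemma frozen_one_pt_trans:
  assumes sq: "frozen QF (one_pt J q) s q" and qp: "frozen QF (one_pt J p) q p"
  shows "frozen QF (one_pt J p) s p"
  unfolding frozen_def
proof (intro conjI ballI)
  have le: "(s, q) \<in> QF" "(q, p) \<in> QF" using assms by (auto simp: frozen_def)
  then show "(s, p) \<in> QF" by (rule QF_trans)
  fix y assume yJ: "y \<in> one_pt J p"
  then obtain i j where J: "(i, j) \<in> J" and y: "y \<in> one_pt {(i, j)} p" by (rule one_ptE)
  have jp: "j \<notin> supp (p i)" and jy: "j \<in> supp (y i)" using y by (simp_all add: one_pt1)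
  have jq: "j \<notin> supp (q i)" using frozen_supp[OF qp J] jp by blast
  have js: "j \<notin> supp (s i)" using frozen_supp[OF sq J] jq by blast
  obtain z where z: "z \<in> one_pt {(i, j)} q" "(z, y) \<in> QF"
    using one_pt_transfer[OF y le(2) jq] qp yJ by (auto simp: frozen_def)
  have "z \<in> one_pt J q" using z(1) one_pt_mono[of "{(i, j)}" J] J by blast
  then have "compatible QF s z" using sq by (auto simp: frozen_def)
  then show "compatible QF s y" using z(2) QF_trans by (auto simp: compatible_def)
  show "(s, y) \<notin> QF" using js jy PF_supp[of "s i" "y i"] by (auto simp: QF_iff)
qed

text \<open>The bound \<open>K\<close> depends on \<open>p0\<close>, \<open>i\<close> and
  \<open>j\<close> only. In a fusion it can be fixed at the start and then applied with a late stage
  in place of \<open>p\<close>.\<close>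

lemma QF_amalgamation:
  assumes p0: "p0 \<in> Field QF"
  shows "\<exists>K. \<forall>p y q. (p, p0) \<in> QF \<and> y \<in> one_pt {(i, j)} p \<and> (q, p) \<in> QF \<and> j \<notin> supp (q i) \<and>
    (\<forall>e\<in>supp (q i) - supp (p i). K < e) \<longrightarrow> compatible QF q y"
proof -
  have "p0 i \<in> PC" using p0 by (simp add: Field_QF)
  then obtain K where K: "\<And>p y q. (p, p0 i) \<in> PF \<Longrightarrow> (y, p) \<in> PF \<Longrightarrow> supp y = insert j (supp p) \<Longrightarrow>
      (q, p) \<in> PF \<Longrightarrow> j \<notin> supp q \<Longrightarrow> (\<forall>e\<in>supp q - supp p. K < e) \<Longrightarrow>
      \<exists>t. (t, y) \<in> PF \<and> (t, q) \<in> PF"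
    using amalgamation[of "p0 i" j] by metis
  have "compatible QF q y" if h: "(p, p0) \<in> QF" "y \<in> one_pt {(i, j)} p" "(q, p) \<in> QF" "j \<notin> supp (q i)"
    "\<forall>e\<in>supp (q i) - supp (p i). K < e" for p y q
  proof -
    have le: "(p i, p0 i) \<in> PF" "(y i, p i) \<in> PF" "supp (y i) = insert j (supp (p i))" "(q i, p i) \<in> PF"
      using that by (simp_all add: QF_iff one_pt1)
    obtain t where t: "(t, y i) \<in> PF" "(t, q i) \<in> PF" using K[OF le h(4,5)] by blast
    have q: "q \<in> Field QF" using that(3) by (auto intro: FieldI1)
    have "(q(i := t), q) \<in> QF" using QF_upd[OF QF_refl[OF q] t(2)] .
    moreover have "(q(i := t), y) \<in> QF" using t that(2,3) by (auto simp: QF_iff one_pt1)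
    ultimately show ?thesis by (auto simp: compatible_def)
  qed
  then show ?thesis by blast
qed

text \<open>Conditions of \<open>D\<close> are sorted by their traces up to \<open>N\<close> in the
  first coordinates. One representative for each trace suffices, once everything it does beyond
  \<open>N\<close> and in the other coordinates has been built into \<open>q\<close>: a later
  condition with the same trace is then below it by \<open>front_determines\<close>. The number of
  traces bounds \<open>D'\<close> for all \<open>D\<close> at once.\<close>

lemma QF_one_step:
  assumes p: "p \<in> Field QF" and J: "finite J"
  shows "\<exists>M :: nat. \<forall>D. dense_in QF D \<longrightarrow>
    (\<exists>q D'. frozen QF (one_pt J p) q p \<and> D' \<subseteq> D \<and> finite D' \<and> card D' \<le> M \<and>
      (\<forall>q'. (q', q) \<in> QF \<longrightarrow> (\<exists>d\<in>D'. compatible QF d q')))"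
proof -
  obtain k where k: "\<And>i j. (i, j) \<in> J \<Longrightarrow> i \<le> k"
  proof -
    have "finite (fst ` J)" using J by simp
    then obtain k where "\<forall>i\<in>fst ` J. i \<le> k" using finite_nat_set_iff_bounded_le by blast
    then show ?thesis using that by force
  qed
  obtain m where m: "\<And>i q. (q, p i) \<in> PF \<Longrightarrow> cofinal_ext (m i) (fst q)"
  proof -
    have "\<forall>i. \<exists>m. \<forall>q. (q, p i) \<in> PF \<longrightarrow> cofinal_ext m (fst q)"
      using PC_cofinal_ext p by (simp add: Field_QF)
    then show ?thesis using that by metis
  qed
  obtain K where K: "\<And>i j y q. y \<in> one_pt {(i, j)} p \<Longrightarrow> (q, p) \<in> QF \<Longrightarrow> j \<notin> supp (q i) \<Longrightarrow>
      (\<forall>e\<in>supp (q i) - supp (p i). K (i, j) < e) \<Longrightarrow> compatible QF q y"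
  proof -
    have "\<exists>K. \<forall>y q. y \<in> one_pt {(fst x, snd x)} p \<longrightarrow> (q, p) \<in> QF \<longrightarrow> snd x \<notin> supp (q (fst x)) \<longrightarrow>
      (\<forall>e\<in>supp (q (fst x)) - supp (p (fst x)). K < e) \<longrightarrow> compatible QF q y" for x
      using QF_amalgamation[OF p, of "fst x" "snd x"] QF_refl[OF p] by blast
    then obtain K where "\<And>x y q. y \<in> one_pt {(fst x, snd x)} p \<Longrightarrow> (q, p) \<in> QF \<Longrightarrow> snd x \<notin> supp (q
        (fst x)) \<Longrightarrow>
      (\<forall>e\<in>supp (q (fst x)) - supp (p (fst x)). K x < e) \<Longrightarrow> compatible QF q y" by metis
    then show ?thesis using that[of K] by (metis fst_conv snd_conv)
  qed
  \<comment> \<open>The sums serve as a common upper bound of the numbers \<open>m i\<close>, the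
    amalgamation bounds and the numbers to be frozen.\<close>
  define n where "n = (\<Sum>i\<le>k. m i) + (\<Sum>x\<in>J. K x) + (\<Sum>x\<in>J. snd x)"
  have mn: "m i \<le> n" if "i \<le> k" for i
    using member_le_sum[of i "{..k}" m] that by (simp add: n_def)
  have Kn: "K x \<le> n" "snd x \<le> n" if "x \<in> J" for x
    using member_le_sum[of x J K] member_le_sum[of x J snd] that J by (simp_all add: n_def)
  obtain N where N: "front n N" using front_exists by blast
  then have nN: "n \<le> N" by (simp add: front_def)
  \<comment> \<open>All numbers after \<open>n\<close> up to \<open>N\<close> are added beforehand
    in the first coordinates, so that a number up to \<open>N\<close> missing from a later support
    there is at most \<open>n\<close>, as \<open>front_determines\<close> demands.\<close>
  have "\<exists>y. (y, p i) \<in> PF \<and> supp y = supp (p i) \<union> {n<..N}" for i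
    using fill_exists[of "{n<..N}"] p by (simp add: Field_QF)
  then obtain a where a: "\<And>i. (a i, p i) \<in> PF" "\<And>i. supp (a i) = supp (p i) \<union> {n<..N}" by metis
  define p' where "p' i = (if i \<le> k then a i else p i)" for i
  have p'p: "(p', p) \<in> QF" using a p by (auto simp: QF_iff p'_def PF_refl Field_QF)
  define code where "code s = (\<lambda>i\<in>{..k}. cut {..N} (s i))" for s :: "nat \<Rightarrow> condition"
  define Ps where "Ps = code ` Field QF"
  have fin: "finite Ps"
  proof -
    let ?R = "{c :: condition. fst c \<subseteq> {..N} \<times> {..N} \<and> dom (snd c) \<subseteq> {..N} \<and> ran (snd c) \<subseteq> {0, 1}}"
    have "Ps \<subseteq> (\<Pi>\<^sub>E i\<in>{..k}. ?R)"
    proof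
      fix c assume "c \<in> Ps"
      then obtain s where s: "c = code s" "s \<in> Field QF" by (auto simp: Ps_def)
      then have "cut {..N} (s i) \<in> ?R" for i using cut_mem by (simp add: Field_QF)
      then show "c \<in> (\<Pi>\<^sub>E i\<in>{..k}. ?R)" unfolding s(1) code_def by (intro restrict_PiE_iff[THEN
          iffD2] ballI)
    qed
    then show ?thesis by (rule finite_subset) (intro finite_PiE finite_cuts; simp)
  qed
  have "\<exists>q D'. frozen QF (one_pt J p) q p \<and> D' \<subseteq> D \<and> finite D' \<and> card D' \<le> card Ps \<and>
      (\<forall>q'. (q', q) \<in> QF \<longrightarrow> (\<exists>d\<in>D'. compatible QF d q'))" if D: "dense_in QF D" for D
  proof -
    have DF: "D \<subseteq> Field QF" using D by (simp add: dense_in_def)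
    \<comment> \<open>Induction over the traces: a trace realised in \<open>D\<close> below the
      current condition contributes a representative \<open>s0\<close>; a trace that is not realised
      contributes nothing and stays unrealised below all later conditions.\<close>
    have "\<exists>q D'. (q, p') \<in> QF \<and> (\<forall>i\<le>k. \<forall>e\<in>supp (q i) - supp (p' i). N < e) \<and>
        D' \<subseteq> D \<and> finite D' \<and> card D' \<le> card A \<and>
        (\<forall>s\<in>D. (s, q) \<in> QF \<longrightarrow> code s \<in> A \<longrightarrow> (\<exists>d\<in>D'. (s, d) \<in> QF))" if "finite A" for A
      using that
    proof induction
      case empty
      have "p' \<in> Field QF" using p'p by (auto intro: FieldI1)
      then show ?case using QF_refl by (intro exI[of _ p'] exI[of _ "{}"]) auto
    next
      case (insert c A)
      then obtain q D' where q: "(q, p') \<in> QF" "\<And>i e. i \<le> k \<Longrightarrow> e \<in> supp (q i) \<Longrightarrow> e \<notin> supp (p' i) \<Longrightarrow> N < e"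
        "D' \<subseteq> D" "finite D'" "card D' \<le> card A"
        "\<And>s. s \<in> D \<Longrightarrow> (s, q) \<in> QF \<Longrightarrow> code s \<in> A \<Longrightarrow> \<exists>d\<in>D'. (s, d) \<in> QF" by blast
      show ?case
      proof (cases "\<exists>s0\<in>D. (s0, q) \<in> QF \<and> code s0 = c")
        case False
        then show ?thesis using q insert by (intro exI[of _ q] exI[of _ D']) auto
      next
        case True
        then obtain s0 where s0: "s0 \<in> D" "(s0, q) \<in> QF" "code s0 = c" by blast
        have s0i: "(s0 i, q i) \<in> PF" for i using s0(2) by (simp add: QF_iff)
        \<comment> \<open>In the first coordinates nothing new is taken from \<open>s0\<close> up to
          \<open>N\<close>, as this part is to stay undecided; beyond \<open>N\<close> and in the
          other coordinates all of \<open>s0\<close> is taken over.\<close>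
        define w where "w i = (if i \<le> k then cut (supp (q i) \<union> {N<..}) (s0 i) else s0 i)" for i
        have wq: "(w, q) \<in> QF" using cut_between(2)[OF s0i] s0i by (auto simp: QF_iff w_def)
        have neww: "N < e" if "i \<le> k" "e \<in> supp (w i)" "e \<notin> supp (p' i)" for i e
          using that q(2)[OF that(1), of e] supp_cut[OF PF_PC(1)[OF s0i[of i]]] by (auto simp: w_def)
        have key: "(s, s0) \<in> QF" if s: "(s, w) \<in> QF" "code s = c" for s
          unfolding QF_iff
        proof
          fix i
          show "(s i, s0 i) \<in> PF"
          proof (cases "i \<le> k")
            case False
            have "(s i, w i) \<in> PF" using s(1) by (simp add: QF_iff)
            then show ?thesis using False by (simp add: w_def)
          next
            case True
            have qp: "(q i, p i) \<in> PF" using QF_trans[OF q(1) p'p] by (simp add: QF_iff)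
            show ?thesis
            proof (rule front_determines[OF N m[OF qp] mn[OF True] s0i])
              have "(s i, w i) \<in> PF" using s(1) by (simp add: QF_iff)
              then show "(s i, cut (supp (q i) \<union> {N<..}) (s0 i)) \<in> PF"
                using True by (simp add: w_def)
              have "code s i = code s0 i" using s(2) s0(3) by simp
              then show "cut {..N} (s i) = cut {..N} (s0 i)" using True by (simp add: code_def)
              fix x assume x: "x \<notin> supp (q i)" "x \<le> N"
              have "(q i, p' i) \<in> PF" using q(1) by (simp add: QF_iff)
              then have "supp (a i) \<subseteq> supp (q i)" using PF_supp True by (simp add: p'_def)
              then show "x \<le> n" using x a(2)[of i] by (auto simp: not_le)
            qed
          qed
        qed
        have "\<exists>d\<in>insert s0 D'. (s, d) \<in> QF" if "s \<in> D" "(s, w) \<in> QF" "code s \<in> insert c A" for s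
          using that key q(6)[OF that(1) QF_trans[OF that(2) wq]] by blast
        moreover have "card (insert s0 D') \<le> card (insert c A)"
          using q(4,5) insert(1,2) by (simp add: card_insert_if)
        ultimately show ?thesis
          using s0(1) q(3,4) neww QF_trans[OF wq q(1)]
          by (intro exI[of _ w] exI[of _ "insert s0 D'"]) auto
      qed
    qed
    from this[OF fin] obtain q D' where q: "(q, p') \<in> QF"
      "\<And>i e. i \<le> k \<Longrightarrow> e \<in> supp (q i) \<Longrightarrow> e \<notin> supp (p' i) \<Longrightarrow> N < e"
      "D' \<subseteq> D" "finite D'" "card D' \<le> card Ps"
      "\<And>s. s \<in> D \<Longrightarrow> (s, q) \<in> QF \<Longrightarrow> code s \<in> Ps \<Longrightarrow> \<exists>d\<in>D'. (s, d) \<in> QF" by blast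
    have qp: "(q, p) \<in> QF" using QF_trans[OF q(1) p'p] .
    \<comment> \<open>A new number was either filled in between \<open>n\<close> and
      \<open>N\<close> or lies beyond \<open>N\<close>; in both cases it exceeds the amalgamation
      bounds, which keeps the covers compatible.\<close>
    have new: "n < e" if "i \<le> k" "e \<in> supp (q i)" "e \<notin> supp (p i)" for i e
      using that q(2)[of i e] a(2)[of i] nN by (cases "e \<in> supp (p' i)") (auto simp: p'_def)
    have "frozen QF (one_pt J p) q p"
      unfolding frozen_def
    proof (intro conjI ballI qp)
      fix y assume "y \<in> one_pt J p"
      then obtain i j where ij: "(i, j) \<in> J" and y: "y \<in> one_pt {(i, j)} p" by (rule one_ptE)
      have jp: "j \<notin> supp (p i)" and jy: "j \<in> supp (y i)" using y by (simp_all add: one_pt1)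
      have jq: "j \<notin> supp (q i)" using new[OF k[OF ij], of j] jp Kn(2)[OF ij] by auto
      show "compatible QF q y"
        using K[OF y qp jq] new[OF k[OF ij]] Kn(1)[OF ij] by (meson DiffD1 DiffD2 le_less_trans)
      show "(q, y) \<notin> QF" using jq jy PF_supp[of "q i" "y i"] by (auto simp: QF_iff)
    qed
    moreover have "\<exists>d\<in>D'. compatible QF d q'" if q': "(q', q) \<in> QF" for q'
    proof -
      have "q' \<in> Field QF" using q' by (auto intro: FieldI1)
      then obtain s where s: "s \<in> D" "(s, q') \<in> QF" using D by (auto simp: dense_in_def)
      then have "code s \<in> Ps" using DF by (auto simp: Ps_def)
      then obtain d where "d \<in> D'" "(s, d) \<in> QF" using q(6) s QF_trans[OF s(2) q'] by blast
      then show ?thesis using s(2) by (auto simp: compatible_def)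
    qed
    ultimately show ?thesis using q(3-5) by blast
  qed
  then show ?thesis by blast
qed

text \<open>The bound \<open>m\<close> of \<open>P 0\<close> serves the whole chain, so the union
  inherits cofinality from its members. Membership of the support in the ideal is the only
  requirement that may fail in the limit.\<close>

lemma PC_chain_Union:
  fixes P :: "nat \<Rightarrow> condition"
  assumes mono: "\<And>j k. j \<le> k \<Longrightarrow> (P k, P j) \<in> PF" and I: "(\<Union>j. supp (P j)) \<in> I"
  obtains q where "\<And>j. (q, P j) \<in> PF" "supp q = (\<Union>j. supp (P j))"
proof
  have PC: "P j \<in> PC" for j using PF_PC(1)[OF mono[of j j]] by simp
  let ?T = "\<Union>j. fst (P j)"
  define f where "f e = (if \<exists>j. e \<in> supp (P j) then snd (P (LEAST j. e \<in> supp (P j))) e else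
      None)" for e
  have fT: "Field ?T = (\<Union>j. supp (P j))" by (auto simp: Field_def)
  have up: "(x, y) \<in> fst (P k)" if "(x, y) \<in> fst (P j)" "j \<le> k" for x y j k
    using PF_order'[OF mono[OF that(2)] that(1)] .
  have up2: "\<exists>k. (x, y) \<in> fst (P k) \<and> (x', y') \<in> fst (P k)"
    if "(x, y) \<in> ?T" "(x', y') \<in> ?T" for x y x' y'
  proof -
    obtain j k where "(x, y) \<in> fst (P j)" "(x', y') \<in> fst (P k)" using \<open>(x, y) \<in> ?T\<close> \<open>(x', y') \<in>
        ?T\<close> by blast
    then show ?thesis using up[of x y j "max j k"] up[of x' y' k "max j k"] by (intro exI[of _
        "max j k"]) simp
  qed
  have f: "f e = snd (P j) e" if e: "e \<in> supp (P j)" for e j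
  proof -
    let ?l = "LEAST j. e \<in> supp (P j)"
    have "e \<in> supp (P ?l)" "?l \<le> j" using e by (auto intro: LeastI Least_le)
    then have "snd (P ?l) e = snd (P j) e" using PF_value[OF mono] by blast
    then show ?thesis using e by (auto simp: f_def)
  qed
  have ord: "(x, y) \<in> fst (P j) \<longleftrightarrow> (x, y) \<in> ?T" if xy: "x \<in> supp (P j)" "y \<in> supp (P j)" for x y j
  proof
    assume "(x, y) \<in> ?T"
    then obtain k where "(x, y) \<in> fst (P k)" by blast
    then have "(x, y) \<in> fst (P (max j k))" using up[of x y k "max j k"] by simp
    then show "(x, y) \<in> fst (P j)" using PF_order[OF mono[of j "max j k"] xy] by simp
  qed auto
  obtain m where m: "\<And>q. (q, P 0) \<in> PF \<Longrightarrow> cofinal_ext m (fst q)" using PC_cofinal_ext[OF PC] by blast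
  have mP: "cofinal_ext m (fst (P j))" for j by (rule m[OF mono]) simp
  have t: "is_tree ?T"
  proof (rule is_treeI)
    show "(x, x) \<in> ?T" if "x \<in> Field ?T" for x
      using that tree_refl[OF PC_tree[OF PC]] unfolding fT by blast
    show "x \<le> y" if "(x, y) \<in> ?T" for x y using that tree_le[OF PC_tree[OF PC]] by blast
    show "(x, z) \<in> ?T" if "(x, y) \<in> ?T" "(y, z) \<in> ?T" for x y z
      using up2[OF that] tree_trans[OF PC_tree[OF PC]] by blast
    show "(x, y) \<in> ?T" if "(x, z) \<in> ?T" "(y, z) \<in> ?T" "x < y" for x y z
      using up2[OF that(1,2)] tree_linear_less[OF PC_tree[OF PC] _ _ that(3)] by blast
  qed
  have "cofinal_ext m ?T"
  proof (rule cofinal_extI[OF t])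
    show "Field ?T \<in> I" using I fT by simp
    show "(x, y) \<in> ?T \<longleftrightarrow> (x, y) \<in> T0"
      if "x \<in> Field T0" "y \<in> Field T0" "m < x" "m < y" for x y
      using ord[of x 0 y] cofinal_ext_Field[OF mP[of 0]] cofinal_ext_T0[OF mP[of 0] that] that by blast
    show "\<exists>s\<in>Field T0. m < s \<and> (x, s) \<in> ?T" if "x \<in> Field ?T" for x
      using that cofinal_ext_above[OF mP] unfolding fT by blast
  qed
  moreover have "dom f = Field ?T"
    unfolding fT
  proof (intro equalityI subsetI)
    fix e assume "e \<in> dom f"
    then show "e \<in> (\<Union>j. supp (P j))" by (auto simp: f_def split: if_splits)
  next
    fix e assume "e \<in> (\<Union>j. supp (P j))"
    then obtain j where j: "e \<in> supp (P j)" by blast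
    then have "e \<in> dom (snd (P j))" using PC[of j] by (simp add: PC_iff)
    then show "e \<in> dom f" using f[OF j] by (simp add: domIff)
  qed
  moreover have "ran f \<subseteq> {0, 1}"
  proof
    fix v assume "v \<in> ran f"
    then obtain e where e: "f e = Some v" by (auto simp: ran_def)
    then obtain j where j: "e \<in> supp (P j)" by (auto simp: f_def split: if_splits)
    then have "v \<in> ran (snd (P j))" using f[OF j] e by (auto intro: ranI)
    then show "v \<in> {0, 1}" using PC[of j] by (auto simp: PC_iff)
  qed
  ultimately have "(?T, f) \<in> PC" by (auto simp: PC_iff)
  then show "((?T, f), P j) \<in> PF" for j
    unfolding PF_iff using PC ord f fT by auto
  show "supp (?T, f) = (\<Union>j. supp (P j))" using fT by simp
qed

lemma QF_limit:
  assumes X: "X \<subseteq> Field QF"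
    and ex: "\<And>(k :: nat) p J. p \<in> X \<Longrightarrow> finite J \<Longrightarrow> \<exists>q\<in>X \<inter> E k. frozen QF (one_pt J p) q p"
    and p: "p \<in> X" and J: "finite J"
  shows "\<exists>q. frozen QF (one_pt J p) q p \<and> (\<forall>k. \<exists>s\<in>X \<inter> E k. (q, s) \<in> QF)"
proof -
  \<comment> \<open>Stage \<open>k\<close> freezes, besides \<open>J\<close>, the numbers up to the
    opponent's demand \<open>n\<close> in the coordinates up to \<open>k\<close>; every coordinate
    is thus controlled from some stage on.\<close>
  define J' where "J' k n = J \<union> {..k} \<times> {..n}" for k n :: nat
  have "\<exists>q\<in>X \<inter> E k. frozen QF (one_pt (J' k n) s) q s" if "s \<in> X" for k n s
    using ex[OF that, of "J' k n" k] J by (simp add: J'_def)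
  then have "\<forall>k s n. \<exists>q. s \<in> X \<longrightarrow> q \<in> X \<inter> E k \<and> frozen QF (one_pt (J' k n) s) q s" by blast
  then obtain nx where nx: "\<And>k s n. s \<in> X \<Longrightarrow> nx k s n \<in> X \<inter> E k"
    "\<And>k s n. s \<in> X \<Longrightarrow> frozen QF (one_pt (J' k n) s) (nx k s n) s" by metis
  \<comment> \<open>\<open>st \<sigma>\<close> is the condition reached when the opponent has played
    \<open>\<sigma>\<close>; the fold also carries the number of the round, which selects the set
    \<open>E k\<close> to be met.\<close>
  define st where "st \<sigma> = snd (foldl (\<lambda>(k, s) n. (Suc k, nx k s n)) (0, p) \<sigma>)" for \<sigma>
  have len: "fst (foldl (\<lambda>(k, s) n. (Suc k, nx k s n)) (0, p) \<sigma>) = length \<sigma>" for \<sigma>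
    by (induction \<sigma> rule: rev_induct) (auto simp: split_beta)
  have st0: "st [] = p" by (simp add: st_def)
  have stS: "st (\<sigma> @ [n]) = nx (length \<sigma>) (st \<sigma>) n" for \<sigma> n
    using len[of \<sigma>] by (simp add: st_def split_beta)
  have stX: "st \<sigma> \<in> X" for \<sigma>
    by (induction \<sigma> rule: rev_induct) (use p nx st0 stS in auto)
  have fr: "frozen QF (one_pt (J' (length \<sigma>) n) (st \<sigma>)) (st (\<sigma> @ [n])) (st \<sigma>)" for \<sigma> n
    using nx(2)[OF stX] by (simp add: stS)
  have stPC: "st \<sigma> i \<in> PC" for \<sigma> i using stX[of \<sigma>] X by (auto simp: Field_QF)
  have stI: "supp (st \<sigma> i) \<in> I" for \<sigma> i
    using stPC[of \<sigma> i] by (auto simp: PC_iff cofinal_ext_def)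
  have stn: "supp (st (\<sigma> @ [n]) i) - supp (st \<sigma> i) \<subseteq> {n<..}" if "i \<le> length \<sigma>" for \<sigma> n i
    using frozen_supp[OF fr[of \<sigma> n], of i] that by (fastforce simp: J'_def not_le)
  \<comment> \<open>The supports are the moves of the strategy. By \<open>frozen_supp\<close> a
    round answering \<open>n\<close> adds only numbers above \<open>n\<close> in the coordinates up
    to its index, so some sequence of demands keeps all unions of supports in the ideal.\<close>
  obtain x where x: "\<And>j. j \<le> x j" "\<And>i. (\<Union>j. supp (st (map x [0..<j]) i)) \<in> I"
    using strategy_defeated[of "\<lambda>\<sigma> i. supp (st \<sigma> i)", OF stI stn] by blast
  define P where "P j = st (map x [0..<j])" for j
  have P0: "P 0 = p" by (simp add: P_def st0)
  have PS: "P (Suc j) = nx j (P j) (x j)" for j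
    using stS[of "map x [0..<j]" "x j"] by (simp add: P_def)
  have PX: "P j \<in> X" for j by (simp add: P_def stX)
  have frP: "frozen QF (one_pt (J' j (x j)) (P j)) (P (Suc j)) (P j)" for j
    using nx(2)[OF PX] by (simp add: PS)
  have mono: "(P k, P j) \<in> QF" if "j \<le> k" for j k
    using that
  proof (induction k rule: dec_induct)
    case base show ?case using PX X QF_refl by blast
  next
    case (step n)
    then show ?case using frP[of n] QF_trans by (auto simp: frozen_def)
  qed
  have "\<exists>q. (\<forall>j. (q, P j i) \<in> PF) \<and> supp q = (\<Union>j. supp (P j i))" for i
  proof -
    have "(P k i, P j i) \<in> PF" if "j \<le> k" for j k using mono[OF that] by (simp add: QF_iff)
    then show ?thesis using PC_chain_Union[of "\<lambda>j. P j i"] x(2)[of i] unfolding P_def by metis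
  qed
  then obtain q where q: "\<And>i j. (q i, P j i) \<in> PF" "\<And>i. supp (q i) = (\<Union>j. supp (P j i))" by metis
  have qP: "(q, P j) \<in> QF" for j using q(1) by (simp add: QF_iff)
  have compat: "compatible QF (P k) y \<and> (P k, y) \<notin> QF" if y: "y \<in> one_pt J p" for y k
  proof (induction k)
    case 0
    have "(y, p) \<in> QF" "y \<noteq> p" using y one_pt_covers by (auto simp: covers_def)
    moreover have "(y, y) \<in> QF" using QF_refl \<open>(y, p) \<in> QF\<close> by (blast intro: FieldI1)
    ultimately show ?case using QF_antisym unfolding P0 compatible_def by blast
  next
    case (Suc k)
    have "frozen QF (one_pt J p) (P (Suc k)) p" for k
    proof (induction k)
      case 0
      then show ?case using frozen_mono[OF frP[of 0] one_pt_mono[of J]] P0 by (simp add: J'_def)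
    next
      case (Suc k)
      have "frozen QF (one_pt J (P (Suc k))) (P (Suc (Suc k))) (P (Suc k))"
        by (rule frozen_mono[OF frP one_pt_mono]) (simp add: J'_def)
      then show ?case using frozen_one_pt_trans Suc by blast
    qed
    then show ?case using y by (auto simp: frozen_def)
  qed
  have "frozen QF (one_pt J p) q p"
    unfolding frozen_def
  proof (intro conjI ballI)
    show "(q, p) \<in> QF" using qP[of 0] P0 by simp
    fix y assume yJ: "y \<in> one_pt J p"
    then obtain i j where J: "(i, j) \<in> J" and y: "y \<in> one_pt {(i, j)} p" by (rule one_ptE)
    have jp: "j \<notin> supp (p i)" and jy: "j \<in> supp (y i)" using y by (simp_all add: one_pt1)
    have "j \<notin> supp (P k i)" for k
    proof (induction k)
      case 0 then show ?case using jp P0 by simp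
    next
      case (Suc k) then show ?case using frozen_supp[OF frP[of k], of i j] J by (auto simp: J'_def)
    qed
    then have jq: "j \<notin> supp (q i)" and jP: "\<And>k. j \<notin> supp (P k i)" using q(2) by auto
    then show "(q, y) \<notin> QF" using jy PF_supp[of "q i" "y i"] by (auto simp: QF_iff)
    have "p \<in> Field QF" using p X by blast
    then obtain K where K: "\<And>p' y q. (p', p) \<in> QF \<Longrightarrow> y \<in> one_pt {(i, j)} p' \<Longrightarrow> (q, p') \<in> QF \<Longrightarrow>
        j \<notin> supp (q i) \<Longrightarrow> (\<forall>e\<in>supp (q i) - supp (p' i). K < e) \<Longrightarrow> compatible QF q y"
      using QF_amalgamation[of p i j] by blast
    define k where "k = Suc (max i K)"
    have new: "\<forall>e\<in>supp (q i) - supp (P k i). K < e"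
    proof
      fix e assume e: "e \<in> supp (q i) - supp (P k i)"
      then obtain l where l: "e \<in> supp (P l i)" using q(2) by blast
      have "e \<in> supp (P k i) \<or> K < e" if "e \<in> supp (P l i)" for l
        using that
      proof (induction l)
        case 0
        then show ?case using mono[of 0 k] PF_supp[of "P k i" "P 0 i"] by (auto simp: QF_iff)
      next
        case (Suc l)
        show ?case
        proof (cases "k \<le> l")
          case True
          show ?thesis
          proof (cases "e \<le> x l")
            case True
            then have "(i, e) \<in> J' l (x l)" using \<open>k \<le> l\<close> by (auto simp: J'_def k_def)
            then show ?thesis using frozen_supp[OF frP[of l], of i e] Suc by blast
          next
            case False
            moreover have "K < k" by (simp add: k_def)
            ultimately show ?thesis using x(1)[of l] \<open>k \<le> l\<close> by linarith
          qed
        next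
          case False
          then have "(P k i, P (Suc l) i) \<in> PF" using mono[of "Suc l" k] by (simp add: QF_iff)
          then show ?thesis using PF_supp Suc.prems by blast
        qed
      qed
      then show "K < e" using l e by blast
    qed
    \<comment> \<open>\<open>y\<close> is a cover of \<open>p\<close>, not of \<open>P k\<close>; it
      is replaced by a cover \<open>z\<close> of \<open>P k\<close> below it, to which amalgamation
      applies.\<close>
    obtain z where z: "z \<in> one_pt {(i, j)} (P k)" "(z, y) \<in> QF"
      using one_pt_transfer[of y i j p "P k"] y jP[of k] mono[of 0 k] P0 compat[OF yJ, of k] by auto
    have "compatible QF q z" using K[OF _ z(1) qP jq new] mono[of 0 k] P0 by simp
    then show "compatible QF q y" using z(2) QF_trans by (auto simp: compatible_def)
  qed
  moreover have "\<exists>s\<in>X \<inter> E k. (q, s) \<in> QF" for k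
    using nx(1)[OF PX[of k], of k "x k"] qP[of "Suc k"] unfolding PS by blast
  ultimately show ?thesis by blast
qed

lemma fusion_QF: "fusion QF one_pt"
proof unfold_locales
  show "one_pt J p \<subseteq> covers QF p" for J p by (rule one_pt_covers)
qed (fact QF_refl QF_trans one_pt_finite covers_QF_countable covers_QF_infinite
    frozen_one_pt_trans QF_one_step QF_limit)+

end

section \<open>Elementary submodels\<close>

lemma sat_connectives [simp]:
  "sat M E (Imp \<phi> \<psi>) e \<longleftrightarrow> (sat M E \<phi> e \<longrightarrow> sat M E \<psi> e)"
  "sat M E (Disj \<phi> \<psi>) e \<longleftrightarrow> sat M E \<phi> e \<or> sat M E \<psi> e"
  "sat M E (Iff \<phi> \<psi>) e \<longleftrightarrow> (sat M E \<phi> e \<longleftrightarrow> sat M E \<psi> e)"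
  "sat M E (Exists x \<phi>) e \<longleftrightarrow> (\<exists>a\<in>M. sat M E \<phi> (e(x := a)))"
  by (auto simp: Imp_def Disj_def Iff_def Exists_def)

lemma sat_bounded [simp]:
  "x \<noteq> y \<Longrightarrow> sat M E (BAll x y \<phi>) e \<longleftrightarrow> (\<forall>a\<in>M. (a, e y) \<in> E \<longrightarrow> sat M E \<phi> (e(x := a)))"
  "x \<noteq> y \<Longrightarrow> sat M E (BEx x y \<phi>) e \<longleftrightarrow> (\<exists>a\<in>M. (a, e y) \<in> E \<and> sat M E \<phi> (e(x := a)))"
  by (auto simp: BAll_def BEx_def)

lemma sat_UPair_fm:
  "100 \<notin> {x, y, z} \<Longrightarrow> sat UNIV E (UPair_fm z x y) e \<longleftrightarrow> upair_in E (e z) (e x) (e y)"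
  by (auto simp: UPair_fm_def upair_in_def ext_def)

lemma sat_OPair_fm:
  assumes "x \<notin> {100..102}" "y \<notin> {100..102}" "z \<notin> {100..102}"
  shows "sat UNIV E (OPair_fm z x y) e \<longleftrightarrow> opair_in E (e z) (e x) (e y)"
proof -
  have "x \<noteq> 100" "x \<noteq> 101" "x \<noteq> 102" "y \<noteq> 100" "y \<noteq> 101" "y \<noteq> 102" "z \<noteq> 100" "z \<noteq> 101" "z \<noteq> 102"
    using assms by auto
  then show ?thesis by (simp add: OPair_fm_def opair_in_def sat_UPair_fm)
qed

definition Conjs :: "fm list \<Rightarrow> fm" where
  "Conjs \<phi>s = foldr Conj \<phi>s (Eq 0 0)"

definition Disjs :: "fm list \<Rightarrow> fm" where
  "Disjs \<phi>s = foldr Disj \<phi>s (Neg (Eq 0 0))"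

lemma sat_Conjs [simp]: "sat M E (Conjs \<phi>s) e \<longleftrightarrow> (\<forall>\<phi>\<in>set \<phi>s. sat M E \<phi> e)"
  by (induction \<phi>s) (auto simp: Conjs_def)

lemma sat_Disjs [simp]: "sat M E (Disjs \<phi>s) e \<longleftrightarrow> (\<exists>\<phi>\<in>set \<phi>s. sat M E \<phi> e)"
  by (induction \<phi>s) (auto simp: Disjs_def)

lemma sat_exists_list:
  "sat UNIV E (foldr Exists xs \<phi>) e \<longleftrightarrow> (\<exists>e'. (\<forall>x. x \<notin> set xs \<longrightarrow> e' x = e x) \<and> sat UNIV E \<phi> e')"
proof (induction xs arbitrary: e)
  case Nil
  then show ?case by (auto simp: fun_eq_iff[symmetric] ext)
next
  case (Cons x xs)
  have "sat UNIV E (foldr Exists (x # xs) \<phi>) e \<longleftrightarrow>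
      (\<exists>a e'. (\<forall>y. y \<notin> set xs \<longrightarrow> e' y = (e(x := a)) y) \<and> sat UNIV E \<phi> e')"
    using Cons by simp
  also have "\<dots> \<longleftrightarrow> (\<exists>e'. (\<forall>y. y \<notin> set (x # xs) \<longrightarrow> e' y = e y) \<and> sat UNIV E \<phi> e')"
  proof
    assume "\<exists>a e'. (\<forall>y. y \<notin> set xs \<longrightarrow> e' y = (e(x := a)) y) \<and> sat UNIV E \<phi> e'"
    then obtain a e' where "\<forall>y. y \<notin> set xs \<longrightarrow> e' y = (e(x := a)) y" "sat UNIV E \<phi> e'" by blast
    then show "\<exists>e'. (\<forall>y. y \<notin> set (x # xs) \<longrightarrow> e' y = e y) \<and> sat UNIV E \<phi> e'"
      by (intro exI[of _ e']) auto
  next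
    assume "\<exists>e'. (\<forall>y. y \<notin> set (x # xs) \<longrightarrow> e' y = e y) \<and> sat UNIV E \<phi> e'"
    then obtain e' where "\<forall>y. y \<notin> set (x # xs) \<longrightarrow> e' y = e y" "sat UNIV E \<phi> e'" by blast
    then show "\<exists>a e'. (\<forall>y. y \<notin> set xs \<longrightarrow> e' y = (e(x := a)) y) \<and> sat UNIV E \<phi> e'"
      by (intro exI[of _ "e' x"] exI[of _ e']) auto
  qed
  finally show ?case .
qed

lemma elementary_witness:
  assumes N: "elementary_submodel E N" and e: "range e \<subseteq> N" and ex: "sat UNIV E \<phi> (e(x := a))"
  shows "\<exists>b\<in>N. sat UNIV E \<phi> (e(x := b))"
proof -
  have "sat UNIV E (Exists x \<phi>) e" using ex by auto
  then have "sat N E (Exists x \<phi>) e" using N e unfolding elementary_submodel_def by blast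
  then obtain b where b: "b \<in> N" "sat N E \<phi> (e(x := b))" by auto
  then have "range (e(x := b)) \<subseteq> N" using e by auto
  then show ?thesis using N b by (auto simp: elementary_submodel_def)
qed

text \<open>How many witnesses are sought depends on the size of a finite set of conditions, so they
  are obtained for a whole list of variables.\<close>

lemma elementary_witnesses:
  assumes N: "elementary_submodel E N"
  shows "range e \<subseteq> N \<Longrightarrow> \<forall>x. x \<notin> set xs \<longrightarrow> e' x = e x \<Longrightarrow> sat UNIV E \<phi> e' \<Longrightarrow>
    \<exists>e'. (\<forall>x. x \<notin> set xs \<longrightarrow> e' x = e x) \<and> range e' \<subseteq> N \<and> sat UNIV E \<phi> e'"
proof (induction xs arbitrary: e e')
  case Nil
  then have "e' = e" by auto
  then show ?case using Nil by auto
next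
  case (Cons x xs)
  have "sat UNIV E (foldr Exists xs \<phi>) (e(x := e' x))"
    unfolding sat_exists_list using Cons.prems by (intro exI[of _ e']) auto
  then obtain b where b: "b \<in> N" "sat UNIV E (foldr Exists xs \<phi>) (e(x := b))"
    using elementary_witness[OF N Cons.prems(1)] by blast
  then obtain e1 where e1: "\<forall>y. y \<notin> set xs \<longrightarrow> e1 y = (e(x := b)) y" "sat UNIV E \<phi> e1"
    unfolding sat_exists_list by blast
  have "range (e(x := b)) \<subseteq> N" using b Cons.prems(1) by auto
  then obtain e2 where "\<forall>y. y \<notin> set xs \<longrightarrow> e2 y = (e(x := b)) y" "range e2 \<subseteq> N" "sat UNIV E \<phi> e2"
    using Cons.IH[OF _ e1] by blast
  then show ?case by (intro exI[of _ e2]) auto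
qed

text \<open>In the following formulas the variables 0 and 1 stand for the underlying set and the order of
  a forcing notion; the variables from 100 to 199 are reserved for bound occurrences.\<close>

definition Pair_fm :: "nat \<Rightarrow> nat \<Rightarrow> nat \<Rightarrow> fm" where
  "Pair_fm g x y = BEx 103 g (OPair_fm 103 x y)"

definition Compat_fm :: "nat \<Rightarrow> nat \<Rightarrow> fm" where
  "Compat_fm x y = Exists 104 (Conj (Pair_fm 1 104 x) (Pair_fm 1 104 y))"

definition Cover_fm :: "nat \<Rightarrow> nat \<Rightarrow> fm" where
  "Cover_fm y p = Conj (Pair_fm 1 y p) (Conj (Neg (Eq y p)) (Forall 105
     (Imp (Conj (Pair_fm 1 y 105) (Pair_fm 1 105 p)) (Disj (Eq 105 y) (Eq 105 p)))))"

text \<open>Finite sets of conditions enter as lists of variables. So only the codes of their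
  elements have to belong to a submodel, and no set of the structure has to represent the finite
  set.\<close>

definition Frozen_fm :: "nat list \<Rightarrow> nat \<Rightarrow> nat \<Rightarrow> fm" where
  "Frozen_fm ys q p = Conj (Pair_fm 1 q p)
     (Conjs (map (\<lambda>y. Conj (Compat_fm q y) (Neg (Pair_fm 1 q y))) ys))"

definition Predense_fm :: "nat list \<Rightarrow> nat \<Rightarrow> fm" where
  "Predense_fm ds q = Forall 105 (Imp (Pair_fm 1 105 q) (Disjs (map (\<lambda>d. Compat_fm d 105) ds)))"

definition Dense_fm :: "nat \<Rightarrow> fm" where
  "Dense_fm d = Conj (BAll 105 d (Mem 105 0)) (BAll 105 0 (BEx 106 d (Pair_fm 1 106 105)))"

definition Generic_fm :: "nat \<Rightarrow> nat \<Rightarrow> fm" where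
  "Generic_fm v q = BAll 107 v (Imp (Dense_fm 107) (Forall 108 (Imp (Pair_fm 1 108 q)
     (BEx 109 107 (Conj (Mem 109 v) (Compat_fm 109 108))))))"

definition Generics_fm :: "nat \<Rightarrow> nat \<Rightarrow> fm" where
  "Generics_fm s q = BAll 110 s (Forall 111 (Forall 112
     (Imp (OPair_fm 110 111 112) (Generic_fm 112 q))))"

definition pair_in :: "'m rel \<Rightarrow> 'm \<Rightarrow> 'm \<Rightarrow> 'm \<Rightarrow> bool" where
  "pair_in E g a b \<longleftrightarrow> (\<exists>w. (w, g) \<in> E \<and> opair_in E w a b)"

lemma sat_Pair_fm:
  assumes "x \<notin> {100..103}" "y \<notin> {100..103}" "g \<noteq> 103"
  shows "sat UNIV E (Pair_fm g x y) e \<longleftrightarrow> pair_in E (e g) (e x) (e y)"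
proof -
  have "x \<notin> {100..102}" "y \<notin> {100..102}" "x \<noteq> 103" "y \<noteq> 103" using assms by auto
  then show ?thesis using assms(3) by (simp add: Pair_fm_def pair_in_def sat_OPair_fm)
qed

lemma sat_Compat_fm:
  assumes "x \<notin> {100..104}" "y \<notin> {100..104}"
  shows "sat UNIV E (Compat_fm x y) e \<longleftrightarrow> (\<exists>t. pair_in E (e 1) t (e x) \<and> pair_in E (e 1) t (e y))"
proof -
  have "x \<notin> {100..103}" "y \<notin> {100..103}" "x \<noteq> 104" "y \<noteq> 104" using assms by auto
  then show ?thesis by (simp add: Compat_fm_def sat_Pair_fm)
qed

lemma sat_Cover_fm:
  assumes "y \<notin> {100..105}" "p \<notin> {100..105}"
  shows "sat UNIV E (Cover_fm y p) e \<longleftrightarrow> pair_in E (e 1) (e y) (e p) \<and> e y \<noteq> e p \<and>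
    (\<forall>w. pair_in E (e 1) (e y) w \<and> pair_in E (e 1) w (e p) \<longrightarrow> w = e y \<or> w = e p)"
proof -
  have "y \<notin> {100..103}" "p \<notin> {100..103}" "y \<noteq> 105" "p \<noteq> 105" using assms by auto
  then show ?thesis by (simp add: Cover_fm_def sat_Pair_fm)
qed

lemma sat_Frozen_fm:
  assumes "q \<notin> {100..104}" "p \<notin> {100..104}" "set ys \<inter> {100..104} = {}"
  shows "sat UNIV E (Frozen_fm ys q p) e \<longleftrightarrow> pair_in E (e 1) (e q) (e p) \<and>
    (\<forall>y\<in>set ys. (\<exists>t. pair_in E (e 1) t (e q) \<and> pair_in E (e 1) t (e y)) \<and> \<not> pair_in E (e 1) (e q)
        (e y))"
proof -
  have "q \<notin> {100..103}" "p \<notin> {100..103}" using assms by auto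
  moreover have "y \<notin> {100..104}" "y \<notin> {100..103}" if "y \<in> set ys" for y using assms(3) that by
      fastforce+
  ultimately show ?thesis using assms(1,2)
    by (simp add: Frozen_fm_def sat_Pair_fm sat_Compat_fm del: atLeastAtMost_iff cong: ball_cong)
qed

lemma sat_Predense_fm:
  assumes "q \<notin> {100..105}" "set ds \<inter> {100..105} = {}"
  shows "sat UNIV E (Predense_fm ds q) e \<longleftrightarrow> (\<forall>q'. pair_in E (e 1) q' (e q) \<longrightarrow>
    (\<exists>d\<in>set ds. \<exists>t. pair_in E (e 1) t (e d) \<and> pair_in E (e 1) t q'))"
proof -
  have q: "q \<notin> {100..103}" "q \<noteq> 105" using assms by auto
  have *: "d \<notin> {100..104}" "d \<noteq> 105" if "d \<in> set ds" for d using assms(2) that by fastforce+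
  have "sat UNIV E (Compat_fm d 105) (e(105 := q')) \<longleftrightarrow>
      (\<exists>t. pair_in E (e 1) t (e d) \<and> pair_in E (e 1) t q')" if "d \<in> set ds" for d q'
    using *[OF that] by (subst sat_Compat_fm) auto
  then show ?thesis using q by (simp add: Predense_fm_def sat_Pair_fm cong: bex_cong)
qed

lemma sat_Dense_fm:
  assumes "d \<notin> {100..106}"
  shows "sat UNIV E (Dense_fm d) e \<longleftrightarrow> ext E (e d) \<subseteq> ext E (e 0) \<and>
    (\<forall>p\<in>ext E (e 0). \<exists>b\<in>ext E (e d). pair_in E (e 1) b p)"
proof -
  have "d \<noteq> 105" "d \<noteq> 106" using assms by auto
  then show ?thesis by (auto simp: Dense_fm_def sat_Pair_fm ext_def)
qed

lemma sat_Generic_fm: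
  assumes "v \<notin> {100..109}" "q \<notin> {100..109}"
  shows "sat UNIV E (Generic_fm v q) e \<longleftrightarrow> (\<forall>D\<in>ext E (e v). ext E D \<subseteq> ext E (e 0) \<and>
    (\<forall>p\<in>ext E (e 0). \<exists>b\<in>ext E D. pair_in E (e 1) b p) \<longrightarrow>
    (\<forall>q'. pair_in E (e 1) q' (e q) \<longrightarrow> (\<exists>b\<in>ext E D. (b, e v) \<in> E \<and>
      (\<exists>t. pair_in E (e 1) t b \<and> pair_in E (e 1) t q'))))"
proof -
  have ne: "v \<noteq> 107" "v \<noteq> 108" "v \<noteq> 109" "q \<noteq> 107" "q \<noteq> 108" "q \<notin> {100..103}" using assms by auto
  have "sat UNIV E (Dense_fm 107) (e(107 := D)) \<longleftrightarrow> ext E D \<subseteq> ext E (e 0) \<and>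
    (\<forall>p\<in>ext E (e 0). \<exists>b\<in>ext E D. pair_in E (e 1) b p)" for D
    by (subst sat_Dense_fm) auto
  moreover have "sat UNIV E (Compat_fm 109 108) (e(107 := D, 108 := q', 109 := b)) \<longleftrightarrow>
      (\<exists>t. pair_in E (e 1) t b \<and> pair_in E (e 1) t q')" for D q' b
    by (subst sat_Compat_fm) auto
  moreover have "sat UNIV E (Pair_fm 1 108 q) (e(107 := D, 108 := q')) \<longleftrightarrow> pair_in E (e 1) q' (e q)"
      for D q'
    using ne by (subst sat_Pair_fm) auto
  ultimately show ?thesis using ne by (simp add: Generic_fm_def ext_def Bex_def Ball_def)
qed

lemma sat_Generics_fm:
  assumes "s \<noteq> 110" "q \<notin> {100..112}"
  shows "sat UNIV E (Generics_fm s q) e \<longleftrightarrow> (\<forall>w \<xi> v. (w, e s) \<in> E \<and> opair_in E w \<xi> v \<longrightarrow>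
    sat UNIV E (Generic_fm 112 q) (e(112 := v)))"
proof -
  have q: "q \<notin> {100..109}" "q \<noteq> 110" "q \<noteq> 111" "q \<noteq> 112" using assms by auto
  have "sat UNIV E (Generic_fm 112 q) (e(110 := w, 111 := \<xi>, 112 := v)) =
      sat UNIV E (Generic_fm 112 q) (e(112 := v))" for w \<xi> v
    using q by (simp add: sat_Generic_fm)
  then show ?thesis using assms by (auto simp: Generics_fm_def sat_OPair_fm)
qed

lemma countable_ordLess: "countable A \<Longrightarrow> natLeq <o \<kappa> \<Longrightarrow> |A| <o \<kappa>"
proof -
  assume "countable A" and \<kappa>: "natLeq <o \<kappa>"
  then obtain f :: "'a \<Rightarrow> nat" where "inj_on f A" by (auto simp: countable_def)
  then have "|A| \<le>o |UNIV :: nat set|" using card_of_ordLeq by blast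
  then show "|A| <o \<kappa>" using card_of_nat \<kappa> ordLeq_ordIso_trans ordLeq_ordLess_trans by blast
qed

section \<open>Existence of sets in the structure H(\<kappa>)\<close>

locale H_model =
  fixes \<kappa> E :: "'m rel"
  assumes H: "H_structure \<kappa> E" and \<kappa>: "natLeq <o \<kappa>"
begin

lemma ext_inj: "ext E x = ext E y \<Longrightarrow> x = y"
  using H by (auto simp: H_structure_def inj_def)

lemma wf_E: "wf E"
  using H by (simp add: H_structure_def)

lemma ordLess_Un:
  fixes A B :: "'m set"
  assumes "|A| <o \<kappa>" "|B| <o \<kappa>"
  shows "|A \<union> B| <o \<kappa>"
proof -
  have "Card_order \<kappa>" using H by (simp add: H_structure_def)
  have "\<not> finite (Field \<kappa>)"
  proof
    assume "finite (Field \<kappa>)"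
    have "natLeq \<le>o |Field \<kappa>|"
      using \<kappa> card_of_Field_ordIso[OF \<open>Card_order \<kappa>\<close>] ordIso_symmetric ordLess_imp_ordLeq
          ordLeq_ordIso_trans by blast
    then show False using \<open>finite (Field \<kappa>)\<close> infinite_iff_natLeq_ordLeq by blast
  qed
  then show ?thesis using \<open>Card_order \<kappa>\<close> assms by (rule card_of_Un_ordLess_infinite_Field)
qed

lemma ordLess_subset: "|B| <o \<kappa> \<Longrightarrow> A \<subseteq> B \<Longrightarrow> |A| <o \<kappa>" for A B :: "'m set"
  using card_of_mono1 ordLeq_ordLess_trans by blast

lemma closure_ordLess: "|{y. (y, x) \<in> E\<^sup>*}| <o \<kappa>"
proof -
  have "ext E x \<in> range (ext E)" by simp
  then have "|{y. \<exists>z\<in>ext E x. (y, z) \<in> E\<^sup>*}| <o \<kappa>" using H unfolding H_structure_def by blast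
  moreover have "|{x}| <o \<kappa>" by (rule countable_ordLess[OF _ \<kappa>]) simp
  ultimately have "|{y. \<exists>z\<in>ext E x. (y, z) \<in> E\<^sup>*} \<union> {x}| <o \<kappa>" by (rule ordLess_Un)
  moreover have "{y. (y, x) \<in> E\<^sup>*} \<subseteq> {y. \<exists>z\<in>ext E x. (y, z) \<in> E\<^sup>*} \<union> {x}"
    by (auto simp: ext_def elim: rtranclE)
  ultimately show ?thesis by (rule ordLess_subset)
qed

text \<open>Sets of the structure are recognised by the size of their closure under elements; a
  small transitive superset \<open>B\<close> bounds that closure.\<close>

lemma set_exists:
  assumes "|B| <o \<kappa>" "X \<subseteq> B" "\<And>x y. x \<in> B \<Longrightarrow> (y, x) \<in> E \<Longrightarrow> y \<in> B"
  shows "\<exists>x. ext E x = X"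
proof -
  have "y \<in> B" if "(y, x) \<in> E\<^sup>*" "x \<in> B" for y x
    using that by (induction rule: converse_rtrancl_induct) (auto intro: assms(3))
  then have "|{y. \<exists>x\<in>X. (y, x) \<in> E\<^sup>*}| <o \<kappa>" using assms(2) by (intro ordLess_subset[OF assms(1)]) blast
  then have "X \<in> range (ext E)" using H unfolding H_structure_def by blast
  then show ?thesis by force
qed

lemma upair_exists: "\<exists>z. upair_in E z x y"
proof -
  have "|{a. (a, x) \<in> E\<^sup>*} \<union> {a. (a, y) \<in> E\<^sup>*}| <o \<kappa>" by (intro ordLess_Un closure_ordLess)
  then have "\<exists>z. ext E z = {x, y}"
    by (rule set_exists) (auto intro: converse_rtrancl_into_rtrancl)
  then show ?thesis by (simp add: upair_in_def)
qed

lemma opair_exists: "\<exists>w. opair_in E w x y"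
  unfolding opair_in_def using upair_exists by blast

lemma opair_in_inject:
  assumes "opair_in E w x y" "opair_in E w x' y'"
  shows "x = x' \<and> y = y'"
proof -
  obtain u v where u: "ext E u = {x}" "ext E v = {x, y}" "ext E w = {u, v}"
    using assms(1) by (auto simp: opair_in_def upair_in_def)
  obtain u' v' where u': "ext E u' = {x'}" "ext E v' = {x', y'}" "ext E w = {u', v'}"
    using assms(2) by (auto simp: opair_in_def upair_in_def)
  have eq: "{u, v} = {u', v'}" using u u' by simp
  show ?thesis
  proof (cases "u = u'")
    case True
    then have "x = x'" using u u' by auto
    moreover have "v = v'" using eq True by (auto simp: doubleton_eq_iff)
    ultimately show ?thesis using u u' by (auto simp: doubleton_eq_iff)
  next
    case False
    then have "u = v'" "v = u'" using eq by (auto simp: doubleton_eq_iff)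
    then show ?thesis using u u' by (auto simp: doubleton_eq_iff)
  qed
qed

lemma subset_exists: "X \<subseteq> ext E A \<Longrightarrow> \<exists>x. ext E x = X"
  by (rule set_exists[OF closure_ordLess[of A]])
    (auto simp: ext_def intro: converse_rtrancl_into_rtrancl)

text \<open>The codes of the pairs and of their components, together with the transitive closure of
  \<open>A\<close>, form a transitive set \<open>?B\<close>; countability of \<open>G\<close> keeps
  its size below \<open>\<kappa>\<close>.\<close>

lemma countable_relation_exists:
  assumes G: "countable G" "G \<subseteq> ext E A \<times> ext E A"
  shows "\<exists>g. \<forall>x y. pair_in E g x y \<longleftrightarrow> (x, y) \<in> G"
proof -
  have "\<forall>p. \<exists>u v w. upair_in E u (fst p) (fst p) \<and> upair_in E v (fst p) (snd p) \<and> upair_in E w u v"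
    using upair_exists by blast
  then obtain u v w where uvw: "\<And>p. ext E (u p) = {fst p}" "\<And>p. ext E (v p) = {fst p, snd p}"
    "\<And>p. ext E (w p) = {u p, v p}" unfolding upair_in_def by (metis insert_absorb2)
  have wp: "opair_in E (w (x, y)) x y" for x y
    unfolding opair_in_def upair_in_def using uvw[of "(x, y)"] by auto
  let ?B = "(u ` G \<union> v ` G \<union> w ` G) \<union> {y. (y, A) \<in> E\<^sup>*}"
  have "|?B| <o \<kappa>" using G by (intro ordLess_Un closure_ordLess countable_ordLess[OF _ \<kappa>]) auto
  moreover have "y \<in> ?B" if "x \<in> ?B" "(y, x) \<in> E" for x y
  proof -
    have A: "a \<in> {y. (y, A) \<in> E\<^sup>*}" if "a \<in> ext E A" for a using that by (auto simp: ext_def)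
    consider p where "p \<in> G" "x = u p \<or> x = v p" | p where "p \<in> G" "x = w p" | "(x, A) \<in> E\<^sup>*"
      using \<open>x \<in> ?B\<close> by blast
    then show ?thesis
    proof cases
      case 1
      then have "y = fst p \<or> y = snd p" using uvw(1,2)[of p] that(2) by (auto simp: ext_def)
      moreover have "fst p \<in> ext E A" "snd p \<in> ext E A" using G(2) 1(1) by auto
      ultimately show ?thesis using A by blast
    next
      case 2
      then have "y = u p \<or> y = v p" using uvw(3)[of p] that(2) by (auto simp: ext_def)
      then show ?thesis using 2 by blast
    next
      case 3
      then show ?thesis using that(2) by (auto intro: converse_rtrancl_into_rtrancl)
    qed
  qed
  ultimately obtain g where g: "ext E g = w ` G"
    using set_exists[of ?B "w ` G"] by blast
  have "pair_in E g x y \<longleftrightarrow> (x, y) \<in> G" for x y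
  proof
    assume "pair_in E g x y"
    then obtain w0 where "w0 \<in> ext E g" "opair_in E w0 x y" by (auto simp: pair_in_def ext_def)
    then obtain p where "p \<in> G" "opair_in E (w p) x y" unfolding g by blast
    then show "(x, y) \<in> G" using opair_in_inject wp[of "fst p" "snd p"] by (metis prod.collapse)
  next
    assume "(x, y) \<in> G"
    then have "w (x, y) \<in> ext E g" unfolding g by blast
    then show "pair_in E g x y" using wp[of x y] by (auto simp: pair_in_def ext_def)
  qed
  then show ?thesis by blast
qed

end

section \<open>A forcing notion seen from its submodels\<close>

locale forcing_model = fusion r C + H_model \<kappa> E
  for r :: "'p rel" and C :: "'j set \<Rightarrow> 'p \<Rightarrow> 'p set" and \<kappa> E :: "'m rel" +
  fixes c :: "'p \<Rightarrow> 'm" and A R :: 'm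
  assumes c_inj: "inj_on c (Field r)" and ext_A: "ext E A = c ` Field r"
    and ext_R: "ext E R = {w. \<exists>(p, q)\<in>r. opair_in E w (c p) (c q)}"
begin

lemma pair_in_R: "pair_in E R a b \<longleftrightarrow> (\<exists>p q. (p, q) \<in> r \<and> a = c p \<and> b = c q)"
proof
  assume "pair_in E R a b"
  then obtain w where "w \<in> ext E R" "opair_in E w a b" by (auto simp: pair_in_def ext_def)
  then show "\<exists>p q. (p, q) \<in> r \<and> a = c p \<and> b = c q" unfolding ext_R using opair_in_inject by fast
next
  assume "\<exists>p q. (p, q) \<in> r \<and> a = c p \<and> b = c q"
  then obtain p q where pq: "(p, q) \<in> r" "a = c p" "b = c q" by blast
  obtain w where w: "opair_in E w a b" using opair_exists by blast
  then have "w \<in> ext E R" unfolding ext_R using pq by blast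
  then show "pair_in E R a b" using w by (auto simp: pair_in_def ext_def)
qed

lemma pair_in_R_c: "p \<in> Field r \<Longrightarrow> q \<in> Field r \<Longrightarrow> pair_in E R (c p) (c q) \<longleftrightarrow> (p, q) \<in> r"
  unfolding pair_in_R using c_inj by (auto dest: inj_onD intro: FieldI1 FieldI2)

lemma pair_in_R_left: "q \<in> Field r \<Longrightarrow> pair_in E R a (c q) \<longleftrightarrow> (\<exists>p. (p, q) \<in> r \<and> a = c p)"
  unfolding pair_in_R using c_inj by (auto dest: inj_onD intro: FieldI1 FieldI2)

lemma compatible_c:
  "p \<in> Field r \<Longrightarrow> q \<in> Field r \<Longrightarrow>
    (\<exists>t. pair_in E R t (c p) \<and> pair_in E R t (c q)) \<longleftrightarrow> compatible r p q"
  unfolding compatible_def by (metis FieldI1 pair_in_R_c pair_in_R_left)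

definition submodel :: "'m set \<Rightarrow> bool" where
  "submodel N \<longleftrightarrow> elementary_submodel E N \<and> A \<in> N \<and> R \<in> N"

lemma cover_c:
  assumes p: "p \<in> Field r"
  shows "pair_in E R y (c p) \<and> y \<noteq> c p \<and> (\<forall>w. pair_in E R y w \<and> pair_in E R w (c p) \<longrightarrow> w = y \<or> w = c p)
    \<longleftrightarrow> y \<in> c ` covers r p" (is "?L \<longleftrightarrow> _")
proof
  assume L: ?L
  then obtain q where q: "(q, p) \<in> r" "y = c q" using pair_in_R_left[OF p] by blast
  have "w = q \<or> w = p" if w: "(q, w) \<in> r" "(w, p) \<in> r" for w
  proof -
    have "w \<in> Field r" "q \<in> Field r" using w by (auto intro: FieldI1)
    moreover have "pair_in E R (c q) (c w)" "pair_in E R (c w) (c p)" using w pair_in_R by blast+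
    then have "c w = c q \<or> c w = c p" using L q(2) by blast
    ultimately show ?thesis using c_inj p by (auto dest: inj_onD)
  qed
  then show "y \<in> c ` covers r p" using q L by (auto simp: covers_def)
next
  assume "y \<in> c ` covers r p"
  then obtain q where q: "q \<in> covers r p" "y = c q" by blast
  then have qp: "(q, p) \<in> r" "q \<noteq> p" "\<And>w. (q, w) \<in> r \<Longrightarrow> (w, p) \<in> r \<Longrightarrow> w = q \<or> w = p"
    by (auto simp: covers_def)
  have qF: "q \<in> Field r" using qp by (auto intro: FieldI1)
  have "w = y \<or> w = c p" if w: "pair_in E R y w" "pair_in E R w (c p)" for w
  proof -
    obtain s where "(s, p) \<in> r" "w = c s" using w(2) pair_in_R_left[OF p] by blast
    moreover have "(q, s) \<in> r" using w(1) calculation q(2) qF pair_in_R_c by (metis FieldI1)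
    ultimately show ?thesis using qp(3) q(2) by blast
  qed
  moreover have "y \<noteq> c p" using qp(2) q(2) c_inj p qF by (auto dest: inj_onD)
  ultimately show ?L using q(2) qp(1) pair_in_R by blast
qed

text \<open>A countable set defined in \<open>N\<close> is a subset of \<open>N\<close>: it is the closure of a single point under
  a partial function, and such a function exists in \<open>N\<close>.\<close>

lemma covers_in_submodel:
  assumes N: "submodel N" and p: "p \<in> Field r" "c p \<in> N" and y: "y \<in> covers r p"
  shows "c y \<in> N"
proof -
  have el: "elementary_submodel E N" and AN: "A \<in> N" "R \<in> N" using N by (auto simp: submodel_def)
  \<comment> \<open>An enumeration without repetitions, so that passing from \<open>G n\<close> to
    \<open>G (Suc n)\<close> is a partial function.\<close>
  define G where "G n = c (from_nat_into (covers r p) n)" for n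
  note bij = bij_betw_from_nat_into[OF covers_countable[OF p(1)] covers_infinite[OF p(1)]]
  have cF: "covers r p \<subseteq> Field r" by (auto simp: covers_def intro: FieldI1)
  have Gc: "range G = c ` covers r p" using bij by (force simp: G_def bij_betw_def)
  have Ginj: "inj G"
  proof (rule injI)
    fix m n assume "G m = G n"
    moreover have "from_nat_into (covers r p) k \<in> covers r p" for k using bij by (auto simp:
        bij_betw_def)
    ultimately have "from_nat_into (covers r p) m = from_nat_into (covers r p) n"
      unfolding G_def using c_inj cF by (meson inj_onD subsetD)
    then show "m = n" using bij by (simp add: bij_betw_def inj_eq)
  qed
  have GA: "G n \<in> ext E A" for n using Gc cF ext_A by blast
  have "countable (range (\<lambda>n. (G n, G (Suc n))))" by simp
  moreover have "range (\<lambda>n. (G n, G (Suc n))) \<subseteq> ext E A \<times> ext E A" using GA by blast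
  ultimately obtain g where g: "\<And>x y. pair_in E g x y \<longleftrightarrow> (x, y) \<in> range (\<lambda>n. (G n, G (Suc n)))"
    using countable_relation_exists by meson
  \<comment> \<open>Variables 0 to 2 hold \<open>A\<close>, \<open>R\<close> and \<open>c p\<close>;
    3 and 4 hold the function and its starting point. The closure is expressed by quantifying over
    all sets closed under the function, so the natural numbers need not be coded in the
    structure.\<close>
  define \<phi> where "\<phi> = Conj (Mem 4 0) (Conj
    (Forall 5 (Forall 6 (Forall 7 (Imp (Conj (Pair_fm 3 5 6) (Pair_fm 3 5 7)) (Eq 6 7)))))
    (Forall 8 (Imp (Conj (Mem 4 8)
        (BAll 5 8 (BAll 6 0 (Imp (Pair_fm 3 5 6) (Mem 6 8)))))
      (Forall 7 (Imp (Cover_fm 7 2) (Mem 7 8))))))"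
  define \<Psi> where "\<Psi> g x0 \<longleftrightarrow> x0 \<in> ext E A \<and>
    (\<forall>x y y'. pair_in E g x y \<and> pair_in E g x y' \<longrightarrow> y = y') \<and>
    (\<forall>S. x0 \<in> ext E S \<and> (\<forall>x\<in>ext E S. \<forall>y\<in>ext E A. pair_in E g x y \<longrightarrow> y \<in> ext E S) \<longrightarrow>
      c ` covers r p \<subseteq> ext E S)" for g x0
  have cov: "sat UNIV E (Cover_fm 7 2) e \<longleftrightarrow> e 7 \<in> c ` covers r p" if "e 1 = R" "e 2 = c p" for e
    using cover_c[OF p(1), of "e 7"] that by (simp add: sat_Cover_fm)
  have sat: "sat UNIV E \<phi> e \<longleftrightarrow> \<Psi> (e 3) (e 4)" if e: "e 0 = A" "e 1 = R" "e 2 = c p" for e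
  proof -
    have "sat UNIV E \<phi> e \<longleftrightarrow> (e 4, A) \<in> E \<and>
      (\<forall>x y y'. pair_in E (e 3) x y \<and> pair_in E (e 3) x y' \<longrightarrow> y = y') \<and>
      (\<forall>S. (e 4, S) \<in> E \<and> (\<forall>x. (x, S) \<in> E \<longrightarrow> (\<forall>y. (y, A) \<in> E \<longrightarrow> pair_in E (e 3) x y \<longrightarrow> (y, S) \<in> E)) \<longrightarrow>
        (\<forall>y. y \<in> c ` covers r p \<longrightarrow> (y, S) \<in> E))"
      unfolding \<phi>_def using e by (simp add: sat_Pair_fm cov)
    also have "\<dots> \<longleftrightarrow> \<Psi> (e 3) (e 4)" unfolding \<Psi>_def ext_def by (simp add: subset_iff Ball_def)
    finally show ?thesis .
  qed
  have "\<Psi> g (G 0)"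
    unfolding \<Psi>_def
  proof (intro conjI allI impI GA)
    fix x y y' assume "pair_in E g x y \<and> pair_in E g x y'"
    then show "y = y'" using Ginj unfolding g by (auto dest: injD)
  next
    fix S assume S: "G 0 \<in> ext E S \<and> (\<forall>x\<in>ext E S. \<forall>y\<in>ext E A. pair_in E g x y \<longrightarrow> y \<in> ext E S)"
    have "G n \<in> ext E S" for n
    proof (induction n)
      case (Suc n) then show ?case using S GA g by blast
    qed (use S in simp)
    then show "c ` covers r p \<subseteq> ext E S" unfolding Gc[symmetric] by blast
  qed
  define e :: "nat \<Rightarrow> 'm" where "e = (\<lambda>_. A)(1 := R, 2 := c p)"
  have "sat UNIV E \<phi> (e(3 := g, 4 := G 0))" using \<open>\<Psi> g (G 0)\<close> by (subst sat) (auto simp: e_def)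
  moreover have "range e \<subseteq> N" using AN p by (auto simp: e_def)
  ultimately obtain e' where e': "\<forall>x. x \<notin> set [3, 4] \<longrightarrow> e' x = e x" "range e' \<subseteq> N" "sat UNIV E \<phi> e'"
    using elementary_witnesses[OF el, of e "[3, 4]" "e(3 := g, 4 := G 0)" \<phi>] by auto
  define g' where "g' = e' 3"
  define x0 where "x0 = e' 4"
  have in_N: "g' \<in> N" "x0 \<in> N" using e'(2) by (auto simp: g'_def x0_def)
  have \<Psi>: "\<Psi> g' x0" using e'(1,3) sat[of e'] by (simp add: e_def g'_def x0_def)
  \<comment> \<open>\<open>S\<close> is a set of the structure that need not belong to
    \<open>N\<close>. The quantifier over \<open>S\<close> in \<open>\<Psi>\<close> ranges over the
    whole structure, so it applies once \<open>N\<close> is closed under \<open>g'\<close>; this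
    holds because values of \<open>g'\<close> are unique.\<close>
  obtain S where S: "ext E S = ext E A \<inter> N" using subset_exists[of "ext E A \<inter> N" A] by blast
  have "y \<in> N" if xy: "x \<in> N" "pair_in E g' x y" for x y
  proof -
    define e2 :: "nat \<Rightarrow> 'm" where "e2 = (\<lambda>_. g')(5 := x)"
    have "sat UNIV E (Pair_fm 3 5 6) (e2(6 := y))" using xy(2) by (simp add: sat_Pair_fm e2_def)
    moreover have "range e2 \<subseteq> N" using in_N xy(1) by (auto simp: e2_def)
    ultimately obtain y' where "y' \<in> N" "sat UNIV E (Pair_fm 3 5 6) (e2(6 := y'))"
      using elementary_witness[OF el] by blast
    then have "y' \<in> N" "pair_in E g' x y'" by (simp_all add: sat_Pair_fm e2_def)
    then show ?thesis using \<Psi> xy(2) unfolding \<Psi>_def by blast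
  qed
  then have cl: "\<forall>x\<in>ext E S. \<forall>y\<in>ext E A. pair_in E g' x y \<longrightarrow> y \<in> ext E S" unfolding S by blast
  have "x0 \<in> ext E S" using \<Psi> in_N(2) unfolding \<Psi>_def S by simp
  then have "c ` covers r p \<subseteq> ext E S"
    using \<Psi>[unfolded \<Psi>_def, THEN conjunct2, THEN conjunct2, THEN spec, THEN mp, OF conjI, OF _ cl]
        by iprover
  then show ?thesis using y unfolding S by blast
qed

lemma C_in_submodel:
  assumes N: "submodel N" and p: "p \<in> Field r" "c p \<in> N" and J: "finite J"
  obtains ys where "set ys = C J p" "c ` set ys \<subseteq> N" "set ys \<subseteq> Field r"
proof -
  obtain ys where ys: "set ys = C J p" using finite_list[OF C_finite[OF J p(1)]] by blast
  moreover have "C J p \<subseteq> covers r p" by (rule C_covers[OF p(1)])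
  moreover have "covers r p \<subseteq> Field r" by (auto simp: covers_def intro: FieldI1)
  ultimately have "set ys \<subseteq> covers r p" "set ys \<subseteq> Field r" by auto
  moreover have "c ` covers r p \<subseteq> N" using covers_in_submodel[OF N p] by blast
  ultimately show ?thesis using that[of ys] ys by blast
qed

text \<open>The variables from 200 on hold the finitely many covers to be frozen, and further witnesses.\<close>

lemma reflect_frozen:
  assumes N: "submodel N" and p: "p \<in> Field r" "c p \<in> N" and J: "finite J" and a: "a \<in> N"
    and q: "frozen r (C J p) q p" and zs: "set zs \<subseteq> Field r"
    and sat: "\<And>e l. e 0 = A \<Longrightarrow> e 1 = R \<Longrightarrow> e 3 = c q \<Longrightarrow> e 4 = a \<Longrightarrow> 200 \<le> l \<Longrightarrow>
      (\<And>i. i < length zs \<Longrightarrow> e (l + i) = c (zs ! i)) \<Longrightarrow> sat UNIV E (\<phi> [l..<l + length zs]) e"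
  shows "\<exists>q' e l. frozen r (C J p) q' p \<and> c q' \<in> N \<and> e 0 = A \<and> e 1 = R \<and> e 3 = c q' \<and> e 4 = a \<and>
    range e \<subseteq> N \<and> 200 \<le> l \<and> sat UNIV E (\<phi> [l..<l + length zs]) e"
proof -
  have el: "elementary_submodel E N" and AN: "A \<in> N" "R \<in> N" using N by (auto simp: submodel_def)
  obtain ys where ys: "set ys = C J p" "c ` set ys \<subseteq> N" "set ys \<subseteq> Field r"
    using C_in_submodel[OF N p J] by blast
  \<comment> \<open>The covers occupy the variables from 200 to below \<open>k\<close>, and the
    witnesses \<open>zs\<close> start at \<open>k\<close>. Their position depends on the number of
    covers, hence the arbitrary start \<open>l\<close> in the hypothesis on
    \<open>\<phi>\<close>.\<close>
  define k where "k = 200 + length ys"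
  define e where "e v = (if v = 0 then A else if v = 1 then R else if v = 2 then c p else if v = 4
      then a
    else if 200 \<le> v \<and> v < k then c (ys ! (v - 200)) else A)" for v
  define e1 where "e1 v = (if v = 3 then c q else if k \<le> v \<and> v < k + length zs then c (zs ! (v -
      k)) else e v)" for v
  let ?xs = "3 # [k..<k + length zs]"
  let ?\<psi> = "Conj (Frozen_fm [200..<k] 3 2) (\<phi> [k..<k + length zs])"
  have qF: "q \<in> Field r" using q by (auto simp: frozen_def intro: FieldI1)
  have vars: "e' ` set [200..<k] = c ` C J p" if "\<And>v. 200 \<le> v \<Longrightarrow> v < k \<Longrightarrow> e' v = e v" for e'
  proof -
    have "e' (200 + i) = c (ys ! i)" if "i < length ys" for i
      using that \<open>\<And>v. 200 \<le> v \<Longrightarrow> v < k \<Longrightarrow> e' v = e v\<close>[of "200 + i"] by (simp add: e_def k_def)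
    moreover have "set [200..<k] = (\<lambda>i. 200 + i) ` {..<length ys}"
      by (auto simp: k_def image_iff) (metis le_add_diff_inverse less_diff_conv2 lessThan_iff
          add.commute)
    ultimately have "e' ` set [200..<k] = (\<lambda>i. c (ys ! i)) ` {..<length ys}"
      by (simp add: image_image)
    also have "\<dots> = c ` set ys" by (auto simp: set_conv_nth)
    finally show ?thesis using ys(1) by simp
  qed
  have frozen: "sat UNIV E (Frozen_fm [200..<k] 3 2) e' \<longleftrightarrow> (\<exists>q'. frozen r (C J p) q' p \<and> e' 3 = c q')"
    if e': "e' 1 = R" "e' 2 = c p" "\<And>v. 200 \<le> v \<Longrightarrow> v < k \<Longrightarrow> e' v = e v" for e'
  proof -
    have V: "e' ` set [200..<k] = c ` C J p" by (rule vars) (rule e'(3))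
    have "sat UNIV E (Frozen_fm [200..<k] 3 2) e' \<longleftrightarrow> pair_in E R (e' 3) (c p) \<and>
      (\<forall>y\<in>e' ` set [200..<k]. (\<exists>t. pair_in E R t (e' 3) \<and> pair_in E R t y) \<and> \<not> pair_in E R (e' 3) y)"
      using e'(1,2) by (subst sat_Frozen_fm) auto
    also have "\<dots> \<longleftrightarrow> (\<exists>q'. (q', p) \<in> r \<and> e' 3 = c q' \<and>
      (\<forall>y\<in>C J p. (\<exists>t. pair_in E R t (c q') \<and> pair_in E R t (c y)) \<and> \<not> pair_in E R (c q') (c y)))"
      unfolding V pair_in_R_left[OF p(1)] by auto
    also have "\<dots> \<longleftrightarrow> (\<exists>q'. frozen r (C J p) q' p \<and> e' 3 = c q')"
    proof -
      have "(\<exists>t. pair_in E R t (c q') \<and> pair_in E R t (c y)) = compatible r q' y"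
        "pair_in E R (c q') (c y) \<longleftrightarrow> (q', y) \<in> r" if "(q', p) \<in> r" "y \<in> C J p" for q' y
      proof -
        have F: "q' \<in> Field r" "y \<in> Field r" using that ys by (auto intro: FieldI1)
        show "(\<exists>t. pair_in E R t (c q') \<and> pair_in E R t (c y)) = compatible r q' y"
          by (rule compatible_c[OF F])
        show "pair_in E R (c q') (c y) \<longleftrightarrow> (q', y) \<in> r" by (rule pair_in_R_c[OF F])
      qed
      then show ?thesis unfolding frozen_def by blast
    qed
    finally show ?thesis .
  qed
  have "sat UNIV E ?\<psi> e1"
  proof -
    have "sat UNIV E (Frozen_fm [200..<k] 3 2) e1"
      using q by (subst frozen) (auto simp: e1_def e_def k_def)
    moreover have "sat UNIV E (\<phi> [k..<k + length zs]) e1"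
      by (rule sat) (auto simp: e1_def e_def k_def)
    ultimately show ?thesis by simp
  qed
  moreover have "range e \<subseteq> N"
    using AN p a ys(2) by (auto simp: e_def k_def)
  moreover have "\<forall>x. x \<notin> set ?xs \<longrightarrow> e1 x = e x" by (auto simp: e1_def)
  ultimately obtain e' where e': "\<forall>x. x \<notin> set ?xs \<longrightarrow> e' x = e x" "range e' \<subseteq> N" "sat UNIV E ?\<psi> e'"
    using elementary_witnesses[OF el, of e ?xs e1 ?\<psi>] by blast
  have vals: "e' 0 = A" "e' 1 = R" "e' 2 = c p" "e' 4 = a" "\<And>v. 200 \<le> v \<Longrightarrow> v < k \<Longrightarrow> e' v = e v"
    using e'(1) by (auto simp: e_def k_def)
  then obtain q' where "frozen r (C J p) q' p" "e' 3 = c q'" using e'(3) frozen[of e'] by auto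
  moreover have "c q' \<in> N" using calculation(2) e'(2) by (metis rangeI subsetD)
  ultimately show ?thesis using vals e'(2,3) by (intro exI[of _ q'] exI[of _ e'] exI[of _ k])
      (auto simp: k_def)
qed

end

lemma generic_for_mono:
  assumes "\<And>s q p. (s, q) \<in> r \<Longrightarrow> (q, p) \<in> r \<Longrightarrow> (s, p) \<in> r"
  shows "generic_for E c r N p \<Longrightarrow> (q, p) \<in> r \<Longrightarrow> generic_for E c r N q"
  using assms unfolding generic_for_def by meson

section \<open>Genericity for one model and along sequences of models\<close>

context forcing_model
begin

lemma frozen_le: "frozen r Y q p \<Longrightarrow> (q, p) \<in> r"
  by (simp add: frozen_def)

text \<open>A fusion through conditions coded in \<open>N\<close> treats the dense sets of
  \<open>N\<close> one after another. The condition and the predense set given by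
  \<open>one_step\<close> may lie outside \<open>N\<close>; as the set is finite, their existence is
  a first-order statement with parameters in \<open>N\<close> and reflects.\<close>

lemma properness:
  assumes N: "submodel N" and cnt: "countable N" and p: "p \<in> Field r" "c p \<in> N" and J: "finite J"
  shows "\<exists>q. frozen r (C J p) q p \<and> generic_for E c r N q"
proof -
  define DD where "DD = {D \<in> N. \<exists>d. dense_in r d \<and> ext E D = c ` d}"
  \<comment> \<open>The whole forcing is a dense set in \<open>N\<close>, so the family to be
    enumerated is not empty.\<close>
  have "A \<in> DD"
    using N ext_A refl by (auto simp: DD_def submodel_def dense_in_def intro!: exI[of _ "Field r"])
  then have ne: "DD \<noteq> {}" by blast
  have "countable DD" using cnt by (rule countable_subset[rotated]) (auto simp: DD_def)
  then have rD: "range (from_nat_into DD) = DD" using ne by (rule range_from_nat_into[rotated])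
  define X where "X = {p \<in> Field r. c p \<in> N}"
  \<comment> \<open>\<open>D'\<close> has to consist of conditions coded in \<open>N\<close>,
    because genericity asks for compatible elements of the dense set inside
    \<open>N\<close>.\<close>
  define E' where "E' k = {q. \<exists>D'\<subseteq>X. finite D' \<and> c ` D' \<subseteq> ext E (from_nat_into DD k) \<and>
    (\<forall>q'. (q', q) \<in> r \<longrightarrow> (\<exists>d\<in>D'. compatible r d q'))}" for k
  have "\<exists>q. frozen r (C J p) q p \<and> (\<forall>k. \<exists>s\<in>X \<inter> E' k. (q, s) \<in> r)"
  proof (rule limit)
    show "X \<subseteq> Field r" by (auto simp: X_def)
    show "p \<in> X" using p by (simp add: X_def)
    show "finite J" by (rule J)
    fix k p and J :: "'j set"
    assume pX: "p \<in> X" and J: "finite J"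
    then have p: "p \<in> Field r" "c p \<in> N" by (auto simp: X_def)
    define D where "D = from_nat_into DD k"
    have "D \<in> DD" using rD by (auto simp: D_def)
    then obtain d where d: "D \<in> N" "dense_in r d" "ext E D = c ` d" by (auto simp: DD_def)
    have dF: "d \<subseteq> Field r" using d by (simp add: dense_in_def)
    obtain q D' where q: "frozen r (C J p) q p" "D' \<subseteq> d" "finite D'"
      "\<And>q'. (q', q) \<in> r \<Longrightarrow> \<exists>d\<in>D'. compatible r d q'"
      using one_step[OF p(1) J] d(2) by blast
    obtain zs where zs: "set zs = D'" using finite_list[OF q(3)] by blast
    let ?\<phi> = "\<lambda>vs. Conj (Conjs (map (\<lambda>v. Mem v 4) vs)) (Predense_fm vs 3)"
    have pd: "sat UNIV E (Predense_fm [l..<l + n] 3) e \<longleftrightarrow>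
        (\<forall>q'. (q', q) \<in> r \<longrightarrow> (\<exists>v\<in>{l..<l + n}. compatible r (s v) q'))"
      if "e 1 = R" "e 3 = c q" "q \<in> Field r" "200 \<le> l"
        "\<And>v. v \<in> {l..<l + n} \<Longrightarrow> e v = c (s v) \<and> s v \<in> Field r" for e l n s q
    proof -
      have "sat UNIV E (Predense_fm [l..<l + n] 3) e \<longleftrightarrow> (\<forall>q'. pair_in E R q' (c q) \<longrightarrow>
        (\<exists>v\<in>{l..<l + n}. \<exists>t. pair_in E R t (e v) \<and> pair_in E R t q'))"
        using that by (subst sat_Predense_fm) auto
      also have "\<dots> \<longleftrightarrow> (\<forall>q'. (q', q) \<in> r \<longrightarrow>
        (\<exists>v\<in>{l..<l + n}. \<exists>t. pair_in E R t (c (s v)) \<and> pair_in E R t (c q')))"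
        using that(5) unfolding pair_in_R_left[OF that(3)] by (metis (no_types, lifting))
      also have "\<dots> \<longleftrightarrow> (\<forall>q'. (q', q) \<in> r \<longrightarrow> (\<exists>v\<in>{l..<l + n}. compatible r (s v) q'))"
        using compatible_c that(5) by (metis FieldI1)
      finally show ?thesis .
    qed
    have "\<exists>q' e l. frozen r (C J p) q' p \<and> c q' \<in> N \<and> e 0 = A \<and> e 1 = R \<and> e 3 = c q' \<and> e 4 = D \<and>
        range e \<subseteq> N \<and> 200 \<le> l \<and> sat UNIV E (?\<phi> [l..<l + length zs]) e"
    proof (rule reflect_frozen[OF N p J d(1) q(1)])
      show "set zs \<subseteq> Field r" using zs q(2) dF by simp
      fix e :: "nat \<Rightarrow> 'm" and l
      assume e: "e 0 = A" "e 1 = R" "e 3 = c q" "e 4 = D" "200 \<le> l"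
        "\<And>i. i < length zs \<Longrightarrow> e (l + i) = c (zs ! i)"
      have ev: "e v = c (zs ! (v - l)) \<and> zs ! (v - l) \<in> D'" if "v \<in> {l..<l + length zs}" for v
        using e(6)[of "v - l"] that zs by (auto simp: less_diff_conv2)
      have "sat UNIV E (Predense_fm [l..<l + length zs] 3) e"
      proof (subst pd[OF e(2,3) _ e(5), of _ "\<lambda>v. zs ! (v - l)"])
        show "q \<in> Field r" using q(1) by (auto simp: frozen_def intro: FieldI1)
        show "e v = c (zs ! (v - l)) \<and> zs ! (v - l) \<in> Field r" if "v \<in> {l..<l + length zs}" for v
          using ev[OF that] q(2) dF by blast
        show "\<forall>q'. (q', q) \<in> r \<longrightarrow> (\<exists>v\<in>{l..<l + length zs}. compatible r (zs ! (v - l)) q')"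
        proof (intro allI impI)
          fix q' assume "(q', q) \<in> r"
          then obtain b where "b \<in> set zs" "compatible r b q'" using q(4) zs by blast
          then obtain i where "i < length zs" "compatible r (zs ! i) q'" by (auto simp: in_set_conv_nth)
          then show "\<exists>v\<in>{l..<l + length zs}. compatible r (zs ! (v - l)) q'"
            by (intro bexI[of _ "l + i"]) auto
        qed
      qed
      moreover have "(e v, D) \<in> E" if "v \<in> {l..<l + length zs}" for v
      proof -
        have "c (zs ! (v - l)) \<in> ext E D" using ev[OF that] q(2) d(3) by blast
        then show ?thesis using ev[OF that] by (simp add: ext_def)
      qed
      ultimately show "sat UNIV E (?\<phi> [l..<l + length zs]) e" using e(4) by simp
    qed
    then obtain q' e l where q': "frozen r (C J p) q' p" "c q' \<in> N" "e 0 = A" "e 1 = R" "e 3 = c q'"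
      "e 4 = D" "range e \<subseteq> N" "200 \<le> l" "sat UNIV E (?\<phi> [l..<l + length zs]) e" by blast
    have q'F: "q' \<in> Field r" using q'(1) by (auto simp: frozen_def intro: FieldI1)
    have "\<forall>v\<in>{l..<l + length zs}. e v \<in> c ` d"
      using q'(6,9) d(3) by (auto simp: ext_def)
    then obtain s where s: "\<And>v. v \<in> {l..<l + length zs} \<Longrightarrow> e v = c (s v) \<and> s v \<in> d"
      unfolding image_iff by metis
    have pr: "\<forall>s'. (s', q') \<in> r \<longrightarrow> (\<exists>v\<in>{l..<l + length zs}. compatible r (s v) s')"
      using q'(9) s dF by (subst pd[symmetric, OF q'(4,5) q'F q'(8)]) auto
    have "q' \<in> E' k"
      unfolding E'_def
    proof (intro CollectI exI[of _ "s ` {l..<l + length zs}"] conjI)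
      show "s ` {l..<l + length zs} \<subseteq> X"
      proof
        fix b assume "b \<in> s ` {l..<l + length zs}"
        then obtain v where "v \<in> {l..<l + length zs}" "b = s v" by blast
        then have "b \<in> d" "c b = e v" using s[of v] by simp_all
        then show "b \<in> X" using dF q'(7) by (auto simp: X_def)
      qed
      have "c ` s ` {l..<l + length zs} \<subseteq> c ` d" using s by blast
      then show "c ` s ` {l..<l + length zs} \<subseteq> ext E (from_nat_into DD k)"
        using d(3) by (simp add: D_def)
    qed (use pr in auto)
    moreover have "q' \<in> X" using q'(2) q'F by (simp add: X_def)
    ultimately show "\<exists>q\<in>X \<inter> E' k. frozen r (C J p) q p" using q'(1) by blast
  qed
  then obtain q where q: "frozen r (C J p) q p" "\<And>k. \<exists>s\<in>X \<inter> E' k. (q, s) \<in> r" by blast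
  have "generic_for E c r N q"
    unfolding generic_for_def
  proof (intro allI impI)
    fix D d q' assume D: "D \<in> N \<and> dense_in r d \<and> ext E D = c ` d" and q': "(q', q) \<in> r"
    then have "D \<in> DD" by (auto simp: DD_def)
    then obtain k where k: "D = from_nat_into DD k" using rD by blast
    obtain s where s: "s \<in> E' k" "(q, s) \<in> r" using q(2) by blast
    then obtain D' where D': "D' \<subseteq> X" "c ` D' \<subseteq> c ` d" "\<And>q'. (q', s) \<in> r \<Longrightarrow> \<exists>d\<in>D'. compatible r d q'"
      using D k by (auto simp: E'_def)
    then obtain b where b: "b \<in> D'" "compatible r b q'" using trans[OF q' s(2)] by blast
    then obtain b' where "b' \<in> d" "c b = c b'" using D'(2) by blast
    moreover have "b \<in> Field r" "d \<subseteq> Field r" "c b \<in> N" using b D'(1) D by (auto simp: X_def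
        dense_in_def)
    ultimately have "b \<in> d" using c_inj by (metis inj_onD subsetD)
    then show "\<exists>p\<in>d. c p \<in> N \<and> compatible r p q'" using b(2) \<open>c b \<in> N\<close> by blast
  qed
  then show ?thesis using q(1) by blast
qed

text \<open>\<open>Generic_fm\<close> speaks of sets of codes and \<open>generic_for\<close> of sets
  of conditions; by injectivity of \<open>c\<close> each subset of \<open>A\<close> in the structure
  corresponds to exactly one set of conditions.\<close>

lemma generic_sat:
  assumes e: "e 0 = A" "e 1 = R" "e 3 = c q" "e 112 = v" and q: "q \<in> Field r"
  shows "sat UNIV E (Generic_fm 112 3) e \<longleftrightarrow> generic_for E c r (ext E v) q"
proof -
  define P where "P B \<longleftrightarrow> (\<forall>q'. (q', q) \<in> r \<longrightarrow> (\<exists>b\<in>B. c b \<in> ext E v \<and> compatible r b q'))" for B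
  have "sat UNIV E (Generic_fm 112 3) e \<longleftrightarrow> (\<forall>D\<in>ext E v. ext E D \<subseteq> ext E A \<and>
    (\<forall>p\<in>ext E A. \<exists>b\<in>ext E D. pair_in E R b p) \<longrightarrow>
    (\<forall>q'. pair_in E R q' (c q) \<longrightarrow> (\<exists>b\<in>ext E D. b \<in> ext E v \<and>
      (\<exists>t. pair_in E R t b \<and> pair_in E R t q'))))" (is "_ \<longleftrightarrow> (\<forall>D\<in>ext E v. ?\<Phi> D)")
    using e by (simp add: sat_Generic_fm ext_def)
  also have "\<dots> \<longleftrightarrow> (\<forall>D\<in>ext E v. \<forall>d. dense_in r d \<and> ext E D = c ` d \<longrightarrow> P d)"
  proof -
    have dn: "dense_in r d \<longleftrightarrow> (\<forall>p\<in>ext E A. \<exists>b\<in>c ` d. pair_in E R b p)" if "d \<subseteq> Field r" for d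
    proof -
      have "(\<exists>b\<in>c ` d. pair_in E R b (c p)) \<longleftrightarrow> (\<exists>b\<in>d. (b, p) \<in> r)" if "p \<in> Field r" for p
        using that \<open>d \<subseteq> Field r\<close> pair_in_R_c by blast
      then show ?thesis using that unfolding dense_in_def ext_A by blast
    qed
    have P: "P d \<longleftrightarrow> (\<forall>q'. pair_in E R q' (c q) \<longrightarrow> (\<exists>b\<in>c ` d. b \<in> ext E v \<and>
      (\<exists>t. pair_in E R t b \<and> pair_in E R t q')))" if d: "d \<subseteq> Field r" for d
    proof -
      have "(\<exists>t. pair_in E R t (c b) \<and> pair_in E R t (c q')) \<longleftrightarrow> compatible r b q'"
        if "b \<in> d" "(q', q) \<in> r" for b q'
        using that d compatible_c[of b q'] by (blast intro: FieldI1)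
      then show ?thesis unfolding P_def pair_in_R_left[OF q] by (auto simp: bex_simps) blast+
    qed
    have "?\<Phi> D \<longleftrightarrow> (\<forall>d. dense_in r d \<and> ext E D = c ` d \<longrightarrow> P d)" for D
    proof
      assume \<Phi>: "?\<Phi> D"
      show "\<forall>d. dense_in r d \<and> ext E D = c ` d \<longrightarrow> P d"
      proof (intro allI impI)
        fix d assume d: "dense_in r d \<and> ext E D = c ` d"
        then have dF: "d \<subseteq> Field r" by (simp add: dense_in_def)
        show "P d" using \<Phi> d dn[OF dF] P[OF dF] dF ext_A by auto
      qed
    next
      assume R: "\<forall>d. dense_in r d \<and> ext E D = c ` d \<longrightarrow> P d"
      show "?\<Phi> D"
      proof (rule impI)
        assume *: "ext E D \<subseteq> ext E A \<and> (\<forall>p\<in>ext E A. \<exists>b\<in>ext E D. pair_in E R b p)"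
        define d where "d = {p \<in> Field r. c p \<in> ext E D}"
        have d: "d \<subseteq> Field r" "ext E D = c ` d" using * ext_A by (auto simp: d_def)
        then have "P d" using R dn[OF d(1)] * by auto
        then show "\<forall>q'. pair_in E R q' (c q) \<longrightarrow> (\<exists>b\<in>ext E D. b \<in> ext E v \<and>
          (\<exists>t. pair_in E R t b \<and> pair_in E R t q'))" using P[OF d(1)] d(2) by simp
      qed
    qed
    then show ?thesis by simp
  qed
  also have "\<dots> \<longleftrightarrow> generic_for E c r (ext E v) q"
    unfolding generic_for_def P_def by blast
  finally show ?thesis .
qed

text \<open>Because the sequence \<open>s\<close> is an element of \<open>N\<close>, genericity for
  all its members is expressible with a parameter from \<open>N\<close>. A condition found outside
  \<open>N\<close> can thus be exchanged for one in \<open>N\<close> that freezes the same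
  covers.\<close>

lemma reflect_generic:
  assumes N: "submodel N" and p: "p \<in> Field r" "c p \<in> N" and J: "finite J"
    and s: "s \<in> N" "sequence_in E Nf \<eta> s"
    and q: "frozen r (C J p) q p" "\<And>\<xi>. \<xi> \<in> insert \<eta> (ext E \<eta>) \<Longrightarrow> generic_for E c r (Nf \<xi>) q"
  shows "\<exists>q. frozen r (C J p) q p \<and> c q \<in> N \<and> (\<forall>\<xi>\<in>insert \<eta> (ext E \<eta>). generic_for E c r (Nf \<xi>) q)"
proof -
  obtain v where v: "\<And>\<xi>. \<xi> \<in> insert \<eta> (ext E \<eta>) \<Longrightarrow> ext E (v \<xi>) = Nf \<xi>"
    "ext E s = {w. \<exists>\<xi>\<in>insert \<eta> (ext E \<eta>). opair_in E w \<xi> (v \<xi>)}"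
    using s(2) unfolding sequence_in_def by blast
  have sat: "sat UNIV E (Generics_fm 4 3) e \<longleftrightarrow> (\<forall>\<xi>\<in>insert \<eta> (ext E \<eta>). generic_for E c r (Nf \<xi>) q)"
    if e: "e 0 = A" "e 1 = R" "e 3 = c q" "e 4 = s" and q: "q \<in> Field r" for e q
  proof -
    have "sat UNIV E (Generics_fm 4 3) e \<longleftrightarrow> (\<forall>w \<xi> v. (w, s) \<in> E \<and> opair_in E w \<xi> v \<longrightarrow>
        generic_for E c r (ext E v) q)"
      using e generic_sat[OF _ _ _ _ q, of "e(112 := _)"] by (simp add: sat_Generics_fm)
    also have "\<dots> \<longleftrightarrow> (\<forall>\<xi>\<in>insert \<eta> (ext E \<eta>). generic_for E c r (Nf \<xi>) q)"
    proof
      assume L: "\<forall>w \<xi> v. (w, s) \<in> E \<and> opair_in E w \<xi> v \<longrightarrow> generic_for E c r (ext E v) q"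
      show "\<forall>\<xi>\<in>insert \<eta> (ext E \<eta>). generic_for E c r (Nf \<xi>) q"
      proof
        fix \<xi> assume \<xi>: "\<xi> \<in> insert \<eta> (ext E \<eta>)"
        obtain w where w: "opair_in E w \<xi> (v \<xi>)" using opair_exists by blast
        then have "w \<in> ext E s" unfolding v(2) using \<xi> by blast
        then have "generic_for E c r (ext E (v \<xi>)) q" using L w by (simp add: ext_def)
        then show "generic_for E c r (Nf \<xi>) q" by (simp add: v(1)[OF \<xi>])
      qed
    next
      assume Rt: "\<forall>\<xi>\<in>insert \<eta> (ext E \<eta>). generic_for E c r (Nf \<xi>) q"
      show "\<forall>w \<xi> v. (w, s) \<in> E \<and> opair_in E w \<xi> v \<longrightarrow> generic_for E c r (ext E v) q"
      proof (intro allI impI)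
        fix w \<xi> u assume w: "(w, s) \<in> E \<and> opair_in E w \<xi> u"
        then have "w \<in> ext E s" by (simp add: ext_def)
        then obtain \<xi>' where \<xi>': "\<xi>' \<in> insert \<eta> (ext E \<eta>)" "opair_in E w \<xi>' (v \<xi>')" unfolding v(2)
            by blast
        then have "u = v \<xi>'" using w opair_in_inject by blast
        moreover have "generic_for E c r (Nf \<xi>') q" using Rt \<xi>'(1) by blast
        ultimately show "generic_for E c r (ext E u) q" by (simp add: v(1)[OF \<xi>'(1)])
      qed
    qed
    finally show ?thesis .
  qed
  have qF: "q \<in> Field r" using q(1) by (auto simp: frozen_def intro: FieldI1)
  have "\<exists>q' e l. frozen r (C J p) q' p \<and> c q' \<in> N \<and> e 0 = A \<and> e 1 = R \<and> e 3 = c q' \<and> e 4 = s \<and>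
    range e \<subseteq> N \<and> 200 \<le> l \<and> sat UNIV E ((\<lambda>_. Generics_fm 4 3) [l..<l + length ([] :: 'p list)]) e"
    by (rule reflect_frozen[OF N p J s(1) q(1), where zs = "[]"]) (use sat qF q(2) in auto)
  then obtain q' e where q': "frozen r (C J p) q' p" "c q' \<in> N" "e 0 = A" "e 1 = R" "e 3 = c q'"
      "e 4 = s"
    "sat UNIV E (Generics_fm 4 3) e" by blast
  moreover have "q' \<in> Field r" using q'(1) by (auto simp: frozen_def intro: FieldI1)
  ultimately show ?thesis using sat by blast
qed

text \<open>The start \<open>\<delta>\<close> is arbitrary, since the fusion at a limit continues
  from conditions that already lie in intermediate models and are generic for the models before
  them. The set \<open>J\<close> is kept frozen so that the result can serve as a stage of such a
  fusion.\<close>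

lemma generic_along_sequence:
  assumes ord: "ordinal_in E a"
    and lin: "\<And>x y. x \<in> ext E a \<Longrightarrow> y \<in> ext E a \<Longrightarrow> (x, y) \<in> E \<or> x = y \<or> (y, x) \<in> E"
    and cnt: "countable (ext E a)"
    and seq: "model_sequence E a z Nf" and sub0: "\<And>\<xi>. \<xi> \<in> insert a (ext E a) \<Longrightarrow> submodel (Nf \<xi>)"
  shows "\<beta> \<in> insert a (ext E a) \<Longrightarrow> \<delta> \<in> insert \<beta> (ext E \<beta>) \<Longrightarrow> p \<in> Field r \<Longrightarrow> c p \<in> Nf \<delta> \<Longrightarrow>
    \<forall>\<xi>\<in>ext E \<delta>. generic_for E c r (Nf \<xi>) p \<Longrightarrow> finite J \<Longrightarrow>
    \<exists>q. frozen r (C J p) q p \<and> (\<forall>\<xi>\<in>insert \<beta> (ext E \<beta>). generic_for E c r (Nf \<xi>) q)"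
proof (induction \<beta> arbitrary: \<delta> p J rule: wf_induct_rule[OF wf_E])
  case (1 \<beta>)
  note IH = "1.IH" and \<beta> = "1.prems"(1) and \<delta> = "1.prems"(2) and p = "1.prems"(3,4) and gp =
      "1.prems"(5) and J = "1.prems"(6)
  have mono: "ext E x \<subseteq> ext E a" if "x \<in> insert a (ext E a)" for x
    using ord that by (auto simp: ordinal_in_def)
  have tr: "ext E y \<subseteq> ext E x" if "x \<in> insert a (ext E a)" "y \<in> ext E x" for x y
    using ord that unfolding ordinal_in_def by blast
  have sub\<beta>: "submodel (Nf \<beta>)" by (rule sub0[OF \<beta>])
  have cnt\<beta>: "countable (Nf \<beta>)" using seq \<beta> by (auto simp: model_sequence_def)
  have inc: "Nf y \<subseteq> Nf x" if "x \<in> insert a (ext E a)" "y \<in> ext E x" for x y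
    using seq that unfolding model_sequence_def by blast
  have gmono: "generic_for E c r N q" if "generic_for E c r N q'" "(q, q') \<in> r" for N q q'
    using generic_for_mono[of r E c N q' q] trans that by blast
  have succ: "\<exists>s\<in>Nf \<zeta>. sequence_in E Nf \<eta> s" if "\<eta> \<in> ext E a" "succ_in E \<eta> \<zeta>" for \<eta> \<zeta>
    using seq that unfolding model_sequence_def by blast
  show ?case
  proof (cases "\<delta> = \<beta>")
    case True
    then obtain q where q: "frozen r (C J p) q p" "generic_for E c r (Nf \<beta>) q"
      using properness[OF sub\<beta> cnt\<beta> p(1) _ J] p(2) by blast
    then show ?thesis using gp True gmono[OF _ frozen_le] by blast
  next
    case False
    then have \<delta>\<beta>: "\<delta> \<in> ext E \<beta>" using \<delta> by blast
    show ?thesis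
    proof (cases "limit_in E \<beta>")
      case True
      \<comment> \<open>The stages are conditions lying in some earlier model and generic for all
        models before it; the \<open>k\<close>-th demand is genericity for the \<open>k\<close>-th
        model in an enumeration of the indices below \<open>\<beta>\<close>.\<close>
      define X where "X = {p \<in> Field r. \<exists>\<zeta>\<in>ext E \<beta>. c p \<in> Nf \<zeta> \<and> (\<forall>\<xi>\<in>ext E \<zeta>. generic_for E c r
          (Nf \<xi>) p)}"
      have c\<beta>: "countable (ext E \<beta>)" using cnt mono[OF \<beta>] countable_subset by blast
      define E' where "E' k = {q. generic_for E c r (Nf (from_nat_into (ext E \<beta>) k)) q}" for k
      have "\<exists>q. frozen r (C J p) q p \<and> (\<forall>k. \<exists>s\<in>X \<inter> E' k. (q, s) \<in> r)"
      proof (rule limit)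
        show "X \<subseteq> Field r" by (auto simp: X_def)
        show "p \<in> X" using p \<delta>\<beta> gp by (auto simp: X_def)
        show "finite J" by (rule J)
        fix k p and J :: "'j set" assume pX: "p \<in> X" and J: "finite J"
        then obtain \<zeta> where \<zeta>: "p \<in> Field r" "\<zeta> \<in> ext E \<beta>" "c p \<in> Nf \<zeta>" "\<forall>\<xi>\<in>ext E \<zeta>. generic_for E
            c r (Nf \<xi>) p"
          by (auto simp: X_def)
        define \<xi> where "\<xi> = from_nat_into (ext E \<beta>) k"
        have \<xi>: "\<xi> \<in> ext E \<beta>" unfolding \<xi>_def using \<delta>\<beta> by (intro from_nat_into) blast
        \<comment> \<open>\<open>\<eta>\<close> is the larger of the index \<open>\<zeta>\<close>
          where \<open>p\<close> lives and the index \<open>\<xi>\<close> demanded at this stage.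
          The stage ends in the model after \<open>\<eta>\<close>, which contains the sequence up to
          \<open>\<eta>\<close>.\<close>
        obtain \<eta> where \<eta>: "\<eta> \<in> ext E \<beta>" "\<zeta> \<in> insert \<eta> (ext E \<eta>)" "\<xi> \<in> insert \<eta> (ext E \<eta>)"
          using lin[of \<zeta> \<xi>] mono[OF \<beta>] \<zeta>(2) \<xi> that[of \<zeta>] that[of \<xi>] unfolding ext_def by blast
        have \<eta>a: "\<eta> \<in> ext E a" using mono[OF \<beta>] \<eta>(1) by blast
        \<comment> \<open>The successor of \<open>\<eta>\<close> is obtained as an
          \<open>E\<close>-minimal element of \<open>\<beta>\<close> above \<open>\<eta>\<close>;
          some element lies above \<open>\<eta>\<close> since \<open>\<beta>\<close> is a
          limit.\<close>
        obtain \<eta>0 where "\<eta>0 \<in> {y \<in> ext E \<beta>. (\<eta>, y) \<in> E}" using True \<eta>(1) by (auto simp: limit_in_def)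
        then obtain \<eta>' where "\<eta>' \<in> {y \<in> ext E \<beta>. (\<eta>, y) \<in> E}"
          and min: "\<And>y. (y, \<eta>') \<in> E \<Longrightarrow> y \<notin> {y \<in> ext E \<beta>. (\<eta>, y) \<in> E}"
          using wf_E[unfolded wf_eq_minimal, THEN spec, of "{y \<in> ext E \<beta>. (\<eta>, y) \<in> E}"] by blast
        then have \<eta>': "\<eta>' \<in> ext E \<beta>" "(\<eta>, \<eta>') \<in> E" by simp_all
        have \<eta>'a: "\<eta>' \<in> insert a (ext E a)" using mono[OF \<beta>] \<eta>'(1) by blast
        have "x \<in> insert \<eta> (ext E \<eta>)" if "x \<in> ext E \<eta>'" for x
        proof -
          have x: "x \<in> ext E \<beta>" using tr[OF \<beta> \<eta>'(1)] that by blast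
          then have "(\<eta>, x) \<notin> E" using min[of x] that by (auto simp: ext_def)
          then show ?thesis using lin[of x \<eta>] x mono[OF \<beta>] \<eta>(1) by (auto simp: ext_def)
        qed
        moreover have "insert \<eta> (ext E \<eta>) \<subseteq> ext E \<eta>'" using tr[OF \<eta>'a, of \<eta>] \<eta>'(2) by (auto simp:
            ext_def)
        ultimately have "succ_in E \<eta> \<eta>'" by (auto simp: succ_in_def)
        then obtain s where s: "s \<in> Nf \<eta>'" "sequence_in E Nf \<eta> s" using succ \<eta>a by blast
        have "(\<eta>, \<beta>) \<in> E" using \<eta>(1) by (simp add: ext_def)
        then obtain q where q: "frozen r (C J p) q p" "\<forall>\<xi>\<in>insert \<eta> (ext E \<eta>). generic_for E c r
            (Nf \<xi>) q"
          using IH[of \<eta> \<zeta> p J] \<eta>a \<eta>(2) \<zeta> J by blast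
        have "c p \<in> Nf \<eta>'"
        proof -
          have "\<zeta> \<in> ext E \<eta>'" using \<eta>(2) \<open>insert \<eta> (ext E \<eta>) \<subseteq> ext E \<eta>'\<close> by blast
          then show ?thesis using inc[OF \<eta>'a] \<zeta>(3) by blast
        qed
        then obtain q' where q': "frozen r (C J p) q' p" "c q' \<in> Nf \<eta>'"
          "\<forall>\<xi>\<in>insert \<eta> (ext E \<eta>). generic_for E c r (Nf \<xi>) q'"
          using reflect_generic[OF sub0[OF \<eta>'a] \<zeta>(1) _ J s q(1)] q(2) by blast
        have "q' \<in> Field r" using q'(1) by (auto simp: frozen_def intro: FieldI1)
        moreover have "\<forall>\<xi>\<in>ext E \<eta>'. generic_for E c r (Nf \<xi>) q'"
          using q'(3) \<open>succ_in E \<eta> \<eta>'\<close> by (simp add: succ_in_def)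
        ultimately have "q' \<in> X" using q'(2) \<eta>'(1) by (auto simp: X_def)
        moreover have "q' \<in> E' k" using q'(3) \<eta>(3) by (auto simp: E'_def \<xi>_def)
        ultimately show "\<exists>q\<in>X \<inter> E' k. frozen r (C J p) q p" using q'(1) by blast
      qed
      then obtain q where q: "frozen r (C J p) q p" "\<And>k. \<exists>s\<in>X \<inter> E' k. (q, s) \<in> r" by blast
      have below: "generic_for E c r (Nf \<xi>) q" if "\<xi> \<in> ext E \<beta>" for \<xi>
      proof -
        obtain k where "\<xi> = from_nat_into (ext E \<beta>) k"
          using from_nat_into_surj[OF c\<beta> \<open>\<xi> \<in> ext E \<beta>\<close>] by metis
        then show ?thesis using q(2)[of k] gmono by (auto simp: E'_def)
      qed
      have U: "Nf \<beta> = (\<Union>\<zeta>\<in>ext E \<beta>. Nf \<zeta>)" using seq \<beta> True unfolding model_sequence_def by blast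
      \<comment> \<open>A dense set in the union belongs to an earlier model, for which
        \<open>q\<close> is already generic.\<close>
      have "generic_for E c r (Nf \<beta>) q"
        unfolding generic_for_def
      proof (intro allI impI)
        fix D d q' assume D: "D \<in> Nf \<beta> \<and> dense_in r d \<and> ext E D = c ` d" and q': "(q', q) \<in> r"
        then obtain \<zeta> where \<zeta>: "\<zeta> \<in> ext E \<beta>" "D \<in> Nf \<zeta>" using U by blast
        then obtain p where "p \<in> d" "c p \<in> Nf \<zeta>" "compatible r p q'"
          using below[OF \<zeta>(1)] D q' unfolding generic_for_def by blast
        then show "\<exists>p\<in>d. c p \<in> Nf \<beta> \<and> compatible r p q'" using inc[OF \<beta> \<zeta>(1)] by blast
      qed
      then show ?thesis using q(1) below by blast
    next
      case False
      have "ordinal_in E \<beta>"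
        unfolding ordinal_in_def using tr[OF \<beta>] tr mono[OF \<beta>] by (meson insertI2 subsetD)
      then obtain \<eta> where \<eta>: "\<eta> \<in> ext E \<beta>" "\<And>y. y \<in> ext E \<beta> \<Longrightarrow> (\<eta>, y) \<notin> E"
        using False \<delta>\<beta> unfolding limit_in_def by blast
      have \<eta>a: "\<eta> \<in> ext E a" using \<eta>(1) mono[OF \<beta>] by blast
      have "ext E \<beta> \<subseteq> insert \<eta> (ext E \<eta>)"
      proof
        fix y assume y: "y \<in> ext E \<beta>"
        then have "(y, \<eta>) \<in> E \<or> y = \<eta>" using lin[of y \<eta>] \<eta> \<eta>a mono[OF \<beta>] by blast
        then show "y \<in> insert \<eta> (ext E \<eta>)" by (auto simp: ext_def)
      qed
      then have sc: "ext E \<beta> = insert \<eta> (ext E \<eta>)" using \<eta>(1) tr[OF \<beta> \<eta>(1)] by blast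
      then have "succ_in E \<eta> \<beta>" by (simp add: succ_in_def)
      then obtain s where s: "s \<in> Nf \<beta>" "sequence_in E Nf \<eta> s" using succ \<eta>a by blast
      have "(\<eta>, \<beta>) \<in> E" using \<eta>(1) by (simp add: ext_def)
      then obtain q where q: "frozen r (C J p) q p" "\<forall>\<xi>\<in>insert \<eta> (ext E \<eta>). generic_for E c r (Nf \<xi>) q"
        using IH[of \<eta> \<delta> p J] \<eta>a \<delta>\<beta> sc p gp J by blast
      \<comment> \<open>The condition from the induction hypothesis has to be moved into
        \<open>Nf \<beta>\<close> before properness can be applied to this last model.\<close>
      have "c p \<in> Nf \<beta>" using p(2) inc[OF \<beta> \<delta>\<beta>] by blast
      then obtain q' where q': "frozen r (C J p) q' p" "c q' \<in> Nf \<beta>"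
        "\<forall>\<xi>\<in>insert \<eta> (ext E \<eta>). generic_for E c r (Nf \<xi>) q'"
        using reflect_generic[OF sub\<beta> p(1) _ J s q(1)] q(2) by blast
      have "q' \<in> Field r" using q'(1) by (auto simp: frozen_def intro: FieldI1)
      then obtain q2 where q2: "frozen r (C J q') q2 q'" "generic_for E c r (Nf \<beta>) q2"
        using properness[OF sub\<beta> cnt\<beta> _ q'(2) J] by blast
      then have "frozen r (C J p) q2 p" using q'(1) frozen_trans by blast
      then show ?thesis using q2(2) q'(3) gmono[OF _ frozen_le[OF q2(1)]] unfolding sc by blast
    qed
  qed
qed

end

lemma (in fusion) alpha_proper: "alpha_proper TYPE('m) \<alpha> r"
  unfolding alpha_proper_def
proof (intro allI impI ballI)
  fix \<kappa> E :: "'m rel" and c z a Nf o0 q0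
  assume *: "H_structure \<kappa> E \<and> natLeq <o \<kappa> \<and> |Pow (Field r)| <o \<kappa> \<and>
      codes_forcing E c r z \<and> order_type_in E \<alpha> a \<and> model_sequence E a z Nf"
    and o0: "ext E o0 = {}" and q0: "q0 \<in> Field r" "c q0 \<in> Nf o0"
  then obtain A R where AR: "inj_on c (Field r)" "opair_in E z A R" "ext E A = c ` Field r"
    "ext E R = {w. \<exists>(p, q)\<in>r. opair_in E w (c p) (c q)}"
    unfolding codes_forcing_def by blast
  interpret forcing_model r C \<kappa> E c A R
    using * AR by unfold_locales auto
  have seq: "model_sequence E a z Nf" and ord: "ordinal_in E a" using * by (auto simp:
      order_type_in_def)
  let ?r = "{(x, y). x \<in> ext E a \<and> y \<in> ext E a \<and> ((x, y) \<in> E \<or> x = y)}"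
  have iso: "\<alpha> =o ?r" using * by (simp add: order_type_in_def)
  have F: "Field ?r = ext E a" by (auto simp: Field_def)
  have wo: "Well_order ?r" using iso by (simp add: ordIso_def)
  have lin: "(x, y) \<in> E \<or> x = y \<or> (y, x) \<in> E" if "x \<in> ext E a" "y \<in> ext E a" for x y
    using wo that F unfolding well_order_on_def linear_order_on_def total_on_def by blast
  obtain f where "bij_betw f (Field \<alpha>) (Field ?r)" using iso unfolding ordIso_def iso_def by blast
  then have cnt: "countable (ext E a)" unfolding F by (metis bij_betw_def countableI_type
      countable_image)
  have o0_le: "o0 \<in> insert \<xi> (ext E \<xi>)" if \<xi>: "\<xi> \<in> insert a (ext E a)" for \<xi>
  proof (cases "ext E \<xi> = {}")
    case True then show ?thesis using o0 ext_inj by auto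
  next
    case False
    then obtain m where m: "m \<in> ext E \<xi>" "\<And>y. (y, m) \<in> E \<Longrightarrow> y \<notin> ext E \<xi>"
      using wfE_min[OF wf_E, of _ "ext E \<xi>"] by blast
    have "ext E m \<subseteq> ext E \<xi>" using ord \<xi> m(1) unfolding ordinal_in_def by blast
    then have "ext E m = {}" using m(2) by (auto simp: ext_def)
    then have "m = o0" using o0 ext_inj by simp
    then show ?thesis using m(1) by simp
  qed
  have sub0: "submodel (Nf \<xi>)" if \<xi>: "\<xi> \<in> insert a (ext E a)" for \<xi>
  proof -
    have el: "elementary_submodel E (Nf \<xi>)" using seq \<xi> unfolding model_sequence_def by blast
    have "z \<in> Nf o0" using seq o0 unfolding model_sequence_def by blast
    moreover have "Nf \<zeta> \<subseteq> Nf \<xi>" if "\<zeta> \<in> ext E \<xi>" for \<zeta>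
      using seq \<xi> that unfolding model_sequence_def by blast
    ultimately have "z \<in> Nf \<xi>" using o0_le[OF \<xi>] by blast
    \<comment> \<open>Only \<open>z\<close> is given as an element of the models; its components
      \<open>A\<close> and \<open>R\<close> are determined by it and so belong to them as
      well.\<close>
    moreover have "sat UNIV E (OPair_fm 2 3 4) ((\<lambda>_. z)(3 := A, 4 := R))"
      using AR(2) by (simp add: sat_OPair_fm)
    ultimately obtain e where "\<forall>x. x \<notin> set [3, 4] \<longrightarrow> e x = z" "range e \<subseteq> Nf \<xi>"
      "sat UNIV E (OPair_fm 2 3 4) e"
      using elementary_witnesses[OF el, of "\<lambda>_. z" "[3, 4]" "(\<lambda>_. z)(3 := A, 4 := R)" "OPair_fm 2 3 4"]
      by auto
    then have "opair_in E z (e 3) (e 4)" "range e \<subseteq> Nf \<xi>" by (simp_all add: sat_OPair_fm)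
    then have "A = e 3" "R = e 4" "range e \<subseteq> Nf \<xi>" using opair_in_inject[OF AR(2)] by blast+
    then show ?thesis using el unfolding submodel_def by blast
  qed
  \<comment> \<open>The start is \<open>o0\<close>, below which there are no models, so no
    genericity of \<open>q0\<close> is required.\<close>
  obtain q where "frozen r (C {} q0) q q0" "\<forall>\<xi>\<in>insert a (ext E a). generic_for E c r (Nf \<xi>) q"
    using generic_along_sequence[OF ord lin cnt seq sub0 _ o0_le q0, of a "{}"] o0 by auto
  then show "\<exists>q. (q, q0) \<in> r \<and> (\<forall>\<xi>\<in>insert a (ext E a). generic_for E c r (Nf \<xi>) q)"
    using frozen_le by blast
qed

section \<open>Names for functions and the strong \<open>PP\<close>-property\<close>

context forcing
begin

definition forces_value :: "('i, 'p) name \<Rightarrow> 'p \<Rightarrow> nat \<Rightarrow> nat \<Rightarrow> bool" where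
  "forces_value f p i v \<longleftrightarrow> fmem (opair_name r (nat_name r i) (nat_name r v)) f p"

lemma forces_value_mono: "forces_value f p i v \<Longrightarrow> (q, p) \<in> r \<Longrightarrow> forces_value f q i v"
  unfolding forces_value_def by (rule fmem_mono)

lemma forces_function_iff:
  assumes "is_name r f"
  shows "forces_function r f p \<longleftrightarrow>
    (\<forall>\<tau> q. is_name r \<tau> \<longrightarrow> (q, p) \<in> r \<longrightarrow> fmem \<tau> f q \<longrightarrow>
      dense_below r {q. \<exists>\<sigma>. is_name r \<sigma> \<and> fmem \<sigma> (omega_name r) q \<and>
        dense_below r {q. \<exists>\<rho>. is_name r \<rho> \<and> fmem \<rho> (omega_name r) q \<and> feq \<tau> (opair_name r \<sigma> \<rho>) q}
            q} q) \<and>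
    (\<forall>\<sigma> q. is_name r \<sigma> \<longrightarrow> (q, p) \<in> r \<longrightarrow> fmem \<sigma> (omega_name r) q \<longrightarrow>
      dense_below r {q. \<exists>\<rho>. is_name r \<rho> \<and> fmem \<rho> (omega_name r) q \<and>
        dense_below r {q. \<exists>\<tau>. is_name r \<tau> \<and> fmem \<tau> f q \<and> feq \<tau> (opair_name r \<sigma> \<rho>) q} q \<and>
        (\<forall>\<rho>' q'. is_name r \<rho>' \<longrightarrow> (q', q) \<in> r \<longrightarrow> fmem \<rho>' (omega_name r) q' \<longrightarrow>
          (\<forall>s. (s, q') \<in> r \<longrightarrow>
            dense_below r {q. \<exists>\<tau>. is_name r \<tau> \<and> fmem \<tau> f q \<and> feq \<tau> (opair_name r \<sigma> \<rho>') q} s \<longrightarrow>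
            feq \<rho>' \<rho> s))} q)"
  using assms
  by (simp add: forces_function_def Function_fm_def forces_BAll forces_BEx forces_Imp forces_OPair_fm
      is_name_omega cong: conj_cong imp_cong)

lemma feq_opair_fmem:
  assumes "is_name r \<sigma>" "is_name r \<rho>"
  shows "dense_below r {q. \<exists>\<tau>. is_name r \<tau> \<and> fmem \<tau> f q \<and> feq \<tau> (opair_name r \<sigma> \<rho>) q} p \<longleftrightarrow>
    fmem (opair_name r \<sigma> \<rho>) f p"
proof
  assume "dense_below r {q. \<exists>\<tau>. is_name r \<tau> \<and> fmem \<tau> f q \<and> feq \<tau> (opair_name r \<sigma> \<rho>) q} p"
  then show "fmem (opair_name r \<sigma> \<rho>) f p"
    by (rule fmem_dense[OF dense_below_subset]) (auto intro: fmem_cong_left)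
next
  assume "fmem (opair_name r \<sigma> \<rho>) f p"
  show "dense_below r {q. \<exists>\<tau>. is_name r \<tau> \<and> fmem \<tau> f q \<and> feq \<tau> (opair_name r \<sigma> \<rho>) q} p"
  proof (intro dense_belowI2 CollectI exI[of _ "opair_name r \<sigma> \<rho>"] conjI feq_refl)
    show "is_name r (opair_name r \<sigma> \<rho>)" by (intro is_name_opair assms)
    show "fmem (opair_name r \<sigma> \<rho>) f q" if "(q, p) \<in> r" for q
      using fmem_mono[OF \<open>fmem (opair_name r \<sigma> \<rho>) f p\<close> that] .
  qed
qed

text \<open>This is needed to show that an element of the restriction of \<open>f\<close> to a
  number \<open>k\<close> is one of the pairs of a decided initial segment.\<close>

lemma function_pairs:
  assumes f: "is_name r f" "forces_function r f p" and \<tau>: "is_name r \<tau>" "fmem \<tau> f q" and q: "(q, p) \<in> r"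
  shows "\<exists>d a b. (d, q) \<in> r \<and> feq \<tau> (opair_name r (nat_name r a) (nat_name r b)) d"
proof -
  have "dense_below r {q. \<exists>\<sigma>. is_name r \<sigma> \<and> fmem \<sigma> (omega_name r) q \<and>
      dense_below r {q. \<exists>\<rho>. is_name r \<rho> \<and> fmem \<rho> (omega_name r) q \<and> feq \<tau> (opair_name r \<sigma> \<rho>) q} q} q"
    using f(2) \<tau> q unfolding forces_function_iff[OF f(1)] by blast
  from dense_belowD[OF this le_refl[OF q]] obtain d \<sigma> where d: "(d, q) \<in> r" "is_name r \<sigma>" "fmem \<sigma>
      (omega_name r) d"
    "dense_below r {q. \<exists>\<rho>. is_name r \<rho> \<and> fmem \<rho> (omega_name r) q \<and> feq \<tau> (opair_name r \<sigma> \<rho>) q} d"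
        by blast
  obtain d2 \<rho> where d2: "(d2, d) \<in> r" "is_name r \<rho>" "fmem \<rho> (omega_name r) d2" "feq \<tau> (opair_name
      r \<sigma> \<rho>) d2"
    using dense_belowD[OF d(4) le_refl[OF d(1)]] by blast
  obtain d3 a where d3: "(d3, d2) \<in> r" "feq \<sigma> (nat_name r a) d3"
    using dense_belowD[OF fmem_mono[OF d(3) d2(1), unfolded fmem_omega] le_refl[OF d2(1)]] by blast
  obtain d4 b where d4: "(d4, d3) \<in> r" "feq \<rho> (nat_name r b) d4"
    using dense_belowD[OF fmem_mono[OF d2(3) d3(1), unfolded fmem_omega] le_refl[OF d3(1)]] by blast
  have "(d4, d2) \<in> r" using trans[OF d4(1) d3(1)] .
  moreover have "feq (opair_name r \<sigma> \<rho>) (opair_name r (nat_name r a) (nat_name r b)) d4"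
    by (rule opair_cong[OF d(2) d2(2) is_name_nat is_name_nat feq_mono[OF d3(2) d4(1)] d4(2)])
  ultimately have "feq \<tau> (opair_name r (nat_name r a) (nat_name r b)) d4"
    using feq_trans[OF feq_mono[OF d2(4)]] by blast
  moreover have "(d4, q) \<in> r" using trans[OF trans[OF \<open>(d4, d2) \<in> r\<close> d2(1)] d(1)] .
  ultimately show ?thesis by blast
qed

lemma function_value_unique:
  assumes f: "is_name r f" "forces_function r f p" and q: "(q, p) \<in> r"
    and v: "forces_value f q i v" "forces_value f q i v'"
  shows "v = v'"
proof -
  obtain d \<rho> where d: "(d, q) \<in> r" "is_name r \<rho>"
    "\<And>\<rho>' q'. is_name r \<rho>' \<Longrightarrow> (q', d) \<in> r \<Longrightarrow> fmem \<rho>' (omega_name r) q' \<Longrightarrow>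
      (\<forall>s. (s, q') \<in> r \<longrightarrow> fmem (opair_name r (nat_name r i) \<rho>') f s \<longrightarrow> feq \<rho>' \<rho> s)"
  proof -
    have *: "dense_below r {q. \<exists>\<rho>. is_name r \<rho> \<and> fmem \<rho> (omega_name r) q \<and>
        dense_below r {q. \<exists>\<tau>. is_name r \<tau> \<and> fmem \<tau> f q \<and> feq \<tau> (opair_name r (nat_name r i) \<rho>) q} q \<and>
        (\<forall>\<rho>' q'. is_name r \<rho>' \<longrightarrow> (q', q) \<in> r \<longrightarrow> fmem \<rho>' (omega_name r) q' \<longrightarrow>
          (\<forall>s. (s, q') \<in> r \<longrightarrow>
            dense_below r {q. \<exists>\<tau>. is_name r \<tau> \<and> fmem \<tau> f q \<and> feq \<tau> (opair_name r (nat_name r i)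
                \<rho>') q} s \<longrightarrow>
            feq \<rho>' \<rho> s))} q"
      using f(2) q is_name_nat fmem_nat_omega unfolding forces_function_iff[OF f(1)] by blast
    obtain d \<rho> where d: "(d, q) \<in> r" "is_name r \<rho>"
      and uniq: "\<And>\<rho>' q' s. is_name r \<rho>' \<Longrightarrow> (q', d) \<in> r \<Longrightarrow> fmem \<rho>' (omega_name r) q' \<Longrightarrow> (s, q') \<in> r \<Longrightarrow>
        dense_below r {q. \<exists>\<tau>. is_name r \<tau> \<and> fmem \<tau> f q \<and> feq \<tau> (opair_name r (nat_name r i) \<rho>') q} s \<Longrightarrow>
        feq \<rho>' \<rho> s"
      using dense_belowD[OF * le_refl[OF q]] by blast
    show ?thesis
    proof (rule that[OF d], intro allI impI)
      fix \<rho>' q' s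
      assume \<rho>': "is_name r \<rho>'" and le: "(q', d) \<in> r" "fmem \<rho>' (omega_name r) q'" "(s, q') \<in> r"
        and m: "fmem (opair_name r (nat_name r i) \<rho>') f s"
      show "feq \<rho>' \<rho> s"
        by (rule uniq[OF \<rho>' le feq_opair_fmem[OF is_name_nat \<rho>', THEN iffD2, OF m]])
    qed
  qed
  have eq: "feq (nat_name r w) \<rho> d" if "forces_value f q i w" for w
    using d(3)[OF is_name_nat le_refl[OF d(1)] fmem_nat_omega] le_refl[OF d(1)]
      forces_value_mono[OF that d(1)] unfolding forces_value_def by blast
  show ?thesis
    using nat_name_inject[OF feq_trans[OF eq[OF v(1)] feq_sym[OF eq[OF v(2)]]] FieldI1[OF d(1)]] .
qed

lemma function_value_exists:
  assumes f: "is_name r f" "forces_function r f p" and q: "(q, p) \<in> r"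
  shows "\<exists>d v. (d, q) \<in> r \<and> forces_value f d i v"
proof -
  have "dense_below r {q. \<exists>\<rho>. is_name r \<rho> \<and> fmem \<rho> (omega_name r) q \<and>
      dense_below r {q. \<exists>\<tau>. is_name r \<tau> \<and> fmem \<tau> f q \<and> feq \<tau> (opair_name r (nat_name r i) \<rho>) q} q \<and>
      (\<forall>\<rho>' q'. is_name r \<rho>' \<longrightarrow> (q', q) \<in> r \<longrightarrow> fmem \<rho>' (omega_name r) q' \<longrightarrow>
        (\<forall>s. (s, q') \<in> r \<longrightarrow>
          dense_below r {q. \<exists>\<tau>. is_name r \<tau> \<and> fmem \<tau> f q \<and> feq \<tau> (opair_name r (nat_name r i) \<rho>') q} s \<longrightarrow>
          feq \<rho>' \<rho> s))} q"
    using f(2) q is_name_nat fmem_nat_omega unfolding forces_function_iff[OF f(1)] by blast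
  from dense_belowD[OF this le_refl[OF q]] obtain d \<rho> where d: "(d, q) \<in> r" "is_name r \<rho>" "fmem \<rho>
      (omega_name r) d"
    "dense_below r {q. \<exists>\<tau>. is_name r \<tau> \<and> fmem \<tau> f q \<and> feq \<tau> (opair_name r (nat_name r i) \<rho>) q} d"
    by blast
  have m: "fmem (opair_name r (nat_name r i) \<rho>) f d" using d(4) feq_opair_fmem[OF is_name_nat
      d(2)] by blast
  obtain d2 v where d2: "(d2, d) \<in> r" "feq \<rho> (nat_name r v) d2"
    using dense_belowD[OF d(3)[unfolded fmem_omega] le_refl[OF d(1)]] by blast
  have "feq (opair_name r (nat_name r i) \<rho>) (opair_name r (nat_name r i) (nat_name r v)) d2"
    by (rule opair_cong[OF is_name_nat d(2) is_name_nat is_name_nat feq_refl d2(2)])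
  then have "forces_value f d2 i v"
    unfolding forces_value_def using fmem_cong_left[OF fmem_mono[OF m d2(1)]] by blast
  then show ?thesis using trans[OF d2(1) d(1)] by blast
qed

definition forces_initial :: "('i, 'p) name \<Rightarrow> 'p \<Rightarrow> nat list \<Rightarrow> bool" where
  "forces_initial f p s \<longleftrightarrow> (\<forall>i<length s. forces_value f p i (s ! i))"

lemma forces_initial_mono: "forces_initial f p s \<Longrightarrow> (q, p) \<in> r \<Longrightarrow> forces_initial f q s"
  unfolding forces_initial_def using forces_value_mono by blast

lemma forces_initial_exists:
  assumes f: "is_name r f" "forces_function r f p" and q: "(q, p) \<in> r"
  shows "\<exists>d s. (d, q) \<in> r \<and> length s = L \<and> forces_initial f d s"
proof (induction L)
  case 0
  then show ?case using le_refl[OF q] by (intro exI[of _ q] exI[of _ "[]"]) (simp add: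
      forces_initial_def)
next
  case (Suc L)
  then obtain d s where d: "(d, q) \<in> r" "length s = L" "forces_initial f d s" by blast
  obtain d2 v where d2: "(d2, d) \<in> r" "forces_value f d2 L v"
    using function_value_exists[OF f trans[OF d(1) q]] by blast
  have "forces_initial f d2 (s @ [v])"
    using forces_initial_mono[OF d(3) d2(1)] d2(2) d(2)
    by (auto simp: forces_initial_def nth_append less_Suc_eq)
  then show ?case using trans[OF d2(1) d(1)] d(2) by (intro exI[of _ d2] exI[of _ "s @ [v]"]) simp
qed

lemma forces_initial_unique:
  assumes f: "is_name r f" "forces_function r f p" and q: "(q, p) \<in> r"
    and s: "forces_initial f q s" "forces_initial f q s'" "length s = length s'"
  shows "s = s'"
  using s function_value_unique[OF f q] by (intro nth_equalityI) (auto simp: forces_initial_def)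

lemma is_name_list: "is_name r (list_name r s)"
  unfolding list_name_def by (intro is_name_seq_name is_name_opair is_name_nat)

lemma fmem_list_name: "fmem \<tau> (list_name r s) q \<longleftrightarrow>
    dense_below r {d. \<exists>i<length s. feq \<tau> (opair_name r (nat_name r i) (nat_name r (s ! i))) d} q"
  unfolding list_name_def fmem_seq_name by (rule arg_cong[of _ _ "\<lambda>D. dense_below r D q"]) auto

lemma fmem_list_set_name:
  assumes "s \<in> T"
  shows "fmem (list_name r s) (list_set_name r T) q"
  unfolding list_set_name_def fmem_seq_name
  by (intro dense_belowI2 CollectI exI[of _ "to_nat s"]) (use assms feq_refl in simp)

text \<open>An extension decides the natural number \<open>k\<close> named by \<open>\<nu>\<close>
  and an initial segment \<open>s\<close> of length \<open>k\<close>. The canonical name of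
  \<open>s\<close> then witnesses the formula: the pairs of \<open>s\<close> are forced into
  \<open>f\<close>, and an element of \<open>f\<close> with first coordinate below \<open>k\<close>
  is densely decided to be one of them.\<close>

lemma forces_branch_initials:
  assumes f: "is_name r f" "forces_function r f p" and q: "(q, p) \<in> r"
    and T: "\<And>q' s. (q', q) \<in> r \<Longrightarrow> forces_initial f q' s \<Longrightarrow> s \<in> T"
  shows "forces_branch r f T q"
proof -
  have "dense_below r {q. \<exists>\<sigma>. is_name r \<sigma> \<and> fmem \<sigma> (list_set_name r T) q \<and>
      (\<forall>\<tau>. is_name r \<tau> \<longrightarrow> (\<forall>s. (s, q) \<in> r \<longrightarrow> (fmem \<tau> \<sigma> s \<longleftrightarrow> fmem \<tau> f s \<and>
        dense_below r {d. \<exists>\<mu>. is_name r \<mu> \<and> fmem \<mu> \<nu> d \<and>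
          dense_below r {d. \<exists>\<rho>. is_name r \<rho> \<and> feq \<tau> (opair_name r \<mu> \<rho>) d} d} s)))} q1"
    if \<nu>: "is_name r \<nu>" "fmem \<nu> (omega_name r) q1" and q1: "(q1, q) \<in> r" for \<nu> q1
  proof (rule dense_belowI)
    fix q2 assume q2: "(q2, q1) \<in> r"
    obtain q3 k where q3: "(q3, q2) \<in> r" "feq \<nu> (nat_name r k) q3"
      using dense_belowD[OF \<nu>(2)[unfolded fmem_omega] q2] by blast
    have q3p: "(q3, p) \<in> r" using trans[OF trans[OF trans[OF q3(1) q2] q1] q] .
    obtain q4 s where q4: "(q4, q3) \<in> r" "length s = k" "forces_initial f q4 s"
      using forces_initial_exists[OF f q3p] by blast
    have q4q: "(q4, q) \<in> r" using trans[OF trans[OF trans[OF q4(1) q3(1)] q2] q1] .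
    have "s \<in> T" using T[OF q4q q4(3)] .
    moreover have "fmem \<tau> (list_name r s) t \<longleftrightarrow> fmem \<tau> f t \<and>
        dense_below r {d. \<exists>\<mu>. is_name r \<mu> \<and> fmem \<mu> \<nu> d \<and>
          dense_below r {d. \<exists>\<rho>. is_name r \<rho> \<and> feq \<tau> (opair_name r \<mu> \<rho>) d} d} t"
      if \<tau>: "is_name r \<tau>" and t: "(t, q4) \<in> r" for \<tau> t
    proof
      assume L: "fmem \<tau> (list_name r s) t"
      have *: "fmem \<tau> f d \<and> (\<exists>\<mu>. is_name r \<mu> \<and> fmem \<mu> \<nu> d \<and>
          dense_below r {d. \<exists>\<rho>. is_name r \<rho> \<and> feq \<tau> (opair_name r \<mu> \<rho>) d} d)"
        if d: "(d, t) \<in> r" "i < length s" "feq \<tau> (opair_name r (nat_name r i) (nat_name r (s !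
            i))) d" for d i
      proof (intro conjI exI[of _ "nat_name r i"])
        have dq4: "(d, q4) \<in> r" using trans[OF d(1) t] .
        have "forces_value f d i (s ! i)"
          using forces_initial_mono[OF q4(3) dq4] d(2) by (simp add: forces_initial_def)
        then show "fmem \<tau> f d" unfolding forces_value_def using fmem_cong_left feq_sym d(3) by blast
        show "is_name r (nat_name r i)" by (rule is_name_nat)
        have "feq (nat_name r k) \<nu> d" using feq_sym[OF feq_mono[OF q3(2) trans[OF dq4 q4(1)]]] .
        then show "fmem (nat_name r i) \<nu> d"
          using fmem_cong_right[OF fmem_nat_less] d(2) q4(2) by blast
        show "dense_below r {d. \<exists>\<rho>. is_name r \<rho> \<and> feq \<tau> (opair_name r (nat_name r i) \<rho>) d} d"
          by (intro dense_belowI2 CollectI exI[of _ "nat_name r (s ! i)"] conjI is_name_nat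
              feq_mono[OF d(3)])
      qed
      have "dense_below r {d. \<exists>i<length s. feq \<tau> (opair_name r (nat_name r i) (nat_name r (s !
          i))) d} t"
        using L unfolding fmem_list_name .
      then show "fmem \<tau> f t \<and> dense_below r {d. \<exists>\<mu>. is_name r \<mu> \<and> fmem \<mu> \<nu> d \<and>
          dense_below r {d. \<exists>\<rho>. is_name r \<rho> \<and> feq \<tau> (opair_name r \<mu> \<rho>) d} d} t"
        by (intro conjI fmem_dense) (erule dense_below_subset; use * in blast)+
    next
      assume R: "fmem \<tau> f t \<and> dense_below r {d. \<exists>\<mu>. is_name r \<mu> \<and> fmem \<mu> \<nu> d \<and>
          dense_below r {d. \<exists>\<rho>. is_name r \<rho> \<and> feq \<tau> (opair_name r \<mu> \<rho>) d} d} t"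
      show "fmem \<tau> (list_name r s) t"
        unfolding fmem_list_name
      proof (rule dense_belowI)
        fix u assume u: "(u, t) \<in> r"
        obtain d1 \<mu> where d1: "(d1, u) \<in> r" "is_name r \<mu>" "fmem \<mu> \<nu> d1"
          "dense_below r {d. \<exists>\<rho>. is_name r \<rho> \<and> feq \<tau> (opair_name r \<mu> \<rho>) d} d1"
          using dense_belowD[OF conjunct2[OF R] u] by blast
        obtain d2 \<rho> where d2: "(d2, d1) \<in> r" "feq \<tau> (opair_name r \<mu> \<rho>) d2"
          using dense_belowD[OF d1(4) le_refl[OF d1(1)]] by blast
        have d2t: "(d2, t) \<in> r" using trans[OF trans[OF d2(1) d1(1)] u] .
        have d2q3: "(d2, q3) \<in> r" using trans[OF trans[OF d2t t] q4(1)] .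
        have "fmem \<mu> (nat_name r k) d2"
          by (rule fmem_cong_right[OF fmem_mono[OF d1(3) d2(1)] feq_mono[OF q3(2) d2q3]])
        then obtain d3 j where d3: "(d3, d2) \<in> r" "j < k" "feq \<mu> (nat_name r j) d3"
          unfolding fmem_nat using dense_belowD le_refl[OF d2(1)] by blast
        have d3t: "(d3, t) \<in> r" using trans[OF d3(1) d2t] .
        obtain d4 a b where d4: "(d4, d3) \<in> r" "feq \<tau> (opair_name r (nat_name r a) (nat_name r b)) d4"
          using function_pairs[OF f \<tau> fmem_mono[OF conjunct1[OF R] d3t] trans[OF d3(1) trans[OF
              d2q3 q3p]]]
          by blast
        have d4t: "(d4, t) \<in> r" and d4p: "(d4, p) \<in> r"
          using trans[OF d4(1) d3t] trans[OF d4(1) trans[OF d3(1) trans[OF d2q3 q3p]]] by blast+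
        have "feq (opair_name r \<mu> \<rho>) (opair_name r (nat_name r a) (nat_name r b)) d4"
          using feq_trans[OF feq_sym[OF feq_mono[OF d2(2) trans[OF d4(1) d3(1)]]] d4(2)] .
        then have \<mu>a: "feq \<mu> (nat_name r a) d4" using opair_inject by blast
        have "a = j"
          using nat_name_inject[OF feq_trans[OF feq_sym[OF \<mu>a] feq_mono[OF d3(3) d4(1)]]
              FieldI1[OF d4(1)]] .
        then have ak: "a < length s" using d3(2) q4(2) by simp
        have "forces_value f d4 a b"
          unfolding forces_value_def by (rule fmem_cong_left[OF fmem_mono[OF conjunct1[OF R] d4t]
              d4(2)])
        moreover have "forces_value f d4 a (s ! a)"
          using forces_initial_mono[OF q4(3) trans[OF d4t t]] ak by (simp add: forces_initial_def)
        ultimately have "b = s ! a" using function_value_unique[OF f d4p] by blast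
        then show "\<exists>d\<in>{d. \<exists>i<length s. feq \<tau> (opair_name r (nat_name r i) (nat_name r (s ! i)))
            d}. (d, u) \<in> r"
          using d4(2) ak trans[OF trans[OF d4(1) d3(1)] trans[OF d2(1) d1(1)]] by blast
      qed
    qed
    moreover have "(q4, q2) \<in> r" using trans[OF q4(1) q3(1)] .
    ultimately show "\<exists>d\<in>{q. \<exists>\<sigma>. is_name r \<sigma> \<and> fmem \<sigma> (list_set_name r T) q \<and>
      (\<forall>\<tau>. is_name r \<tau> \<longrightarrow> (\<forall>s. (s, q) \<in> r \<longrightarrow> (fmem \<tau> \<sigma> s \<longleftrightarrow> fmem \<tau> f s \<and>
        dense_below r {d. \<exists>\<mu>. is_name r \<mu> \<and> fmem \<mu> \<nu> d \<and>
          dense_below r {d. \<exists>\<rho>. is_name r \<rho> \<and> feq \<tau> (opair_name r \<mu> \<rho>) d} d} s)))}. (d, q2) \<in> r"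
      by (intro bexI[of _ q4] CollectI exI[of _ "list_name r s"] conjI is_name_list
          fmem_list_set_name) simp_all
  qed
  then show ?thesis
    using f(1)
    by (simp add: forces_branch_def Branch_fm_def forces_BAll forces_BEx forces_Iff forces_Exists
        forces_OPair_fm cong: conj_cong imp_cong)
qed

end

section \<open>Reading off a ground-model tree from a fusion\<close>

context fusion
begin

lemma strong_PP: "strong_PP TYPE('i) r"
  unfolding strong_PP_def
proof (intro allI impI, elim conjE)
  fix h :: "nat \<Rightarrow> nat" and p and f :: "('i, 'p) name"
  assume h: "filterlim h at_top sequentially" and p: "p \<in> Field r" and f: "is_name r f"
      "forces_function r f p"
  define X where "X = {q. (q, p) \<in> r}"
  define E where "E k = {q. \<exists>L\<ge>k. \<exists>S. finite S \<and> card S \<le> h L \<and>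
    (\<forall>q' s. (q', q) \<in> r \<longrightarrow> length s = L \<longrightarrow> forces_initial f q' s \<longrightarrow> s \<in> S)}" for k
  have "\<exists>q. frozen r (C {} p) q p \<and> (\<forall>k. \<exists>s\<in>X \<inter> E k. (q, s) \<in> r)"
  proof (rule limit)
    show "X \<subseteq> Field r" by (auto simp: X_def intro: FieldI1)
    show "p \<in> X" using refl[OF p] by (simp add: X_def)
    fix k q and J :: "'j set" assume qX: "q \<in> X" and J: "finite J"
    then have qp: "(q, p) \<in> r" by (simp add: X_def)
    then have qF: "q \<in> Field r" by (rule FieldI1)
    obtain M where M: "\<And>D. dense_in r D \<Longrightarrow> \<exists>q' D'. frozen r (C J q) q' q \<and> D' \<subseteq> D \<and> finite D' \<and>
        card D' \<le> M \<and>
        (\<forall>t. (t, q') \<in> r \<longrightarrow> (\<exists>d\<in>D'. compatible r d t))"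
      using one_step[OF qF J] by blast
    have "eventually (\<lambda>L. M \<le> h L \<and> k \<le> L) sequentially"
      using h eventually_ge_at_top[of k] unfolding filterlim_at_top by (auto intro: eventually_conj)
    then obtain L where L: "M \<le> h L" "k \<le> L" by (auto simp: eventually_sequentially)
    \<comment> \<open>Conditions incompatible with \<open>q\<close> are included to make
      \<open>D\<close> dense in the whole forcing; an element of \<open>D\<close> compatible with an
      extension of \<open>q\<close> is of the first kind.\<close>
    define D where "D = {d \<in> Field r. ((d, q) \<in> r \<and> (\<exists>s. length s = L \<and> forces_initial f d s)) \<or> \<not>
        compatible r d q}"
    have "dense_in r D"
      unfolding dense_in_def
    proof (intro conjI ballI)
      show "D \<subseteq> Field r" by (auto simp: D_def)
      fix t assume t: "t \<in> Field r"
      show "\<exists>d\<in>D. (d, t) \<in> r"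
      proof (cases "compatible r t q")
        case True
        then obtain u where u: "(u, t) \<in> r" "(u, q) \<in> r" by (auto simp: compatible_def)
        obtain d s where d: "(d, u) \<in> r" "length s = L" "forces_initial f d s"
          using forces_initial_exists[OF f trans[OF u(2) qp]] by blast
        have "(d, q) \<in> r" "(d, t) \<in> r" using trans[OF d(1) u(2)] trans[OF d(1) u(1)] .
        then show ?thesis using d by (intro bexI[of _ d]) (auto simp: D_def intro: FieldI1)
      next
        case False
        then show ?thesis using t refl[OF t] by (intro bexI[of _ t]) (auto simp: D_def)
      qed
    qed
    then obtain q' D' where q': "frozen r (C J q) q' q" "D' \<subseteq> D" "finite D'" "card D' \<le> M"
      "\<And>t. (t, q') \<in> r \<Longrightarrow> \<exists>d\<in>D'. compatible r d t" using M by blast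
    have q'q: "(q', q) \<in> r" using q'(1) by (simp add: frozen_def)
    define w where "w d = (SOME s. length s = L \<and> forces_initial f d s)" for d
    \<comment> \<open>In a common extension of \<open>t\<close> and \<open>d\<close> the initial
      segments forced by both are forced together, so they agree.\<close>
    have "s \<in> w ` D'" if t: "(t, q') \<in> r" and s: "length s = L" "forces_initial f t s" for t s
    proof -
      obtain d u where d: "d \<in> D'" "(u, d) \<in> r" "(u, t) \<in> r" using q'(5)[OF t] by (auto simp:
          compatible_def)
      have uq: "(u, q) \<in> r" using trans[OF d(3) trans[OF t q'q]] .
      then have "compatible r d q" using d(2) by (auto simp: compatible_def)
      then have "\<exists>s. length s = L \<and> forces_initial f d s" using d(1) q'(2) by (auto simp: D_def)
      then have "length (w d) = L \<and> forces_initial f d (w d)" unfolding w_def by (rule someI_ex)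
      then have "w d = s"
        using forces_initial_unique[OF f trans[OF uq qp]] forces_initial_mono d(2,3) s by metis
      then show ?thesis using d(1) by blast
    qed
    moreover have "card (w ` D') \<le> h L" using card_image_le[OF q'(3), of w] q'(4) L(1) by simp
    ultimately have "q' \<in> E k" using L(2) q'(3) unfolding E_def by blast
    moreover have "q' \<in> X" using trans[OF q'q qp] by (simp add: X_def)
    ultimately show "\<exists>q'\<in>X \<inter> E k. frozen r (C J q) q' q" using q'(1) by blast
  qed simp
  then obtain q where q: "frozen r (C {} p) q p" "\<And>k. \<exists>s\<in>X \<inter> E k. (q, s) \<in> r" by blast
  have qp: "(q, p) \<in> r" using q(1) by (simp add: frozen_def)
  \<comment> \<open>All initial segments forced by some extension of \<open>q\<close> are collected,
    so that no possibility is lost; the set \<open>E k\<close> bounds a level of \<open>T\<close> at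
    some length \<open>L \<ge> k\<close>.\<close>
  define T where "T = {s. \<exists>q'. (q', q) \<in> r \<and> forces_initial f q' s}"
  have "seq_tree T"
    unfolding seq_tree_def
  proof (intro allI impI, elim conjE)
    fix s t :: "nat list" assume "t \<in> T" and st: "prefix s t"
    then obtain q' where q': "(q', q) \<in> r" "forces_initial f q' t" by (auto simp: T_def)
    obtain u where "t = s @ u" using st by (rule prefixE)
    then have "i < length t \<and> t ! i = s ! i" if "i < length s" for i using that by (simp add:
        nth_append)
    then have "forces_initial f q' s" using q'(2) unfolding forces_initial_def by metis
    then show "s \<in> T" using q'(1) by (auto simp: T_def)
  qed
  moreover have "\<exists>\<^sub>\<infinity>k. finite {s \<in> T. length s = k} \<and> card {s \<in> T. length s = k} \<le> h k"
    unfolding INFM_nat_le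
  proof
    fix k
    obtain t where t: "t \<in> E k" "(q, t) \<in> r" using q(2) by blast
    then obtain L S where L: "k \<le> L" "finite S" "card S \<le> h L"
      "\<And>q' s. (q', t) \<in> r \<Longrightarrow> length s = L \<Longrightarrow> forces_initial f q' s \<Longrightarrow> s \<in> S" by (auto simp: E_def)
    have sub: "{s \<in> T. length s = L} \<subseteq> S" using L(4) trans[OF _ t(2)] by (auto simp: T_def)
    then have "finite {s \<in> T. length s = L} \<and> card {s \<in> T. length s = L} \<le> h L"
      using finite_subset[OF sub L(2)] order_trans[OF card_mono[OF L(2) sub] L(3)] by simp
    then show "\<exists>n\<ge>k. finite {s \<in> T. length s = n} \<and> card {s \<in> T. length s = n} \<le> h n" using L(1)
        by blast
  qed
  moreover have "forces_branch r f T q"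
    by (rule forces_branch_initials[OF f qp]) (auto simp: T_def)
  ultimately show "\<exists>q T. (q, p) \<in> r \<and> seq_tree T \<and>
      (\<exists>\<^sub>\<infinity>k. finite {s \<in> T. length s = k} \<and> card {s \<in> T. length s = k} \<le> h k) \<and> forces_branch r f T q"
    using qp by blast
qed

end

theorem theorem2p4:
  fixes F :: "nat filter" and T0 :: "nat rel"
  assumes "F \<noteq> bot"
    and "F \<le> cofinite"
    and "P_filter F"
    and "ccc_space (subtopology omega_star_topology (filter_closed_set F))"
    and "is_tree T0"
    and "Field T0 \<in> dual_ideal F"
    and "full_binary T0"
  shows "(\<forall>\<alpha> :: nat rel. Well_order \<alpha> \<longrightarrow> alpha_proper TYPE('m) \<alpha> (Q_forcing F T0)) \<and>
         strong_PP TYPE('i) (Q_forcing F T0)"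
proof -
  interpret tree_forcing F T0
    using assms by unfold_locales
  interpret fusion QF one_pt by (rule fusion_QF)
  show ?thesis using alpha_proper strong_PP by blast
qed

end
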